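(* Let $k\in\mathbb N$ satisfy $1<k<n/2$, let $\Sigma^p\subset\mathbb S^n$ be a (nonempty, proper) closed smooth embedded submanifold of dimension $p$, and let $g=v^{-2}g_{\mathbb S^n}$ be a complete conformal metric on $\mathbb S^n\setminus\Sigma$, where $v>0$ is a smooth function on $\mathbb S^n\setminus\Sigma$. Assume that on $\mathbb S^n\setminus\Sigma$ \[ \lambda(g^{-1}A_g)\in\Gamma_k^+,\qquad \sigma_k(g^{-1}A_g)\equiv\kappa \] for a constant $\kappa>0$. Assume in addition that \[ 0<L_*:=\limsup_{x\to\Sigma}\frac{v(x)}{\operatorname{dist}(x,\Sigma)}<\infty . \] Then \[ p<p_k(n). \]
   Context: $g_{\mathbb S^n}$ is the standard round metric on $\mathbb S^n$ and $\operatorname{dist}$ is the distance in $\mathbb S^n$. For a Riemannian metric $g$ in dimension $n\ge 3$ the Schouten tensor is $A_g=\frac{1}{n-2}\bigl(\operatorname{Ric}_g-\frac{R_g}{2(n-1)}g\bigr)$, where $R_g$ is the scalar curvature. $\lambda(g^{-1}A_g)$ is the vector of eigenvalues of $g^{-1}A_g$, and $\sigma_j$ is the $j$-th elementary symmetric function of the eigenvalues. $\Gamma_k^+=\{\lambda\in\mathbb R^n:\sigma_1(\lambda)>0,\ldots,\sigma_k(\lambda)>0\}$ is the Gårding cone. For $1\le j\le k$ put \[ c_{n,p,j}:=\sum_{i=0}^j(-1)^{j-i}\binom{n-p-1}{i}\binom{p+1}{j-i}, \] with the binomial coefficients extended polynomially to real $p$, and define \[ p_k(n):=\sup\{p\ge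 0 \ (p\in\mathbb R):\ c_{n,p,j}>0\text{ for }1\le j\le k\}. \] *)

theory Defs
  imports "HOL-Analysis.Analysis"
begin

text \<open>\<open>\<real>\<^sup>n\<^sup>+\<^sup>1\<close> is modelled as \<open>\<real>\<^sup>n \<times> \<real>\<close>, with \<open>n = CARD('n)\<close>; its inner product is the Euclidean one.\<close>

abbreviation Sph :: "((real^'n) \<times> real) set" where
  "Sph \<equiv> sphere 0 1"

text \<open>These predicates are meant for open sets only: derivatives are taken in the full neighbourhood.\<close>

primrec Ck_on :: "nat \<Rightarrow> 'a::real_normed_vector set \<Rightarrow> ('a \<Rightarrow> 'b::real_normed_vector) \<Rightarrow> bool" where
  "Ck_on 0 U f \<longleftrightarrow> continuous_on U f"
| "Ck_on (Suc m) U f \<longleftrightarrow> (\<forall>x\<in>U. f differentiable (at x)) \<and>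
     (\<forall>h. Ck_on m U (\<lambda>x. frechet_derivative f (at x) h))"

definition smooth_on :: "'a::real_normed_vector set \<Rightarrow> ('a \<Rightarrow> 'b::real_normed_vector) \<Rightarrow> bool" where
  "smooth_on U f \<longleftrightarrow> (\<forall>m. Ck_on m U f)"

text \<open>Local smooth parametrizations of \<open>\<S>\<^sup>n\<close>, i.e. inverses of its coordinate charts.\<close>

definition sph_param :: "(real^'n) set \<Rightarrow> (real^'n \<Rightarrow> (real^'n) \<times> real) \<Rightarrow> bool" where
  "sph_param U \<phi> \<longleftrightarrow> open U \<and> smooth_on U \<phi> \<and>
     openin (top_of_set Sph) (\<phi> ` U) \<and>
     (\<exists>\<psi>. homeomorphism U (\<phi> ` U) \<phi> \<psi>) \<and>
     (\<forall>x\<in>U. inj (frechet_derivative \<phi> (at x)))"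

text \<open>Smooth real functions on a relatively open subset \<open>\<Omega>\<close> of \<open>\<S>\<^sup>n\<close>: smooth in every chart.\<close>

definition sph_smooth_on :: "((real^'n) \<times> real) set \<Rightarrow> ((real^'n) \<times> real \<Rightarrow> real) \<Rightarrow> bool" where
  "sph_smooth_on \<Omega> f \<longleftrightarrow>
     (\<forall>U \<phi>. sph_param U \<phi> \<and> \<phi> ` U \<subseteq> \<Omega> \<longrightarrow> smooth_on U (\<lambda>x. f (\<phi> x)))"

text \<open>Closed (compact, without boundary) embedded \<open>p\<close>-dimensional submanifolds of \<open>\<S>\<^sup>n\<close>, by slice charts.\<close>

definition closed_submanifold :: "nat \<Rightarrow> ((real^'n) \<times> real) set \<Rightarrow> bool" where
  "closed_submanifold p M \<longleftrightarrow> compact M \<and> M \<subseteq> Sph \<and>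
     (\<forall>q\<in>M. \<exists>U \<phi> L. sph_param U \<phi> \<and> q \<in> \<phi> ` U \<and> subspace L \<and> dim L = p \<and>
        M \<inter> \<phi> ` U = \<phi> ` (U \<inter> L))"

text \<open>Length of a piecewise \<open>C\<^sup>1\<close> curve for the metric \<open>v\<^sup>-\<^sup>2 g\<close>, where \<open>g\<close> is the round metric (\<open>v > 0\<close>).
  The nonnegative integral is used because \<^const>\<open>valid_path\<close> allows the speed to be unbounded near
  the break points; such a curve may have infinite length.\<close>

definition conf_length ::
    "((real^'n) \<times> real \<Rightarrow> real) \<Rightarrow> (real \<Rightarrow> (real^'n) \<times> real) \<Rightarrow> ennreal" where
  "conf_length v \<gamma> =
     (\<integral>\<^sup>+ t\<in>{0..1}. ennreal (norm (vector_derivative \<gamma> (at t)) / v (\<gamma> t)) \<partial>lborel)"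

text \<open>The value is infinite for points in different components of \<open>\<Omega>\<close>.\<close>

definition conf_dist :: "((real^'n) \<times> real) set \<Rightarrow> ((real^'n) \<times> real \<Rightarrow> real) \<Rightarrow>
    (real^'n) \<times> real \<Rightarrow> (real^'n) \<times> real \<Rightarrow> ennreal" where
  "conf_dist \<Omega> v x y =
     (INF \<gamma> \<in> {\<gamma>. valid_path \<gamma> \<and> path_image \<gamma> \<subseteq> \<Omega> \<and> pathstart \<gamma> = x \<and> pathfinish \<gamma> = y}.
        conf_length v \<gamma>)"

definition conf_complete :: "((real^'n) \<times> real) set \<Rightarrow> ((real^'n) \<times> real \<Rightarrow> real) \<Rightarrow> bool" where
  "conf_complete \<Omega> v \<longleftrightarrow>
     (\<forall>s :: nat \<Rightarrow> (real^'n) \<times> real. range s \<subseteq> \<Omega> \<and>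
        (\<forall>e>0. \<exists>N. \<forall>i\<ge>N. \<forall>j\<ge>N. conf_dist \<Omega> v (s i) (s j) < e) \<longrightarrow>
        (\<exists>l\<in>\<Omega>. (\<lambda>i. conf_dist \<Omega> v (s i) l) \<longlonglongrightarrow> 0))"

definition sph_dist :: "(real^'n) \<times> real \<Rightarrow> (real^'n) \<times> real \<Rightarrow> real" where
  "sph_dist x y = enn2real (conf_dist Sph (\<lambda>_. 1) x y)"

definition sph_setdist :: "(real^'n) \<times> real \<Rightarrow> ((real^'n) \<times> real) set \<Rightarrow> real" where
  "sph_setdist x M = (INF y\<in>M. sph_dist x y)"

text \<open>The filter \<open>x \<rightarrow> M\<close>, with \<open>x\<close> in \<open>\<S>\<^sup>n\<close> minus \<open>M\<close>.\<close>

definition approaching :: "((real^'n) \<times> real) set \<Rightarrow> ((real^'n) \<times> real) filter" where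
  "approaching M = (INF e\<in>{0<..}. principal {x \<in> Sph - M. sph_setdist x M < e})"

definition pd :: "'n \<Rightarrow> (real^'n \<Rightarrow> 'b::real_normed_vector) \<Rightarrow> real^'n \<Rightarrow> 'b" where
  "pd i f x = frechet_derivative f (at x) (axis i 1)"

text \<open>Below, \<open>G\<close> is the coefficient matrix of a Riemannian metric in coordinates.
  \<open>christoffel G l i j\<close> is \<open>\<Gamma>\<^sup>l\<^sub>i\<^sub>j\<close>, and \<open>riemann G l k i j\<close> is the \<open>l\<close>-th component of \<open>R(\<partial>\<^sub>i, \<partial>\<^sub>j) \<partial>\<^sub>k\<close> with
  \<open>R(X, Y) Z = \<nabla>\<^sub>X \<nabla>\<^sub>Y Z - \<nabla>\<^sub>Y \<nabla>\<^sub>X Z - \<nabla>\<^bsub>[X,Y]\<^esub> Z\<close>; round spheres have positive Ricci curvature.\<close>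

definition christoffel ::
    "(real^'n \<Rightarrow> real^'n^'n) \<Rightarrow> 'n \<Rightarrow> 'n \<Rightarrow> 'n \<Rightarrow> real^'n \<Rightarrow> real" where
  "christoffel G l i j x = (\<Sum>m\<in>UNIV. matrix_inv (G x) $ l $ m *
     (pd i (\<lambda>y. G y $ j $ m) x + pd j (\<lambda>y. G y $ i $ m) x - pd m (\<lambda>y. G y $ i $ j) x)) / 2"

definition riemann ::
    "(real^'n \<Rightarrow> real^'n^'n) \<Rightarrow> 'n \<Rightarrow> 'n \<Rightarrow> 'n \<Rightarrow> 'n \<Rightarrow> real^'n \<Rightarrow> real" where
  "riemann G l k i j x =
     pd i (christoffel G l j k) x - pd j (christoffel G l i k) x +
     (\<Sum>m\<in>UNIV. christoffel G l i m x * christoffel G m j k x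
               - christoffel G l j m x * christoffel G m i k x)"

definition ricci :: "(real^'n \<Rightarrow> real^'n^'n) \<Rightarrow> real^'n \<Rightarrow> real^'n^'n" where
  "ricci G x = (\<chi> j k. \<Sum>i\<in>UNIV. riemann G i k i j x)"

definition scalar_curv :: "(real^'n \<Rightarrow> real^'n^'n) \<Rightarrow> real^'n \<Rightarrow> real" where
  "scalar_curv G x = (\<Sum>i\<in>UNIV. \<Sum>j\<in>UNIV. matrix_inv (G x) $ i $ j * ricci G x $ i $ j)"

definition schouten :: "(real^'n \<Rightarrow> real^'n^'n) \<Rightarrow> real^'n \<Rightarrow> real^'n^'n" where
  "schouten G x = (1 / (real CARD('n) - 2)) *\<^sub>R
     (ricci G x - (scalar_curv G x / (2 * (real CARD('n) - 1))) *\<^sub>R G x)"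

text \<open>Coefficients of \<open>v\<^sup>-\<^sup>2 g\<close>, with \<open>g\<close> the round metric, in the parametrization \<open>\<phi>\<close>.\<close>

definition conf_metric :: "((real^'n) \<times> real \<Rightarrow> real) \<Rightarrow> (real^'n \<Rightarrow> (real^'n) \<times> real) \<Rightarrow>
    real^'n \<Rightarrow> real^'n^'n" where
  "conf_metric v \<phi> x = (\<chi> i j. (pd i \<phi> x \<bullet> pd j \<phi> x) / (v (\<phi> x))\<^sup>2)"

text \<open>\<open>lam\<close> lists the eigenvalues of \<open>A\<close> with multiplicity: \<open>det (t I - A) = \<Prod>\<^sub>i (t - lam\<^sub>i)\<close>.\<close>

definition eigenvalue_vector :: "real^'n^'n \<Rightarrow> real^'n \<Rightarrow> bool" where
  "eigenvalue_vector A lam \<longleftrightarrow> (\<forall>t. det (mat t - A) = (\<Prod>i\<in>UNIV. t - lam $ i))"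

definition esym :: "nat \<Rightarrow> real^'n \<Rightarrow> real" where
  "esym j lam = (\<Sum>I | card I = j. \<Prod>i\<in>I. lam $ i)"

definition garding_cone :: "nat \<Rightarrow> (real^'n) set" where
  "garding_cone k = {lam. \<forall>j\<in>{1..k}. esym j lam > 0}"

definition c_coeff :: "nat \<Rightarrow> real \<Rightarrow> nat \<Rightarrow> real" where
  "c_coeff n p j =
     (\<Sum>i=0..j. (-1) ^ (j - i) * ((real n - p - 1) gchoose i) * ((p + 1) gchoose (j - i)))"

text \<open>For \<open>1 \<le> k < n/2\<close> the set contains \<open>0\<close> and, by the condition for \<open>j = 1\<close>, is bounded by \<open>(n - 2)/2\<close>,
  so this is a genuine supremum.\<close>

definition p_crit :: "nat \<Rightarrow> nat \<Rightarrow> real" where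
  "p_crit k n = Sup {p. p \<ge> 0 \<and> (\<forall>j\<in>{1..k}. c_coeff n p j > 0)}"

end

theory Submission
  imports Defs "HOL-Computational_Algebra.Fundamental_Theorem_Algebra"
begin

text \<open>
  In stereographic coordinates with a pole outside \<open>M\<close> the metric is \<open>u\<^sup>-\<^sup>2 \<delta>\<close>, so that
  \<open>g\<^sup>-\<^sup>1 A\<^sub>g = u D\<^sup>2u - \<bar>Du\<bar>\<^sup>2/2\<close>, and \<open>limsup u / dist\<close> at the preimage of \<open>M\<close> is still \<open>L\<^sub>*\<close>.
  At a point where \<open>u / dist\<close> is almost \<open>L\<^sub>*\<close>, at distance \<open>d\<close> from \<open>M\<close>, the submanifold agrees up to
  \<open>o(d)\<close> with an affine \<open>p\<close>-plane on the scale \<open>d\<close>. Hence \<open>u\<close> lies below \<open>L\<^sub>* dist(\<cdot>, plane)\<close> up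
  to \<open>o(d)\<close> and, after a small quadratic perturbation, touches it from below at some point \<open>y\<close>.
  There \<open>g\<^sup>-\<^sup>1 A\<^sub>g \<le> L\<^sub>*\<^sup>2/2 diag(1, \<dots>, 1, -1, \<dots>, -1) + o(1)\<close>, with \<open>n - p - 1\<close> positive and
  \<open>p + 1\<close> negative entries. Monotonicity of the \<open>\<sigma>\<^sub>j\<close> on the Garding cone, \<open>\<sigma>\<^sub>k = \<kappa> > 0\<close> and
  log-concavity of \<open>j \<mapsto> \<sigma>\<^sub>j\<close> (Newton) bound \<open>\<sigma>\<^sub>j\<close> of the limit matrix away from \<open>0\<close>, which says
  \<open>c\<^bsub>n,p,j\<^esub> > 0\<close> for \<open>j \<le> k\<close>. This is an open condition on \<open>p\<close>, so \<open>p\<close> is strictly below the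
  supremum.
\<close>

section \<open>Elementary symmetric functions on the Garding cone\<close>

text \<open>In the model u = L_* h, with h the distance to a p-plane, the Hessian of h vanishes
  along the plane and along Dh, so u D^2u - |Du|^2/2 is -L_*^2/2 on these p + 1 directions; on the
  other n - p - 1 directions h D^2h is the identity and L_*^2 - L_*^2/2 remains. The hypothesis on v
  is only a limsup, so the derivatives of u near M are not controlled. Contact from below transfers
  an upper bound on the Hessian, which is the direction in which the \<sigma>_j are monotone on the
  cone. As -|Du|^2/2 enters with a minus sign, |Du| must be bounded below as well: at the contact
  point the value agrees with the model up to o(d) and the gradient up to o(1). Passing to the limit
  in \<sigma>_j > 0 alone would give only c \<ge> 0. The equation keeps \<sigma>_k at least \<kappa>
  after the perturbation, \<sigma>_0 is 1, and a positive log-concave sequence is never below both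
  of its ends, so min(1, \<kappa>) bounds \<sigma>_j independently of the error.\<close>

lemma coeff_prod_one_linear:
  fixes f :: "'a \<Rightarrow> 'b::comm_ring_1"
  assumes "finite A"
  shows "coeff (\<Prod>i\<in>A. [:1, f i:]) j = (\<Sum>I | I \<subseteq> A \<and> card I = j. \<Prod>i\<in>I. f i)"
proof -
  have "(\<Prod>i\<in>A. [:1, f i:]) = (\<Prod>i\<in>A. monom (f i) 1 + 1)"
    by (intro prod.cong refl) (simp add: monom_altdef one_pCons)
  also have "\<dots> = (\<Sum>X\<in>Pow A. \<Prod>x\<in>X. monom (f x) 1)"
    by (subst prod_add[OF assms]) simp
  also have "\<dots> = (\<Sum>X\<in>Pow A. monom (\<Prod>x\<in>X. f x) (card X))"
  proof (intro sum.cong refl)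
    fix X assume "X \<in> Pow A"
    hence "finite X" using assms finite_subset by blast
    thus "(\<Prod>x\<in>X. monom (f x) 1) = monom (\<Prod>x\<in>X. f x) (card X)"
      by induction (auto simp: mult_monom)
  qed
  finally have "coeff (\<Prod>i\<in>A. [:1, f i:]) j
      = (\<Sum>X\<in>Pow A. if card X = j then \<Prod>x\<in>X. f x else 0)"
    by (simp add: coeff_sum)
  also have "\<dots> = (\<Sum>X\<in>{X\<in>Pow A. card X = j}. \<Prod>x\<in>X. f x)"
    using assms by (intro sum.inter_filter[symmetric]) auto
  finally show ?thesis by (simp add: Collect_conj_eq Pow_def)
qed

text \<open>As coefficients of a product of linear factors these are open to arguments on roots, and
  an arbitrary index set allows an entry to be deleted.\<close>

definition esym_on :: "('a \<Rightarrow> real) \<Rightarrow> 'a set \<Rightarrow> nat \<Rightarrow> real" where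
  "esym_on f A j = coeff (\<Prod>i\<in>A. [:1, f i:]) j"

lemma esym_eq_esym_on: "esym j lam = esym_on (\<lambda>i. lam $ i) UNIV j"
  by (simp add: esym_def esym_on_def coeff_prod_one_linear)

lemma esym_on_0: "esym_on f A 0 = 1"
  by (simp add: esym_on_def flip: poly_0_coeff_0) (simp add: poly_prod)

lemma esym_on_Suc:
  assumes "finite A" "i \<in> A"
  shows "esym_on f A (Suc j) = esym_on f (A - {i}) (Suc j) + f i * esym_on f (A - {i}) j"
  unfolding esym_on_def using assms by (subst prod.remove[of A i]) auto

section \<open>Newton's inequalities from real-rootedness\<close>

definition real_rooted :: "complex poly \<Rightarrow> bool" where
  "real_rooted p \<longleftrightarrow> (\<forall>j. coeff p j \<in> \<real>) \<and> (p = 0 \<or> (\<forall>z. poly p z = 0 \<longrightarrow> z \<in> \<real>))"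

lemma real_rooted_factorization:
  assumes "real_rooted p"
  obtains c n r where "p = smult (of_real c) (\<Prod>i<(n::nat). [:- of_real (r i), 1:])"
proof (cases "p = 0")
  case True
  thus ?thesis using that[where c = 0 and n = 0 and r = "\<lambda>_. 0"] by simp
next
  case False
  obtain root where root: "smult (lead_coeff p) (\<Prod>i<degree p. [:-root i, 1:]) = p"
    using complex_poly_decompose' .
  have "root i \<in> \<real>" if "i < degree p" for i
  proof -
    have "poly p (root i) = 0"
      by (subst root[symmetric]) (use that in \<open>auto simp: poly_prod prod_zero_iff\<close>)
    thus ?thesis using assms False by (auto simp: real_rooted_def)
  qed
  hence "(\<Prod>i<degree p. [:-root i, 1:]) = (\<Prod>i<degree p. [:- of_real (Re (root i)), 1:])"
    by (intro prod.cong) auto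
  moreover have "lead_coeff p = of_real (Re (lead_coeff p))"
    using assms by (auto simp: real_rooted_def)
  ultimately have "p = smult (of_real (Re (lead_coeff p)))
      (\<Prod>i<degree p. [:- of_real (Re (root i)), 1:])"
    using root by metis
  thus ?thesis by (rule that)
qed

text \<open>Gauss-Lucas for real roots: q'/q is the sum of the 1/(z - r_i), each with imaginary part
  of sign opposite to Im z. Multiplying by |q|^2 gives the division-free form that the induction
  carries; s > 0 excludes non-real zeros of q'.\<close>

lemma Gauss_Lucas_product:
  fixes r :: "nat \<Rightarrow> real"
  defines "q \<equiv> \<lambda>n. \<Prod>i<n. [:- of_real (r i), 1:] :: complex poly"
  assumes z: "Im z \<noteq> 0"
  shows "poly (q n) z \<noteq> 0 \<and>
    (\<exists>s\<ge>0. Im (poly (pderiv (q n)) z * cnj (poly (q n) z)) = - Im z * s \<and> (n > 0 \<longrightarrow> s > 0))"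
proof (induction n)
  case 0
  show ?case by (auto simp: q_def pderiv_1 intro: exI[of _ 0])
next
  case (Suc n)
  then obtain s where s: "poly (q n) z \<noteq> 0" "s \<ge> 0"
    "Im (poly (pderiv (q n)) z * cnj (poly (q n) z)) = - Im z * s" by auto
  have q: "q (Suc n) = q n * [:- of_real (r n), 1:]" by (simp add: q_def)
  have ne: "z - of_real (r n) \<noteq> 0" using z by (auto simp: complex_eq_iff)
  define w where "w = z - of_real (r n)"
  define a where "a = poly (q n) z"
  define b where "b = poly (pderiv (q n)) z"
  have 1: "poly (q (Suc n)) z = a * w" unfolding q a_def w_def by (simp add: algebra_simps)
  have 2: "poly (pderiv (q (Suc n))) z = a + b * w"
    unfolding q a_def w_def b_def pderiv_mult by (simp add: pderiv_pCons algebra_simps)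
  have "(a + b * w) * cnj (a * w) = (b * cnj a) * (w * cnj w) + (a * cnj a) * cnj w"
    by (simp add: algebra_simps)
  hence "Im ((a + b * w) * cnj (a * w)) = Im (b * cnj a) * (cmod w)\<^sup>2 + (cmod a)\<^sup>2 * Im (cnj w)"
    by (simp flip: complex_norm_square of_real_power)
  also have "\<dots> = - Im z * (s * (cmod w)\<^sup>2 + (cmod a)\<^sup>2)"
    unfolding s(3)[folded a_def b_def] by (simp add: w_def algebra_simps)
  finally have "Im (poly (pderiv (q (Suc n))) z * cnj (poly (q (Suc n)) z))
     = - Im z * (s * (cmod w)\<^sup>2 + (cmod a)\<^sup>2)" unfolding 1 2 .
  moreover have "s * (cmod w)\<^sup>2 + (cmod a)\<^sup>2 > 0"
    using s by (intro add_nonneg_pos) (auto simp: a_def)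
  ultimately show ?case using s ne unfolding 1 a_def w_def by (metis less_imp_le mult_eq_0_iff)
qed

lemma real_rooted_pderiv:
  assumes "real_rooted p"
  shows "real_rooted (pderiv p)"
proof -
  have "coeff (pderiv p) j \<in> \<real>" for j
    using assms by (auto simp: coeff_pderiv real_rooted_def simp del: of_nat_Suc)
  moreover have "z \<in> \<real>" if nz: "pderiv p \<noteq> 0" and z: "poly (pderiv p) z = 0" for z
  proof (rule ccontr)
    assume "z \<notin> \<real>"
    hence Im: "Im z \<noteq> 0" by (auto simp: complex_is_Real_iff)
    obtain c n r where p: "p = smult (of_real c) (\<Prod>i<(n::nat). [:- of_real (r i), 1:])"
      using real_rooted_factorization[OF assms] .
    have "c \<noteq> 0" "n > 0" using nz unfolding p by (auto simp: pderiv_smult intro!: gr0I)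
    with Gauss_Lucas_product[OF Im, where n = n and r = r] z Im show False
      unfolding p by (auto simp: pderiv_smult)
  qed
  ultimately show ?thesis by (auto simp: real_rooted_def)
qed

text \<open>Laguerre's inequality at 0: formally q'^2 - q q'' is q^2 times the sum of the 1/(z -
  r_i)^2. The induction avoids this quotient because some r_i may be 0.\<close>

lemma Laguerre_product:
  fixes r :: "nat \<Rightarrow> real"
  defines "q \<equiv> \<lambda>n. \<Prod>i<n. [:- of_real (r i), 1:] :: complex poly"
  shows "poly (q n) 0 \<in> \<real> \<and> (\<exists>s\<ge>0. (poly (pderiv (q n)) 0)\<^sup>2
    - poly (q n) 0 * poly (pderiv (pderiv (q n))) 0 = of_real s)"
proof (induction n)
  case 0
  show ?case by (auto simp: q_def)
next
  case (Suc n)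
  then obtain s a where s: "s \<ge> 0" "(poly (pderiv (q n)) 0)\<^sup>2
    - poly (q n) 0 * poly (pderiv (pderiv (q n))) 0 = of_real s"
    and a: "poly (q n) 0 = of_real a" by (auto elim!: Reals_cases)
  have q: "q (Suc n) = q n * [:- of_real (r n), 1:]" by (simp add: q_def)
  define b where "b = poly (pderiv (q n)) 0"
  define d where "d = poly (pderiv (pderiv (q n))) 0"
  have 0: "poly (q (Suc n)) 0 = - of_real (a * r n)"
    unfolding q by (simp add: a)
  have 1: "poly (pderiv (q (Suc n))) 0 = of_real a - b * of_real (r n)"
    unfolding q b_def pderiv_mult by (simp add: a pderiv_pCons)
  have 2: "poly (pderiv (pderiv (q (Suc n)))) 0 = 2 * b - d * of_real (r n)"
    unfolding q b_def d_def pderiv_mult by (simp add: pderiv_pCons pderiv_add pderiv_mult pderiv_smult pderiv_diff)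
  have "(of_real a - b * of_real (r n))\<^sup>2 - (- of_real (a * r n)) * (2 * b - d * of_real (r n))
     = of_real (a\<^sup>2) + (of_real (r n))\<^sup>2 * (b\<^sup>2 - of_real a * d)"
    by (simp add: power2_eq_square algebra_simps)
  also have "\<dots> = of_real (a\<^sup>2 + (r n)\<^sup>2 * s)" using s(2) unfolding b_def d_def a by simp
  finally show ?case using s(1) unfolding 0 1 2
    by (intro conjI exI[of _ "a\<^sup>2 + (r n)\<^sup>2 * s"]) auto
qed

text \<open>For j = 0 this is Laguerre's inequality at 0. Differentiation preserves real-rootedness
  and moves coefficient k + 1 to place k with a factor k + 1, which gives the general case after
  cancelling (j + 1)(j + 2). The weights are those of Newton's inequality without the factor that
  depends on the degree.\<close>

lemma real_rooted_Newton:
  assumes "real_rooted p"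
  shows "real (j + 2) * Re (coeff p j) * Re (coeff p (j + 2)) \<le> real (j + 1) * (Re (coeff p (j + 1)))\<^sup>2"
  using assms
proof (induction j arbitrary: p)
  case 0
  obtain c n r where p: "p = smult (of_real c) (\<Prod>i<(n::nat). [:- of_real (r i), 1:])"
    using real_rooted_factorization[OF 0] .
  define q :: "complex poly" where "q = (\<Prod>i<n. [:- of_real (r i), 1:])"
  obtain s where s: "s \<ge> 0" "(poly (pderiv q) 0)\<^sup>2 - poly q 0 * poly (pderiv (pderiv q)) 0 = of_real s"
    using Laguerre_product[of r n] unfolding q_def by auto
  have e: "p = smult (of_real c) q" using p by (simp add: q_def)
  have "(poly (pderiv p) 0)\<^sup>2 - poly p 0 * poly (pderiv (pderiv p)) 0 = of_real (c\<^sup>2 * s)"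
    unfolding e pderiv_smult poly_smult of_real_mult s(2)[symmetric]
    by (simp add: power2_eq_square algebra_simps)
  hence "(coeff p 1)\<^sup>2 - coeff p 0 * (2 * coeff p 2) = of_real (c\<^sup>2 * s)"
    by (simp add: poly_0_coeff_0 coeff_pderiv numeral_2_eq_2)
  moreover have "coeff p k = of_real (Re (coeff p k))" for k
    using 0 by (auto simp: real_rooted_def)
  then obtain e where e: "\<And>k. coeff p k = of_real (e k)" by (rule that)
  ultimately have "of_real ((e 1)\<^sup>2 - e 0 * (2 * e 2)) = (of_real (c\<^sup>2 * s) :: complex)"
    by (simp only: of_real_diff of_real_mult of_real_power of_real_numeral)
  hence "(e 1)\<^sup>2 - e 0 * (2 * e 2) = c\<^sup>2 * s" by (simp only: of_real_eq_iff)
  moreover have "c\<^sup>2 * s \<ge> 0" using s by simp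
  ultimately show ?case by (simp add: e algebra_simps eval_nat_numeral)
next
  case (Suc j)
  have "real (j + 2) * Re (coeff (pderiv p) j) * Re (coeff (pderiv p) (j + 2))
    \<le> real (j + 1) * (Re (coeff (pderiv p) (j + 1)))\<^sup>2"
    by (rule Suc.IH[OF real_rooted_pderiv[OF Suc.prems]])
  moreover have "Re (coeff (pderiv p) k) = real (Suc k) * Re (coeff p (Suc k))" for k
    by (simp add: coeff_pderiv del: of_nat_Suc)
  ultimately have "real (j + 1) * real (j + 2) * (real (j + 3) * Re (coeff p (j + 1)) * Re (coeff p (j + 3)))
     \<le> real (j + 1) * real (j + 2) * (real (j + 2) * (Re (coeff p (j + 2)))\<^sup>2)"
    by (simp add: power2_eq_square eval_nat_numeral algebra_simps)
  hence "real (j + 3) * Re (coeff p (j + 1)) * Re (coeff p (j + 3)) \<le> real (j + 2) * (Re (coeff p (j + 2)))\<^sup>2"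
    by (subst (asm) mult_le_cancel_left_pos) simp_all
  thus ?case by (simp add: eval_nat_numeral)
qed

text \<open>The zeros of the product of the 1 + f_i z are the -1/f_i with f_i nonzero, hence
  real.\<close>

lemma esym_on_Newton:
  assumes "finite A"
  shows "real (j + 2) * esym_on f A j * esym_on f A (j + 2) \<le> real (j + 1) * (esym_on f A (j + 1))\<^sup>2"
proof -
  define p :: "complex poly" where "p = (\<Prod>i\<in>A. [:1, of_real (f i):])"
  have c: "coeff p j = of_real (esym_on f A j)" for j
    unfolding p_def esym_on_def coeff_prod_one_linear[OF assms] by simp
  have "z \<in> \<real>" if "poly p z = 0" for z
  proof -
    have "\<exists>i\<in>A. 1 + z * of_real (f i) = 0"
      using that assms by (simp add: p_def poly_prod prod_zero_iff)
    then obtain i where i: "1 + z * of_real (f i) = 0" by blast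
    hence "f i \<noteq> 0" by auto
    with i have "z = of_real (- 1 / f i)" by (simp add: field_simps add_eq_0_iff)
    thus ?thesis by (metis Reals_of_real)
  qed
  hence "real_rooted p" using c by (auto simp: real_rooted_def)
  from real_rooted_Newton[OF this, of j] show ?thesis by (simp add: c)
qed

lemma esym_on_Newton_weak:
  assumes "finite A"
  shows "esym_on f A j * esym_on f A (j + 2) \<le> (esym_on f A (j + 1))\<^sup>2"
proof (cases "esym_on f A j * esym_on f A (j + 2) \<le> 0")
  case True
  thus ?thesis by (smt (verit) zero_le_power2)
next
  case False
  have "real (j + 1) * (esym_on f A j * esym_on f A (j + 2)) \<le> real (j + 2) * (esym_on f A j * esym_on f A (j + 2))"
    using False by (intro mult_right_mono) auto
  also have "\<dots> \<le> real (j + 1) * (esym_on f A (j + 1))\<^sup>2"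
    using esym_on_Newton[OF assms, where j = j and f = f] by (simp only: mult.assoc)
  finally show ?thesis by (subst (asm) mult_le_cancel_left_pos) simp_all
qed

section \<open>Monotonicity on the Garding cone\<close>

text \<open>\<sigma>_j of the remaining entries is the derivative of \<sigma>_{j+1} in the i-th
  entry, so this positivity is the source of monotonicity. If the next \<sigma> of the remaining
  entries were nonpositive, the recursions for two consecutive degrees on A would contradict
  Newton's inequality.\<close>

lemma esym_on_remove_pos:
  assumes A: "finite A" "i \<in> A" and pos: "\<And>j. j \<le> k \<Longrightarrow> esym_on f A j > 0" and "j < k"
  shows "esym_on f (A - {i}) j > 0"
  using \<open>j < k\<close>
proof (induction j)
  case 0
  show ?case by (simp add: esym_on_0)
next
  case (Suc j)
  define S where "S = esym_on f (A - {i})"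
  have S: "S j > 0" using Suc by (simp add: S_def)
  have 1: "S (Suc j) + f i * S j > 0" and 2: "S (Suc (Suc j)) + f i * S (Suc j) > 0"
    using pos[of "Suc j"] pos[of "Suc (Suc j)"] Suc.prems esym_on_Suc[OF A] by (simp_all add: S_def)
  have N: "S j * S (Suc (Suc j)) \<le> (S (Suc j))\<^sup>2"
    using esym_on_Newton_weak[of "A - {i}" f j] A by (simp add: S_def)
  have "S (Suc j) > 0"
  proof (rule ccontr)
    assume "\<not> S (Suc j) > 0"
    hence le: "S (Suc j) \<le> 0" by simp
    have "S j * (S (Suc (Suc j)) + f i * S (Suc j)) > 0" using S 2 by simp
    hence "S j * S (Suc (Suc j)) > - (f i * S j) * S (Suc j)" by (simp add: algebra_simps)
    moreover have "- (f i * S j) * S (Suc j) \<ge> S (Suc j) * S (Suc j)"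
      using 1 le by (intro mult_right_mono_neg) auto
    ultimately show False using N by (simp add: power2_eq_square)
  qed
  thus ?case by (simp add: S_def)
qed

lemma esym_on_mono1:
  assumes A: "finite A" "i \<in> A" and pos: "\<And>j. j \<le> k \<Longrightarrow> esym_on f A j > 0"
    and "f i \<le> c" "j \<le> k"
  shows "esym_on f A j \<le> esym_on (f(i := c)) A j"
proof (cases j)
  case 0
  thus ?thesis by (simp add: esym_on_0)
next
  case (Suc m)
  have e: "esym_on (f(i := c)) (A - {i}) l = esym_on f (A - {i}) l" for l
    unfolding esym_on_def by (intro arg_cong2[where f = coeff] prod.cong) auto
  have "f i * esym_on f (A - {i}) m \<le> c * esym_on f (A - {i}) m"
    using esym_on_remove_pos[OF A pos, of k m] assms Suc by (intro mult_right_mono) auto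
  thus ?thesis unfolding Suc esym_on_Suc[OF A] e by simp
qed

text \<open>Entries are raised one at a time. Each step stays in the cone because all \<sigma>_j
  with j \<le> k only grow.\<close>

lemma esym_on_mono:
  assumes A: "finite A" and pos: "\<And>j. j \<le> k \<Longrightarrow> esym_on f A j > 0"
    and le: "\<And>i. i \<in> A \<Longrightarrow> f i \<le> g i" and "j \<le> k"
  shows "esym_on f A j \<le> esym_on g A j"
proof -
  have "\<forall>j\<le>k. esym_on f A j \<le> esym_on (\<lambda>i. if i \<in> B then g i else f i) A j"
    if "finite B" "B \<subseteq> A" for B
    using that
  proof (induction B)
    case empty
    show ?case by simp
  next
    case (insert b B)
    define h where "h = (\<lambda>i. if i \<in> B then g i else f i)"
    have IH: "\<And>j. j \<le> k \<Longrightarrow> esym_on f A j \<le> esym_on h A j" using insert by (simp add: h_def)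
    have h: "(\<lambda>i. if i \<in> insert b B then g i else f i) = h(b := g b)" by (auto simp: h_def)
    have "esym_on h A j \<le> esym_on (h(b := g b)) A j" if "j \<le> k" for j
      by (rule esym_on_mono1[OF A, where k = k])
        (use insert.prems insert.hyps le that IH pos in \<open>auto simp: h_def intro: less_le_trans\<close>)
    with IH show ?case unfolding h by (meson order_trans)
  qed
  from this[OF A] have "esym_on f A j \<le> esym_on (\<lambda>i. if i \<in> A then g i else f i) A j"
    using \<open>j \<le> k\<close> by blast
  also have "\<dots> = esym_on g A j"
    unfolding esym_on_def by (intro arg_cong2[where f = coeff] prod.cong) auto
  finally show ?thesis .
qed

section \<open>The coefficients \<open>c_coeff\<close> as elementary symmetric functions of a
  two-valued vector\<close>

lemma coeff_one_linear_power: "coeff ([:1, b:] ^ n) i = of_nat (n choose i) * (b::'a::comm_ring_1) ^ i"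
proof (cases "i \<le> n")
  case True
  thus ?thesis by (simp add: coeff_linear_poly_power)
next
  case False
  have "degree ([:1, b:] ^ n) \<le> degree [:1, b:] * n" by (rule degree_power_le)
  also have "\<dots> \<le> 1 * n" by (intro mult_right_mono) auto
  finally show ?thesis using False by (simp add: coeff_eq_0 binomial_eq_0)
qed

lemma esym_on_two_values:
  assumes "finite A" "J \<subseteq> A"
  shows "esym_on (\<lambda>i. if i \<in> J then b else a) A j =
    (\<Sum>i\<le>j. real (card (A - J) choose i) * a ^ i * (real (card J choose (j - i)) * b ^ (j - i)))"
proof -
  have "(\<Prod>i\<in>A. [:1, if i \<in> J then b else a:]) = (\<Prod>i\<in>A. if i \<in> J then [:1, b:] else [:1, a:])"
    by (intro prod.cong) auto
  also have "\<dots> = [:1, a:] ^ card (A - J) * [:1, b:] ^ card J"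
    using assms by (simp add: prod.If_cases Int_absorb1 Diff_eq mult.commute)
  finally show ?thesis unfolding esym_on_def by (simp add: coeff_mult coeff_one_linear_power)
qed

text \<open>The right side is \<sigma>_j of the vector with n - p - 1 entries a and p + 1 entries
  -a. The hypothesis p < n makes the truncated difference agree with the real one.\<close>

lemma c_coeff_conv:
  assumes "p < n"
  shows "c_coeff n (real p) j * a ^ j =
    (\<Sum>i\<le>j. real (n - p - 1 choose i) * a ^ i * (real (p + 1 choose (j - i)) * (- a) ^ (j - i)))"
proof -
  have e: "real n - real p - 1 = real (n - p - 1)" "real p + 1 = real (p + 1)" using assms by auto
  show ?thesis
    unfolding c_coeff_def e binomial_gbinomial[symmetric] sum_distrib_right atMost_atLeast0
  proof (intro sum.cong refl)
    fix i assume "i \<in> {0..j}"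
    hence j: "a ^ j = a ^ i * a ^ (j - i)" by (simp flip: power_add)
    have m: "(- a) ^ (j - i) = (- 1) ^ (j - i) * a ^ (j - i)" by (rule power_minus)
    show "(- 1) ^ (j - i) * real (n - p - 1 choose i) * real (p + 1 choose (j - i)) * a ^ j
      = real (n - p - 1 choose i) * a ^ i * (real (p + 1 choose (j - i)) * (- a) ^ (j - i))"
      unfolding j m by (simp only: ac_simps)
  qed
qed


text \<open>Ratios of consecutive terms do not increase, so once the sequence drops it keeps
  dropping up to k. A value below \<open>E 0\<close> needs an earlier drop and is therefore followed
  by a descent to \<open>E k\<close>, which cannot be larger.\<close>

lemma log_concave_ge_min:
  fixes E :: "nat \<Rightarrow> real"
  assumes pos: "\<And>j. j \<le> k \<Longrightarrow> E j > 0"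
    and lc: "\<And>j. j + 2 \<le> k \<Longrightarrow> E j * E (j + 2) \<le> (E (j + 1))\<^sup>2"
    and "j \<le> k"
  shows "min (E 0) (E k) \<le> E j"
proof (rule ccontr)
  assume "\<not> min (E 0) (E k) \<le> E j"
  hence lt: "E j < E 0" "E j < E k" by auto
  have ratio: "E (m + 2) < E (m + 1)" if "E (m + 1) < E m" "m + 2 \<le> k" for m
  proof -
    have "E m * E (m + 2) \<le> E (m + 1) * E (m + 1)" using lc[OF that(2)] by (simp add: power2_eq_square)
    also have "\<dots> < E m * E (m + 1)" using that pos[of "m + 1"] by simp
    finally show ?thesis using pos[of m] that by simp
  qed
  obtain i where i: "i < j" "E (Suc i) < E i"
  proof (rule ccontr)
    assume "\<not> thesis"
    hence "\<forall>i<j. E i \<le> E (Suc i)" using that by (meson not_le)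
    hence mono: "E i \<le> E (Suc i)" if "i < j" for i using that by blast
    have "E 0 \<le> E i" if "i \<le> j" for i
      using that
    proof (induction i)
      case (Suc i)
      thus ?case using mono[of i] by simp
    qed simp
    hence "E 0 \<le> E j" by simp
    with lt show False by simp
  qed
  have dec: "E (Suc m) < E m" if "i \<le> m" "m < k" for m
    using that
  proof (induction m rule: dec_induct)
    case base
    show ?case by fact
  next
    case (step m)
    thus ?case using ratio[of m] by simp
  qed
  have "E m \<le> E j" if "j \<le> m" "m \<le> k" for m
    using that
  proof (induction m rule: dec_induct)
    case (step m)
    thus ?case using dec[of m] i by simp
  qed simp
  with lt \<open>j \<le> k\<close> show False by fastforce
qed

lemma c_coeff_pos:
  fixes a \<kappa> :: real
  assumes a: "a > 0" and \<kappa>: "\<kappa> > 0" and A: "finite A" "card A = n" "p < n"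
    and ex: "\<And>\<tau>. \<tau> > 0 \<Longrightarrow> \<exists>f J. (\<forall>j\<in>{1..k}. esym_on f A j > 0) \<and> esym_on f A k = \<kappa> \<and>
      J \<subseteq> A \<and> card J = p + 1 \<and> (\<forall>i\<in>A. f i \<le> a + \<tau>) \<and> (\<forall>i\<in>J. f i \<le> - a + \<tau>)"
    and j: "j \<in> {1..k}"
  shows "c_coeff n (real p) j > 0"
proof -
  \<comment> \<open>\<open>E \<tau>\<close> is \<sigma>_j of the perturbed two-valued vector, a
    polynomial in \<tau>; the bound below is uniform in \<tau> and so passes to \<tau> = 0.\<close>
  define E where "E = (\<lambda>\<tau>. \<Sum>i\<le>j. real (n - p - 1 choose i) * (a + \<tau>) ^ i *
    (real (p + 1 choose (j - i)) * (- a + \<tau>) ^ (j - i)))"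
  have bound: "min 1 \<kappa> \<le> E \<tau>" if \<tau>: "\<tau> > 0" for \<tau>
  proof -
    obtain f J where f: "\<forall>j\<in>{1..k}. esym_on f A j > 0" "esym_on f A k = \<kappa>"
      "J \<subseteq> A" "card J = p + 1" "\<forall>i\<in>A. f i \<le> a + \<tau>" "\<forall>i\<in>J. f i \<le> - a + \<tau>"
      using ex[OF \<tau>] by blast
    define g where "g = (\<lambda>i. if i \<in> J then - a + \<tau> else a + \<tau>)"
    have pos: "esym_on f A i > 0" if "i \<le> k" for i
      using f(1) that by (cases i) (auto simp: esym_on_0)
    have le: "esym_on f A i \<le> esym_on g A i" if "i \<le> k" for i
      by (rule esym_on_mono[OF A(1) pos _ that]) (use f in \<open>auto simp: g_def\<close>)
    have posg: "esym_on g A i > 0" if "i \<le> k" for i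
      using pos[OF that] le[OF that] by simp
    have "min (esym_on g A 0) (esym_on g A k) \<le> esym_on g A j"
      using posg esym_on_Newton_weak[OF A(1)] j by (intro log_concave_ge_min) auto
    moreover have "min 1 \<kappa> \<le> min (esym_on g A 0) (esym_on g A k)"
      using le[of k] f(2) by (auto simp: esym_on_0)
    moreover have "esym_on g A j = E \<tau>"
      unfolding g_def E_def esym_on_two_values[OF A(1) f(3)] card_Diff_subset[OF finite_subset[OF f(3) A(1)] f(3)]
      by (simp add: A f)
    ultimately show ?thesis by linarith
  qed
  have "(E \<longlongrightarrow> E 0) (at_right 0)"
    unfolding E_def by (intro tendsto_intros)
  hence "min 1 \<kappa> \<le> E 0"
    by (rule tendsto_lowerbound) (auto intro!: bound eventually_at_rightI[of 0 1])
  moreover have "E 0 = c_coeff n (real p) j * a ^ j"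
    unfolding E_def c_coeff_conv[OF A(3)] by simp
  ultimately have "c_coeff n (real p) j * a ^ j > 0" using \<kappa> by simp
  thus ?thesis using a by (simp add: zero_less_mult_iff)
qed

lemma less_p_crit:
  assumes k: "k \<ge> 1" and pos: "\<And>j. j \<in> {1..k} \<Longrightarrow> c_coeff n (real p) j > 0"
  shows "real p < p_crit k n"
proof -
  define S where "S = {p. p \<ge> 0 \<and> (\<forall>j\<in>{1..k}. c_coeff n p j > 0)}"
  have cont: "((\<lambda>x. c_coeff n x j) \<longlongrightarrow> c_coeff n (real p) j) (at_right (real p))" for j
    unfolding c_coeff_def gbinomial_prod_rev by (intro tendsto_intros) auto
  have "eventually (\<lambda>x. \<forall>j\<in>{1..k}. c_coeff n x j > 0) (at_right (real p))"
    by (intro eventually_ball_finite ballI order_tendstoD(1)[OF cont] pos) auto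
  hence "eventually (\<lambda>x. x > real p \<and> (\<forall>j\<in>{1..k}. c_coeff n x j > 0)) (at_right (real p))"
    by (intro eventually_conj eventually_at_right_less)
  then obtain q where q: "q > real p" "\<forall>j\<in>{1..k}. c_coeff n q j > 0"
    using eventually_happens by (metis (mono_tags, lifting) trivial_limit_at_right_real)
  \<comment> \<open>\<open>c_coeff n x 1\<close> is n - 2x - 2, which is positive on S.\<close>
  have "bdd_above S"
  proof (rule bdd_aboveI[of _ "real n / 2"])
    fix x assume "x \<in> S"
    hence "c_coeff n x 1 > 0" using k by (auto simp: S_def)
    thus "x \<le> real n / 2" by (simp add: c_coeff_def)
  qed
  moreover have "q \<in> S" using q by (auto simp: S_def)
  ultimately have "q \<le> Sup S" by (intro cSup_upper)
  with q show ?thesis by (simp add: p_crit_def S_def)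
qed

section \<open>Eigenvalues of symmetric matrices\<close>

lemma quadratic_nonpos_linear_coeff:
  fixes a b :: real
  assumes "\<And>t. t * a + t\<^sup>2 * b \<le> 0"
  shows "a = 0"
proof (rule ccontr)
  assume a: "a \<noteq> 0"
  define t where "t = a / (\<bar>b\<bar> + 1)"
  have t: "t * (\<bar>b\<bar> + 1) = a" by (simp add: t_def)
  have "t * a + t\<^sup>2 * b = t\<^sup>2 * (\<bar>b\<bar> + b + 1)"
    by (subst t[symmetric]) (simp add: power2_eq_square algebra_simps)
  moreover have "t\<^sup>2 > 0" using a by (simp add: t_def)
  moreover have "\<bar>b\<bar> + b + 1 > 0" by simp
  ultimately have "t * a + t\<^sup>2 * b > 0" by simp
  with assms[of t] show False by simp
qed

text \<open>Rayleigh quotient: at a maximiser x of the quadratic form on the unit sphere of S, the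
  first variation makes f x - c x orthogonal to S. This vector also lies in S, hence it is
  0.\<close>

lemma selfadjoint_eigenvector_on_subspace:
  fixes f :: "'a::euclidean_space \<Rightarrow> 'a"
  assumes f: "linear f" "\<And>x y. f x \<bullet> y = x \<bullet> f y"
    and S: "subspace S" "\<And>x. x \<in> S \<Longrightarrow> f x \<in> S" "S \<noteq> {0}"
  obtains x c where "x \<in> S" "norm x = 1" "f x = c *\<^sub>R x"
proof -
  have "compact (sphere 0 1 \<inter> S)" using closed_subspace[OF S(1)] by (simp add: compact_Int_closed)
  moreover have "sphere 0 1 \<inter> S \<noteq> {}"
  proof -
    obtain y where y: "y \<in> S" "y \<noteq> 0" using S(1,3) subspace_0 by blast
    hence "(1 / norm y) *\<^sub>R y \<in> sphere 0 1 \<inter> S" using subspace_scale[OF S(1)] by simp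
    thus ?thesis by blast
  qed
  moreover have "continuous_on (sphere 0 1 \<inter> S) (\<lambda>x. f x \<bullet> x)"
    using f(1) by (intro continuous_intros linear_continuous_on linear_conv_bounded_linear[THEN iffD1])
  ultimately obtain x where x: "x \<in> sphere 0 1 \<inter> S" "\<And>y. y \<in> sphere 0 1 \<inter> S \<Longrightarrow> f y \<bullet> y \<le> f x \<bullet> x"
    using continuous_attains_sup[of "sphere 0 1 \<inter> S" "\<lambda>x. f x \<bullet> x"] by blast
  define c where "c = f x \<bullet> x"
  have max: "f y \<bullet> y - c * (y \<bullet> y) \<le> 0" if "y \<in> S" for y
  proof (cases "y = 0")
    case True
    thus ?thesis by simp
  next
    case False
    have "(1 / norm y) *\<^sub>R y \<in> sphere 0 1 \<inter> S" using that False subspace_scale[OF S(1)] by simp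
    from x(2)[OF this] have "f y \<bullet> y / (norm y)\<^sup>2 \<le> c"
      using f(1) by (simp add: c_def linear_cmul power2_eq_square field_simps)
    thus ?thesis using False by (simp add: divide_le_eq power2_norm_eq_inner)
  qed
  have "(f x - c *\<^sub>R x) \<bullet> y = 0" if y: "y \<in> S" for y
  proof -
    have "t * (2 * ((f x - c *\<^sub>R x) \<bullet> y)) + t\<^sup>2 * (f y \<bullet> y - c * (y \<bullet> y)) \<le> 0" for t
    proof -
      have "x + t *\<^sub>R y \<in> S" using x y S(1) by (simp add: subspace_add subspace_scale)
      from max[OF this] show ?thesis
        using f(2)[of x y] f(2)[of y x] x(1)
        by (simp add: linear_add[OF f(1)] linear_cmul[OF f(1)] inner_simps c_def power2_eq_square
            norm_eq_1 inner_commute algebra_simps)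
    qed
    from quadratic_nonpos_linear_coeff[OF this] show ?thesis by simp
  qed
  moreover have "f x - c *\<^sub>R x \<in> S" using x S by (simp add: subspace_diff subspace_scale)
  ultimately have "f x = c *\<^sub>R x" by (metis inner_eq_zero_iff right_minus_eq)
  thus ?thesis using x that by auto
qed

text \<open>Induction on the dimension: self-adjointness makes the orthogonal complement of an
  eigenvector within S invariant.\<close>

lemma selfadjoint_eigenbasis_subspace:
  fixes f :: "'a::euclidean_space \<Rightarrow> 'a"
  assumes f: "linear f" "\<And>x y. f x \<bullet> y = x \<bullet> f y"
    and S: "subspace S" "\<And>x. x \<in> S \<Longrightarrow> f x \<in> S"
  shows "\<exists>B. B \<subseteq> S \<and> finite B \<and> card B = dim S \<and> (\<forall>x\<in>B. \<forall>y\<in>B. x \<bullet> y = (if x = y then 1 else 0)) \<and>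
    (\<forall>x\<in>B. \<exists>c. f x = c *\<^sub>R x)"
  using S
proof (induction "dim S" arbitrary: S)
  case 0
  hence "dim S = 0" by simp
  thus ?case by (intro exI[of _ "{}"]) auto
next
  case (Suc m)
  have "S \<noteq> {0}" using Suc(2) by auto
  then obtain x c where x: "x \<in> S" "norm x = 1" "f x = c *\<^sub>R x"
    using selfadjoint_eigenvector_on_subspace[OF f Suc(3,4)] by blast
  have x1: "x \<bullet> x = 1" using x(2) by (simp add: norm_eq_1)
  define S' where "S' = S \<inter> {y. x \<bullet> y = 0}"
  have sub: "subspace S'" unfolding S'_def
    by (intro subspace_inter Suc(3) subspace_hyperplane)
  have inv: "f y \<in> S'" if "y \<in> S'" for y
    using that Suc(4) f(2)[of x y] x(3) by (auto simp: S'_def)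
  have "S \<subseteq> span (insert x S')"
  proof
    fix y assume "y \<in> S"
    have "y - (x \<bullet> y) *\<^sub>R x \<in> S'"
      using \<open>y \<in> S\<close> x(1) Suc(3) x1 by (auto simp: S'_def subspace_diff subspace_scale inner_simps)
    thus "y \<in> span (insert x S')" by (meson span_base span_breakdown_eq)
  qed
  moreover have "span (insert x S') \<subseteq> S"
    using x(1) Suc(3) by (intro span_minimal) (auto simp: S'_def)
  ultimately have "dim S = dim (insert x S')" by (metis dim_span subset_antisym)
  moreover have "x \<notin> span S'" using sub x1 by (metis IntD2 S'_def mem_Collect_eq span_eq_iff zero_neq_one)
  ultimately have dimS: "dim S = Suc (dim S')" by (simp add: dim_insert)
  then obtain B where B: "B \<subseteq> S'" "finite B" "card B = dim S'"
    "\<forall>x\<in>B. \<forall>y\<in>B. x \<bullet> y = (if x = y then 1 else 0)" "\<forall>x\<in>B. \<exists>c. f x = c *\<^sub>R x"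
    using Suc(1)[OF _ sub inv] Suc(2) by auto
  have "x \<notin> B" using B(1) x1 by (auto simp: S'_def)
  with B x x1 dimS show ?case
    by (intro exI[of _ "insert x B"]) (auto simp: S'_def inner_commute)
qed

lemma symmetric_matrix_eigenbasis:
  fixes A :: "real^'n^'n"
  assumes "transpose A = A"
  obtains b :: "'n \<Rightarrow> real^'n" and d :: "'n \<Rightarrow> real"
    where "\<And>i j. b i \<bullet> b j = (if i = j then 1 else 0)" "\<And>i. A *v b i = d i *\<^sub>R b i"
proof -
  have "\<exists>B. B \<subseteq> (UNIV :: (real^'n) set) \<and> finite B \<and> card B = dim (UNIV :: (real^'n) set) \<and>
      (\<forall>x\<in>B. \<forall>y\<in>B. x \<bullet> y = (if x = y then 1 else 0)) \<and> (\<forall>x\<in>B. \<exists>c. A *v x = c *\<^sub>R x)"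
    by (rule selfadjoint_eigenbasis_subspace)
      (auto simp: dot_lmul_matrix[symmetric] assms simp flip: transpose_matrix_vector)
  then obtain B where B: "finite B" "card B = CARD('n)"
    "\<forall>x\<in>B. \<forall>y\<in>B. x \<bullet> y = (if x = y then 1 else 0)" "\<forall>x\<in>B. \<exists>c. A *v x = c *\<^sub>R x"
    by auto
  then obtain b :: "'n \<Rightarrow> real^'n" where b: "bij_betw b UNIV B"
    by (metis finite finite_same_card_bij)
  hence "\<exists>c. A *v b i = c *\<^sub>R b i" for i using B(4) by (auto simp: bij_betw_def)
  then obtain d where "\<And>i. A *v b i = d i *\<^sub>R b i" by metis
  moreover have "b i \<bullet> b j = (if i = j then 1 else 0)" for i j
    using b B(3) by (auto simp: bij_betw_def inj_def)
  ultimately show ?thesis using that by blast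
qed

lemma eigenvalue_vector_of_eigenbasis:
  fixes A :: "real^'n^'n" and b :: "'n \<Rightarrow> real^'n" and d :: "'n \<Rightarrow> real"
  assumes b: "\<And>i j. b i \<bullet> b j = (if i = j then 1 else 0)" "\<And>i. A *v b i = d i *\<^sub>R b i"
  shows "eigenvalue_vector A (\<chi> i. d i)"
  unfolding eigenvalue_vector_def
proof
  fix t
  define P :: "real^'n^'n" where "P = (\<chi> i j. b j $ i)"
  have "transpose P ** P = mat 1"
    using b(1) by (simp add: vec_eq_iff P_def transpose_def matrix_matrix_mult_def mat_def inner_vec_def)
  have "(transpose P ** (mat t - A) ** P) $ i $ j = (if i = j then t - d i else 0)" for i j
  proof -
    have "((mat t - A) ** P) $ l $ j = ((mat t - A) *v b j) $ l" for l
      by (simp add: matrix_matrix_mult_def matrix_vector_mult_def P_def)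
    hence "(transpose P ** ((mat t - A) ** P)) $ i $ j = b i \<bullet> ((mat t - A) *v b j)"
      by (subst matrix_matrix_mult_def) (simp add: transpose_def P_def inner_vec_def)
    hence "(transpose P ** (mat t - A) ** P) $ i $ j = b i \<bullet> ((mat t - A) *v b j)"
      by (simp add: matrix_mul_assoc)
    also have "(mat t - A) *v b j = (t - d j) *\<^sub>R b j"
    proof -
      have "mat t *v b j = t *\<^sub>R b j"
        by (simp add: vec_eq_iff matrix_vector_mult_def mat_def if_distrib if_distribR cong: if_cong)
      thus ?thesis by (simp add: matrix_vector_mult_diff_rdistrib b(2) algebra_simps)
    qed
    finally show ?thesis by (simp add: b(1))
  qed
  hence "det (transpose P ** (mat t - A) ** P) = (\<Prod>i\<in>UNIV. t - d i)"
    by (subst det_diagonal) auto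
  moreover have "det (transpose P ** (mat t - A) ** P) = det (transpose P ** P) * det (mat t - A)"
    by (simp add: det_mul)
  ultimately show "det (mat t - A) = (\<Prod>i\<in>UNIV. t - (\<chi> i. d i) $ i)"
    using \<open>transpose P ** P = mat 1\<close> by simp
qed

text \<open>A list of eigenvalues is unique only up to order. For s \<noteq> 0 the value at s is
  (-s)^n det(-I/s - A), so the generating polynomial of the \<sigma>_j depends on A alone.\<close>

lemma eigenvalue_vector_prod_unique:
  fixes lam mu :: "real^'n"
  assumes "eigenvalue_vector A lam" "eigenvalue_vector A mu"
  shows "(\<Prod>i\<in>UNIV. [:1, lam $ i:]) = (\<Prod>i\<in>UNIV. [:1, mu $ i:])"
proof (rule poly_eq_poly_eq_iff[THEN iffD1], rule ext)
  fix s :: real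
  have *: "poly (\<Prod>i\<in>UNIV. [:1, l $ i:]) s = (- s) ^ CARD('n) * (\<Prod>i\<in>UNIV. - 1 / s - l $ i)"
    if "s \<noteq> 0" for l :: "real^'n"
  proof -
    have "(- s) ^ CARD('n) * (\<Prod>i\<in>UNIV. - 1 / s - l $ i) = (\<Prod>i\<in>UNIV. (- s) * (- 1 / s - l $ i))"
      by (subst prod.distrib) simp
    also have "\<dots> = (\<Prod>i\<in>UNIV. 1 + s * l $ i)"
      by (intro prod.cong refl) (use that in \<open>simp add: field_simps\<close>)
    finally show ?thesis by (simp add: poly_prod)
  qed
  show "poly (\<Prod>i\<in>UNIV. [:1, lam $ i:]) s = poly (\<Prod>i\<in>UNIV. [:1, mu $ i:]) s"
  proof (cases "s = 0")
    case True
    thus ?thesis by (simp add: poly_prod)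
  next
    case False
    have "(\<Prod>i\<in>UNIV. - 1 / s - lam $ i) = (\<Prod>i\<in>UNIV. - 1 / s - mu $ i)"
      using assms unfolding eigenvalue_vector_def by metis
    thus ?thesis by (simp only: *[OF False])
  qed
qed

text \<open>Dimension count as in the min-max principle: the span of the b i with eigenvalue above
  \<beta> meets E only in 0, so there are at most n - q of them.\<close>

lemma eigenvalues_le_of_quadratic_form_le:
  fixes A :: "real^'n^'n" and b :: "'n \<Rightarrow> real^'n" and d :: "'n \<Rightarrow> real"
  assumes b: "\<And>i j. b i \<bullet> b j = (if i = j then 1 else 0)" "\<And>i. A *v b i = d i *\<^sub>R b i"
    and E: "subspace E" "dim E = q" and le: "\<And>\<xi>. \<xi> \<in> E \<Longrightarrow> \<xi> \<bullet> (A *v \<xi>) \<le> \<beta> * (\<xi> \<bullet> \<xi>)"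
  obtains J where "card J = q" "\<And>i. i \<in> J \<Longrightarrow> d i \<le> \<beta>"
proof -
  define I where "I = {i. d i > \<beta>}"
  define V where "V = span (b ` I)"
  have "inj b" using b(1) by (metis injI zero_neq_one)
  have "independent (b ` I)"
    using b(1) by (intro pairwise_orthogonal_independent)
      (auto simp: pairwise_def orthogonal_def, metis inner_zero_left zero_neq_one)
  hence dimV: "dim V = card I"
    unfolding V_def dim_span by (simp add: dim_eq_card_independent card_image inj_on_subset[OF \<open>inj b\<close>])
  have "\<xi> = 0" if "\<xi> \<in> V" "\<xi> \<in> E" for \<xi>
  proof -
    have "\<xi> \<in> range (\<lambda>u. \<Sum>v\<in>b ` I. u v *\<^sub>R v)"
      using that(1) span_finite[OF finite_imageI[OF finite[of I]], of b] by (simp add: V_def)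
    then obtain u where "\<xi> = (\<Sum>v\<in>b ` I. u v *\<^sub>R v)" by blast
    hence \<xi>: "\<xi> = (\<Sum>i\<in>I. u (b i) *\<^sub>R b i)"
      by (simp add: sum.reindex[OF inj_on_subset[OF \<open>inj b\<close>]])
    define c where "c = (\<lambda>i. u (b i))"
    have \<xi>: "\<xi> = (\<Sum>i\<in>I. c i *\<^sub>R b i)" using \<xi> by (simp add: c_def)
    have A\<xi>: "A *v \<xi> = (\<Sum>i\<in>I. (c i * d i) *\<^sub>R b i)"
      unfolding \<xi> by (simp add: linear_sum[OF matrix_vector_mul_linear] matrix_vector_mult_scaleR b(2))
    have 1: "\<xi> \<bullet> \<xi> = (\<Sum>i\<in>I. (c i)\<^sup>2)"
      unfolding \<xi> by (simp add: inner_sum_left inner_sum_right b(1) power2_eq_square if_distrib cong: if_cong)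
    have 2: "\<xi> \<bullet> (A *v \<xi>) = (\<Sum>i\<in>I. d i * (c i)\<^sup>2)"
      unfolding A\<xi> unfolding \<xi> by (simp add: inner_sum_left inner_sum_right b(1) power2_eq_square if_distrib ac_simps cong: if_cong)
    have "(\<Sum>i\<in>I. (d i - \<beta>) * (c i)\<^sup>2) \<le> 0"
      using le[OF that(2)] unfolding 1 2 by (simp add: sum_distrib_left sum_subtractf algebra_simps)
    moreover have "(d i - \<beta>) * (c i)\<^sup>2 \<ge> 0" if "i \<in> I" for i using that by (simp add: I_def)
    ultimately have "\<forall>i\<in>I. (d i - \<beta>) * (c i)\<^sup>2 = 0"
      by (metis (no_types, lifting) finite order_antisym sum_nonneg sum_nonneg_eq_0_iff)
    hence "\<forall>i\<in>I. c i = 0" by (auto simp: I_def)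
    thus ?thesis by (simp add: \<xi>)
  qed
  hence "V \<inter> E = {0}" using subspace_0[OF E(1)] by (auto simp: V_def span_zero)
  have "dim {x + y |x y. x \<in> V \<and> y \<in> E} + dim (V \<inter> E) = dim V + dim E"
    by (rule dim_sums_Int) (auto simp: V_def E)
  moreover have "dim {x + y |x y. x \<in> V \<and> y \<in> E} \<le> CARD('n)"
    using dim_subset_UNIV[of "{x + y |x y. x \<in> V \<and> y \<in> E}"] by simp
  ultimately have "card I + q \<le> CARD('n)"
    using dimV E(2) \<open>V \<inter> E = {0}\<close> by simp
  hence "q \<le> card (- I)" by (simp add: Compl_eq_Diff_UNIV card_Diff_subset)
  then obtain J where "J \<subseteq> - I" "card J = q" by (rule obtain_subset_with_card_n)
  thus ?thesis using that[of J] by (force simp: I_def)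
qed

section \<open>Schouten tensor of a conformally flat metric\<close>

lemma frechet_derivative_cong_open:
  assumes "open U" "x \<in> U" "\<And>y. y \<in> U \<Longrightarrow> f y = g y"
  shows "frechet_derivative f (at x) = frechet_derivative g (at x)"
proof -
  have "(f has_derivative D) (at x) \<longleftrightarrow> (g has_derivative D) (at x)" for D
    using has_derivative_transform_within_open[OF _ assms(1,2)] assms(3) by metis
  thus ?thesis unfolding frechet_derivative_def by simp
qed

lemma pd_cong_open:
  assumes "open U" "x \<in> U" "\<And>y. y \<in> U \<Longrightarrow> f y = g y"
  shows "pd i f x = pd i g x"
  unfolding pd_def using frechet_derivative_cong_open[OF assms] by simp

lemma pd_eqI:
  assumes "(f has_derivative D) (at x)"
  shows "pd i f x = D (axis i 1)"
  unfolding pd_def using frechet_derivative_at[OF assms] by simp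

lemma Ck_on_cong:
  assumes "open U" "\<And>y. y \<in> U \<Longrightarrow> f y = g y"
  shows "Ck_on m U f \<longleftrightarrow> Ck_on m U g"
  using assms(2)
proof (induction m arbitrary: f g)
  case 0
  thus ?case by (simp cong: continuous_on_cong)
next
  case (Suc m)
  have 1: "f differentiable (at x) \<longleftrightarrow> g differentiable (at x)" if "x \<in> U" for x
    unfolding differentiable_def
    using has_derivative_transform_within_open[OF _ assms(1) that] Suc.prems by metis
  have "Ck_on m U (\<lambda>x. frechet_derivative f (at x) h) \<longleftrightarrow> Ck_on m U (\<lambda>x. frechet_derivative g (at x) h)" for h
    using frechet_derivative_cong_open[OF assms(1) _ Suc.prems] by (intro Suc.IH) simp
  with 1 show ?case by simp
qed

lemma Ck_on_continuous: "Ck_on m U f \<Longrightarrow> continuous_on U f"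
  by (cases m) (auto intro!: differentiable_imp_continuous_on differentiable_at_imp_differentiable_on)

lemma Ck_on_Suc_imp: "Ck_on (Suc m) U f \<Longrightarrow> Ck_on m U f"
proof (induction m arbitrary: f)
  case 0
  thus ?case using Ck_on_continuous by fastforce
next
  case (Suc m)
  have "Ck_on m U (\<lambda>x. frechet_derivative f (at x) h)" for h
    using Suc.prems by (intro Suc.IH) (metis Ck_on.simps(2))
  thus ?case using Suc.prems by simp
qed

lemma Ck_on_le: "n \<le> m \<Longrightarrow> Ck_on m U f \<Longrightarrow> Ck_on n U f"
  by (induction m rule: dec_induct) (blast dest: Ck_on_Suc_imp)+

lemma Ck_on_subset: "Ck_on m U f \<Longrightarrow> V \<subseteq> U \<Longrightarrow> Ck_on m V f"
  by (induction m arbitrary: f) (auto intro: continuous_on_subset)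

text \<open>Any formula for the derivative that is valid on U will do, because \<open>Ck_on\<close>
  on an open set sees only the values there.\<close>

lemma Ck_on_SucI:
  assumes "open U" "\<And>x. x \<in> U \<Longrightarrow> (f has_derivative f' x) (at x)" "\<And>h. Ck_on m U (\<lambda>x. f' x h)"
  shows "Ck_on (Suc m) U f"
proof -
  have e: "frechet_derivative f (at x) h = f' x h" if "x \<in> U" for x h
    using frechet_derivative_at[OF assms(2)[OF that]] by simp
  have "Ck_on m U (\<lambda>x. frechet_derivative f (at x) h) \<longleftrightarrow> Ck_on m U (\<lambda>x. f' x h)" for h
    by (rule Ck_on_cong[OF assms(1)]) (rule e)
  thus ?thesis using assms by (auto simp: differentiable_def)
qed

lemma Ck_on_const: "Ck_on m U (\<lambda>x. c)"
  by (induction m arbitrary: c) (simp_all add: frechet_derivative_const)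

lemma Ck_on_bounded_linear:
  assumes "open U" "bounded_linear f"
  shows "Ck_on m U f"
proof (cases m)
  case 0
  thus ?thesis using assms(2) by (simp add: linear_continuous_on)
next
  case (Suc n)
  show ?thesis unfolding Suc
    by (rule Ck_on_SucI[OF assms(1), of _ "\<lambda>x. f"]) (auto intro: Ck_on_const bounded_linear_imp_has_derivative assms(2))
qed

lemma Ck_on_has_derivative:
  "Ck_on (Suc m) U f \<Longrightarrow> x \<in> U \<Longrightarrow> (f has_derivative frechet_derivative f (at x)) (at x)"
  by (simp add: frechet_derivative_works)

lemma Ck_on_add:
  assumes "open U" "Ck_on m U f" "Ck_on m U g"
  shows "Ck_on m U (\<lambda>x. f x + g x)"
  using assms(2,3)
proof (induction m arbitrary: f g)
  case 0
  thus ?case by (auto intro: continuous_intros)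
next
  case (Suc m)
  show ?case
    by (rule Ck_on_SucI[OF assms(1) has_derivative_add[OF Ck_on_has_derivative[OF Suc.prems(1)] Ck_on_has_derivative[OF Suc.prems(2)]]])
      (use Suc in auto)
qed

lemma Ck_on_bilinear:
  assumes "open U" "bounded_bilinear prd" "Ck_on m U f" "Ck_on m U g"
  shows "Ck_on m U (\<lambda>x. prd (f x) (g x))"
  using assms(3,4)
proof (induction m arbitrary: f g)
  case 0
  thus ?case using bounded_bilinear.continuous_on[OF assms(2)] by simp
next
  case (Suc m)
  have "Ck_on m U f" "Ck_on m U g" using Suc.prems Ck_on_Suc_imp by blast+
  then show ?case
    by (intro Ck_on_SucI[OF assms(1) bounded_bilinear.FDERIV[OF assms(2) Ck_on_has_derivative[OF Suc.prems(1)] Ck_on_has_derivative[OF Suc.prems(2)]]])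
      (use Suc in \<open>auto intro!: Ck_on_add[OF assms(1)]\<close>)
qed

lemmas Ck_on_mult = Ck_on_bilinear[OF _ bounded_bilinear_mult]
lemmas Ck_on_scaleR = Ck_on_bilinear[OF _ bounded_bilinear_scaleR]

lemma Ck_on_inverse:
  fixes f :: "'a::real_normed_vector \<Rightarrow> real"
  assumes "open U" "Ck_on m U f" "\<And>x. x \<in> U \<Longrightarrow> f x \<noteq> 0"
  shows "Ck_on m U (\<lambda>x. inverse (f x))"
  using assms(2)
proof (induction m)
  case 0
  thus ?case using assms(3) by (auto intro: continuous_intros)
next
  case (Suc m)
  have i: "Ck_on m U (\<lambda>x. inverse (f x))" using Suc Ck_on_Suc_imp by blast
  have "((\<lambda>x. inverse (f x)) has_derivative
      (\<lambda>h. inverse (f x) * ((- 1) * (frechet_derivative f (at x) h * inverse (f x))))) (at x)" if "x \<in> U" for x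
    using Deriv.has_derivative_inverse[OF assms(3)[OF that] Ck_on_has_derivative[OF Suc.prems that]]
    by (simp add: mult.assoc)
  moreover have "Ck_on m U (\<lambda>x. inverse (f x) * ((- 1) * (frechet_derivative f (at x) h * inverse (f x))))" for h
    using Suc.prems by (intro Ck_on_mult[OF assms(1)] Ck_on_const i) simp
  ultimately show ?case by (rule Ck_on_SucI[OF assms(1)])
qed

lemma line_derivative:
  fixes f :: "'a::real_normed_vector \<Rightarrow> real"
  assumes "(f has_derivative D) (at (p + s *\<^sub>R a))"
  shows "((\<lambda>s. f (p + s *\<^sub>R a)) has_real_derivative D a) (at s)"
proof -
  have "((\<lambda>s. p + s *\<^sub>R a) has_derivative (\<lambda>s. s *\<^sub>R a)) (at s)"
    by (auto intro!: derivative_eq_intros)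
  from has_derivative_compose[OF this assms]
  have "((\<lambda>s. f (p + s *\<^sub>R a)) has_derivative (\<lambda>s. D (s *\<^sub>R a))) (at s)" .
  moreover have "D (t *\<^sub>R a) = D a * t" for t
    using has_derivative_linear[OF assms] by (simp add: linear_cmul)
  ultimately show ?thesis by (simp add: has_field_derivative_def mult_commute_abs)
qed

section \<open>Symmetry of second derivatives\<close>

text \<open>The mean value theorem is applied first along a, then along b. The left side is
  symmetric in a and b while the right side fixes an order of differentiation. The bound on h keeps
  the parallelogram inside the ball.\<close>

lemma second_difference_mean_value:
  fixes f :: "'a::real_normed_vector \<Rightarrow> real"
  assumes U: "open U" "Ck_on 2 U f" and r: "ball x r \<subseteq> U" "h > 0" "h * (norm a + norm b) < r"
  obtains s t where "0 < s" "s < h" "0 < t" "t < h"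
    "f (x + h *\<^sub>R a + h *\<^sub>R b) - f (x + h *\<^sub>R a) - f (x + h *\<^sub>R b) + f x
      = h * h * frechet_derivative (\<lambda>y. frechet_derivative f (at y) a) (at (x + s *\<^sub>R a + t *\<^sub>R b)) b"
proof -
  have C: "Ck_on (Suc 1) U f" "\<And>a. Ck_on (Suc 0) U (\<lambda>y. frechet_derivative f (at y) a)"
    using U(2) by (auto simp: numeral_2_eq_2)
  have inU: "x + s *\<^sub>R a + t *\<^sub>R b \<in> U" if "0 \<le> s" "s \<le> h" "0 \<le> t" "t \<le> h" for s t
  proof -
    have "norm (s *\<^sub>R a + t *\<^sub>R b) \<le> s * norm a + t * norm b"
      using norm_triangle_ineq[of "s *\<^sub>R a" "t *\<^sub>R b"] that by simp
    also have "\<dots> \<le> h * norm a + h * norm b" using that by (intro add_mono mult_right_mono) auto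
    also have "\<dots> < r" using r(3) by (simp add: algebra_simps)
    finally have "dist x (x + (s *\<^sub>R a + t *\<^sub>R b)) < r"
      by (simp only: dist_norm norm_minus_commute[of x] add_diff_cancel_left')
    thus ?thesis using r(1) by (auto simp: add.assoc)
  qed
  define d where "d = (\<lambda>y. frechet_derivative f (at y) a)"
  have 1: "((\<lambda>s. f (x + s *\<^sub>R a + t *\<^sub>R b)) has_real_derivative d (x + s *\<^sub>R a + t *\<^sub>R b)) (at s)"
    if "0 \<le> s" "s \<le> h" "0 \<le> t" "t \<le> h" for s t
  proof -
    have e: "x + s *\<^sub>R a + t *\<^sub>R b = x + t *\<^sub>R b + s *\<^sub>R a" for s by simp
    show ?thesis unfolding e d_def
      by (rule line_derivative Ck_on_has_derivative C inU[OF that, unfolded e])+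
  qed
  have 2: "((\<lambda>t. d (x + s *\<^sub>R a + t *\<^sub>R b)) has_real_derivative
      frechet_derivative d (at (x + s *\<^sub>R a + t *\<^sub>R b)) b) (at t)"
    if "0 \<le> s" "s \<le> h" "0 \<le> t" "t \<le> h" for s t
    unfolding d_def by (rule line_derivative Ck_on_has_derivative C(2) inU[OF that])+
  define \<phi> where "\<phi> = (\<lambda>s. f (x + s *\<^sub>R a + h *\<^sub>R b) - f (x + s *\<^sub>R a + 0 *\<^sub>R b))"
  have "\<exists>s>0. s < h \<and> \<phi> h - \<phi> 0 = (h - 0) * (d (x + s *\<^sub>R a + h *\<^sub>R b) - d (x + s *\<^sub>R a + 0 *\<^sub>R b))"
    unfolding \<phi>_def using r(2) by (intro MVT2 DERIV_diff 1) auto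
  then obtain s where s: "0 < s" "s < h"
    "\<phi> h - \<phi> 0 = h * (d (x + s *\<^sub>R a + h *\<^sub>R b) - d (x + s *\<^sub>R a + 0 *\<^sub>R b))" by auto
  have "\<exists>t>0. t < h \<and> d (x + s *\<^sub>R a + h *\<^sub>R b) - d (x + s *\<^sub>R a + 0 *\<^sub>R b)
      = (h - 0) * frechet_derivative d (at (x + s *\<^sub>R a + t *\<^sub>R b)) b"
    using r(2) s by (intro MVT2 2) auto
  then obtain t where t: "0 < t" "t < h" "d (x + s *\<^sub>R a + h *\<^sub>R b) - d (x + s *\<^sub>R a + 0 *\<^sub>R b)
      = h * frechet_derivative d (at (x + s *\<^sub>R a + t *\<^sub>R b)) b" by auto
  show ?thesis
    using that[of s t] s t unfolding d_def \<phi>_def by (simp add: algebra_simps)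
qed

text \<open>Both orders of differentiation represent the same second difference. Divide by h^2 and
  let h tend to 0, using continuity of the second derivatives at x.\<close>

lemma second_derivative_symmetric:
  fixes f :: "'a::real_normed_vector \<Rightarrow> real"
  assumes U: "open U" "Ck_on 2 U f" "x \<in> U"
  shows "frechet_derivative (\<lambda>y. frechet_derivative f (at y) a) (at x) b
    = frechet_derivative (\<lambda>y. frechet_derivative f (at y) b) (at x) a"
proof -
  define F where "F = (\<lambda>a b z. frechet_derivative (\<lambda>y. frechet_derivative f (at y) a) (at z) b)"
  have cont: "isCont (F a b) x" for a b
    using U unfolding F_def by (auto simp: numeral_2_eq_2 continuous_on_eq_continuous_at)
  obtain r where r: "r > 0" "ball x r \<subseteq> U" using U openE by blast
  define h where "h = (\<lambda>n. r / (2 * (norm a + norm b + 1)) / real (Suc n))"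
  have h0: "h n > 0" for n using r(1) by (simp add: h_def add_nonneg_pos)
  have hr: "h n * (norm a + norm b) < r" for n
  proof -
    have "r / (2 * (norm a + norm b + 1)) \<ge> 0" using r(1) by simp
    hence "h n \<le> r / (2 * (norm a + norm b + 1))"
      unfolding h_def using divide_left_mono[of 1 "real (Suc n)" "r / (2 * (norm a + norm b + 1))"] by simp
    hence "h n * (norm a + norm b) \<le> r / (2 * (norm a + norm b + 1)) * (norm a + norm b)"
      by (intro mult_right_mono) auto
    also have "\<dots> < r / (2 * (norm a + norm b + 1)) * (2 * (norm a + norm b + 1))"
      using r(1) by (intro mult_strict_left_mono divide_pos_pos) (auto simp: add_nonneg_pos)
    also have "\<dots> = r"
    proof -
      have "2 * (norm a + norm b + 1) > 0"
        by (intro mult_pos_pos add_nonneg_pos add_nonneg_nonneg) auto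
      thus ?thesis by (metis less_irrefl nonzero_mult_div_cancel_right times_divide_eq_left)
    qed
    finally show ?thesis .
  qed
  have hlim: "h \<longlonglongrightarrow> 0" unfolding h_def
    by (intro tendsto_divide_0[OF tendsto_const] filterlim_compose[OF filterlim_real_sequentially filterlim_Suc] filterlim_at_top_imp_at_infinity)
  have "\<forall>n. \<exists>p. (0 < fst p \<and> fst p < h n \<and> 0 < snd p \<and> snd p < h n) \<and>
     f (x + h n *\<^sub>R a + h n *\<^sub>R b) - f (x + h n *\<^sub>R a) - f (x + h n *\<^sub>R b) + f x
      = h n * h n * F a b (x + fst p *\<^sub>R a + snd p *\<^sub>R b)"
    unfolding F_def using second_difference_mean_value[OF U(1,2) r(2) h0 hr] by (metis fst_conv snd_conv)
  then obtain p where p: "\<And>n. 0 < fst (p n) \<and> fst (p n) < h n \<and> 0 < snd (p n) \<and> snd (p n) < h n"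
    "\<And>n. f (x + h n *\<^sub>R a + h n *\<^sub>R b) - f (x + h n *\<^sub>R a) - f (x + h n *\<^sub>R b) + f x
      = h n * h n * F a b (x + fst (p n) *\<^sub>R a + snd (p n) *\<^sub>R b)" by metis
  have hr': "h n * (norm b + norm a) < r" for n using hr[of n] by (simp add: add.commute)
  have "\<forall>n. \<exists>p. (0 < fst p \<and> fst p < h n \<and> 0 < snd p \<and> snd p < h n) \<and>
     f (x + h n *\<^sub>R b + h n *\<^sub>R a) - f (x + h n *\<^sub>R b) - f (x + h n *\<^sub>R a) + f x
      = h n * h n * F b a (x + fst p *\<^sub>R b + snd p *\<^sub>R a)"
    unfolding F_def using second_difference_mean_value[OF U(1,2) r(2) h0 hr'] by (metis fst_conv snd_conv)
  then obtain q where q: "\<And>n. 0 < fst (q n) \<and> fst (q n) < h n \<and> 0 < snd (q n) \<and> snd (q n) < h n"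
    "\<And>n. f (x + h n *\<^sub>R b + h n *\<^sub>R a) - f (x + h n *\<^sub>R b) - f (x + h n *\<^sub>R a) + f x
      = h n * h n * F b a (x + fst (q n) *\<^sub>R b + snd (q n) *\<^sub>R a)" by metis
  have e: "F a b (x + fst (p n) *\<^sub>R a + snd (p n) *\<^sub>R b) = F b a (x + fst (q n) *\<^sub>R b + snd (q n) *\<^sub>R a)" for n
  proof -
    have "h n * h n * F a b (x + fst (p n) *\<^sub>R a + snd (p n) *\<^sub>R b)
      = h n * h n * F b a (x + fst (q n) *\<^sub>R b + snd (q n) *\<^sub>R a)"
      unfolding p(2)[symmetric] q(2)[symmetric] by (simp add: algebra_simps)
    thus ?thesis using h0[of n] by simp
  qed
  have lims: "(\<lambda>n. fst (p n)) \<longlonglongrightarrow> 0" "(\<lambda>n. snd (p n)) \<longlonglongrightarrow> 0"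
    "(\<lambda>n. fst (q n)) \<longlonglongrightarrow> 0" "(\<lambda>n. snd (q n)) \<longlonglongrightarrow> 0"
    by (rule tendsto_sandwich[OF _ _ tendsto_const hlim]; use p(1) q(1) in \<open>auto intro!: always_eventually less_imp_le\<close>)+
  have "(\<lambda>n. x + fst (p n) *\<^sub>R a + snd (p n) *\<^sub>R b) \<longlonglongrightarrow> x + 0 *\<^sub>R a + 0 *\<^sub>R b"
    by (intro tendsto_intros lims)
  hence 1: "(\<lambda>n. F a b (x + fst (p n) *\<^sub>R a + snd (p n) *\<^sub>R b)) \<longlonglongrightarrow> F a b x"
    by (intro isCont_tendsto_compose[OF cont]) simp
  have "(\<lambda>n. x + fst (q n) *\<^sub>R b + snd (q n) *\<^sub>R a) \<longlonglongrightarrow> x + 0 *\<^sub>R b + 0 *\<^sub>R a"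
    by (intro tendsto_intros lims)
  hence 2: "(\<lambda>n. F b a (x + fst (q n) *\<^sub>R b + snd (q n) *\<^sub>R a)) \<longlonglongrightarrow> F b a x"
    by (intro isCont_tendsto_compose[OF cont]) simp
  from LIMSEQ_unique[OF 1[unfolded e] 2] show ?thesis by (simp add: F_def)
qed

section \<open>Curvature of the metric u^-2 \<delta>\<close>

lemma mult_delta: 
  fixes a :: real
  shows "(if P then a else 0) * c = (if P then a * c else 0)" "c * (if P then a else 0) = (if P then c * a else 0)"
  by auto

text \<open>The trace computation, separated from the analysis. With \<alpha> = D log u and B = D^2
  log u, \<open>\<Gamma>\<close> holds the Christoffel symbols of u^-2 \<delta>, \<open>D m\<close>
  their derivatives in direction m, and the sum is the Ricci tensor.\<close>

lemma ricci_algebra: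
  fixes \<alpha> :: "'n::finite \<Rightarrow> real" and B :: "'n \<Rightarrow> 'n \<Rightarrow> real"
  defines "\<Gamma> \<equiv> \<lambda>l i j. (if i = j then \<alpha> l else 0) - (if j = l then \<alpha> i else 0) - (if i = l then \<alpha> j else 0)"
  defines "D \<equiv> \<lambda>m l i j. (if i = j then B m l else 0) - (if j = l then B m i else 0) - (if i = l then B m j else 0)"
  assumes sym: "\<And>i j. B i j = B j i"
  shows "(\<Sum>i\<in>UNIV. D i i j k - D j i i k + (\<Sum>m\<in>UNIV. \<Gamma> i i m * \<Gamma> m j k - \<Gamma> i j m * \<Gamma> m i k))
    = (real CARD('n) - 2) * (B j k + \<alpha> j * \<alpha> k) + (if j = k then (\<Sum>i\<in>UNIV. B i i) - (real CARD('n) - 2) * (\<Sum>i\<in>UNIV. (\<alpha> i)\<^sup>2) else 0)"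
proof -
  have \<Gamma>: "\<Gamma> i i m = - \<alpha> m" for i m by (simp add: \<Gamma>_def)
  have 1: "(\<Sum>i\<in>UNIV. D i i j k) = (if j = k then (\<Sum>i\<in>UNIV. B i i) else 0) - 2 * B j k"
    unfolding D_def by (auto simp: sum_subtractf sym)
  have 2: "(\<Sum>i\<in>UNIV. D j i i k) = - real CARD('n) * B j k"
    unfolding D_def by (simp add: sum_subtractf sym)
  have 3: "(\<Sum>m\<in>UNIV. \<alpha> m * \<Gamma> m j k) = (if j = k then (\<Sum>i\<in>UNIV. (\<alpha> i)\<^sup>2) else 0) - 2 * (\<alpha> j * \<alpha> k)" for j k
    unfolding \<Gamma>_def
    by (auto simp: right_diff_distrib sum_subtractf mult_delta power2_eq_square)
  have 4: "(\<Sum>m\<in>UNIV. \<Gamma> i j m * \<Gamma> m i k) = \<alpha> i * \<Gamma> j i k - \<alpha> j * \<Gamma> i i k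
      - (if i = j then \<Sum>m\<in>UNIV. \<alpha> m * \<Gamma> m i k else 0)" for i
  proof -
    have "\<Gamma> i j m * \<Gamma> m i k = (if j = m then \<alpha> i * \<Gamma> m i k else 0) - (if i = m then \<alpha> j * \<Gamma> m i k else 0)
       - (if i = j then \<alpha> m * \<Gamma> m i k else 0)" for m
      by (subst \<Gamma>_def) (auto simp: algebra_simps)
    thus ?thesis by (simp add: sum_subtractf)
  qed
  have 5: "(\<Sum>i\<in>UNIV. \<alpha> i * \<Gamma> j i k) = - (if j = k then (\<Sum>i\<in>UNIV. (\<alpha> i)\<^sup>2) else 0)"
    unfolding \<Gamma>_def
    by (auto simp: right_diff_distrib sum_subtractf mult_delta power2_eq_square)
  have 6: "(\<Sum>i\<in>UNIV. if i = j then \<Sum>m\<in>UNIV. \<alpha> m * \<Gamma> m i k else 0) = (\<Sum>m\<in>UNIV. \<alpha> m * \<Gamma> m j k)"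
    by simp
  have "(\<Sum>i\<in>UNIV. \<Sum>m\<in>UNIV. \<Gamma> i j m * \<Gamma> m i k) = (real CARD('n) + 2) * (\<alpha> j * \<alpha> k)
      - 2 * (if j = k then (\<Sum>i\<in>UNIV. (\<alpha> i)\<^sup>2) else 0)"
    unfolding 4 sum_subtractf 5 6 3 unfolding \<Gamma> by (simp add: algebra_simps)
  moreover have "(\<Sum>i\<in>(UNIV::'n set). \<Sum>m\<in>UNIV. \<Gamma> i i m * \<Gamma> m j k)
     = real CARD('n) * (2 * (\<alpha> j * \<alpha> k) - (if j = k then (\<Sum>i\<in>UNIV. (\<alpha> i)\<^sup>2) else 0))"
    unfolding \<Gamma> using 3[of j k] by (simp add: sum_negf)
  ultimately show ?thesis
    unfolding sum.distrib sum_subtractf 1 2 by (cases "j = k") (simp_all add: algebra_simps)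
qed

lemma matrix_inv_scaled_mat_1:
  fixes c :: real
  assumes "c \<noteq> 0"
  shows "matrix_inv (c *\<^sub>R mat 1 :: real^'n^'n) = (1 / c) *\<^sub>R mat 1"
proof -
  let ?A = "c *\<^sub>R mat 1 :: real^'n^'n"
  have "\<exists>B. ?A ** B = mat 1 \<and> B ** ?A = mat 1"
    using assms by (intro exI[of _ "(1 / c) *\<^sub>R mat 1"]) (simp flip: scalar_matrix_assoc add: matrix_scalar_ac)
  hence "?A ** matrix_inv ?A = mat 1" unfolding matrix_inv_def by (rule someI2_ex) simp
  hence "c *\<^sub>R matrix_inv ?A = mat 1" by (simp flip: scalar_matrix_assoc)
  hence "(1 / c) *\<^sub>R (c *\<^sub>R matrix_inv ?A) = (1 / c) *\<^sub>R mat 1" by simp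
  thus ?thesis using assms by simp
qed

lemma conformally_flat_christoffel:
  fixes u :: "real^'n \<Rightarrow> real"
  assumes U: "open U" "Ck_on 1 U u" "\<And>y. y \<in> U \<Longrightarrow> u y > 0"
    and G: "\<And>y. y \<in> U \<Longrightarrow> G y = (1 / (u y)\<^sup>2) *\<^sub>R mat 1" and y: "y \<in> U"
  shows "christoffel G l i j y = (if i = j then pd l u y / u y else 0)
    - (if j = l then pd i u y / u y else 0) - (if i = l then pd j u y / u y else 0)"
proof -
  have d: "(u has_derivative frechet_derivative u (at y)) (at y)"
    using U(2) y by (intro Ck_on_has_derivative[of 0]) auto
  have u: "u y > 0" using U(3) y .
  have G': "G z $ i $ j = (if i = j then 1 / (u z)\<^sup>2 else 0)" if "z \<in> U" for z i j
    using G[OF that] by (simp add: mat_def)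
  have p: "pd k (\<lambda>z. G z $ i $ j) y = (if i = j then - 2 * pd k u y / (u y) ^ 3 else 0)" for k i j
  proof -
    have "pd k (\<lambda>z. G z $ i $ j) y = pd k (\<lambda>z. if i = j then 1 / (u z)\<^sup>2 else 0) y"
      by (rule pd_cong_open[OF U(1) y]) (rule G')
    also have "\<dots> = (if i = j then - 2 * pd k u y / (u y) ^ 3 else 0)"
    proof (cases "i = j")
      case True
      have "((\<lambda>z. 1 / (u z)\<^sup>2) has_derivative (\<lambda>h. - 2 * frechet_derivative u (at y) h / (u y) ^ 3)) (at y)"
        using u by (auto intro!: derivative_eq_intros d simp: field_simps eval_nat_numeral)
      from pd_eqI[OF this, of k] True show ?thesis by (simp add: pd_def)
    next
      case False
      thus ?thesis by (simp add: pd_def frechet_derivative_const)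
    qed
    finally show ?thesis .
  qed
  have "matrix_inv (G y) $ l $ m = (if l = m then (u y)\<^sup>2 else 0)" for m
    unfolding G[OF y] using u by (subst matrix_inv_scaled_mat_1) (auto simp: mat_def)
  then have "christoffel G l i j y = (u y)\<^sup>2 * (pd i (\<lambda>y. G y $ j $ l) y + pd j (\<lambda>y. G y $ i $ l) y - pd l (\<lambda>y. G y $ i $ j) y) / 2"
    unfolding christoffel_def by (simp add: mult_delta)
  also have "\<dots> = (if i = j then pd l u y / u y else 0)
    - (if j = l then pd i u y / u y else 0) - (if i = l then pd j u y / u y else 0)"
    unfolding p using u by (auto simp: field_simps eval_nat_numeral)
  finally show ?thesis .
qed

lemma conformally_flat_schouten:
  fixes u :: "real^'n \<Rightarrow> real"
  assumes n: "CARD('n) > 2"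
    and U: "open U" "Ck_on 2 U u" "\<And>y. y \<in> U \<Longrightarrow> u y > 0"
    and G: "\<And>y. y \<in> U \<Longrightarrow> G y = (1 / (u y)\<^sup>2) *\<^sub>R mat 1" and x: "x \<in> U"
  shows "matrix_inv (G x) ** schouten G x =
    (\<chi> i j. u x * pd i (pd j u) x - (if i = j then (\<Sum>m\<in>UNIV. (pd m u x)\<^sup>2) / 2 else 0))"
proof -
  have C1: "Ck_on 1 U u" using U(2) Ck_on_le[of 1 2] by simp
  have u: "u x > 0" using U(3) x .
  define \<alpha> where "\<alpha> = (\<lambda>i. pd i u x / u x)"
  \<comment> \<open>\<open>B\<close> is the Hessian of log u, so
    \<open>B i j + \<alpha> i * \<alpha> j\<close> is the Hessian of u divided by u.\<close>
  define B where "B = (\<lambda>i j. pd i (pd j u) x / u x - \<alpha> i * \<alpha> j)"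
  have du: "(u has_derivative frechet_derivative u (at x)) (at x)"
    using C1 x by (intro Ck_on_has_derivative[of 0]) auto
  have dpu: "(pd j u has_derivative frechet_derivative (pd j u) (at x)) (at x)" for j
    using U(2) x unfolding pd_def by (intro Ck_on_has_derivative[of 0]) (auto simp: numeral_2_eq_2)
  have symB: "B i j = B j i" for i j
    using second_derivative_symmetric[OF U(1,2) x] by (simp add: B_def pd_def[abs_def] mult.commute)
  have quot: "((\<lambda>y. pd j u y / u y) has_derivative
      (\<lambda>h. frechet_derivative (pd j u) (at x) h / u x - pd j u x * frechet_derivative u (at x) h / (u x)\<^sup>2)) (at x)" for j
    using u by (auto intro!: derivative_eq_intros du dpu simp: field_simps power2_eq_square)
  have pquot: "pd m (\<lambda>y. pd j u y / u y) x = B m j" for m j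
    using pd_eqI[OF quot, of m j] by (simp add: B_def \<alpha>_def pd_def power2_eq_square)
  have dif: "((\<lambda>y. if P then pd j u y / u y else 0) has_derivative
      (\<lambda>h. if P then frechet_derivative (\<lambda>y. pd j u y / u y) (at x) h else 0)) (at x)" for P j
    using quot[of j] frechet_derivative_works differentiableI by (cases P) (auto intro: differentiableI)
  have chr: "christoffel G l i j x = (if i = j then \<alpha> l else 0) - (if j = l then \<alpha> i else 0) - (if i = l then \<alpha> j else 0)" for l i j
    unfolding \<alpha>_def using conformally_flat_christoffel[OF U(1) C1 U(3) G x] .
  have pchr: "pd m (christoffel G l i j) x = (if i = j then B m l else 0) - (if j = l then B m i else 0) - (if i = l then B m j else 0)" for m l i j
  proof -
    have "pd m (christoffel G l i j) x = pd m (\<lambda>y. (if i = j then pd l u y / u y else 0)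
        - (if j = l then pd i u y / u y else 0) - (if i = l then pd j u y / u y else 0)) x"
      by (rule pd_cong_open[OF U(1) x]) (rule conformally_flat_christoffel[OF U(1) C1 U(3) G])
    also have "\<dots> = (if i = j then B m l else 0) - (if j = l then B m i else 0) - (if i = l then B m j else 0)"
      unfolding pd_eqI[OF has_derivative_diff[OF has_derivative_diff[OF dif dif] dif]]
        pquot[symmetric] pd_def[of m] ..
    finally show ?thesis .
  qed
  define N where "N = real CARD('n)"
  have N: "N > 2" using n by (simp add: N_def)
  define S where "S = (\<Sum>i\<in>UNIV. (\<alpha> i)\<^sup>2)"
  define T where "T = (\<Sum>i\<in>UNIV. B i i)"
  have ric: "ricci G x $ j $ k = (N - 2) * (B j k + \<alpha> j * \<alpha> k) + (if j = k then T - (N - 2) * S else 0)" for j k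
    unfolding ricci_def riemann_def vec_lambda_beta chr pchr N_def S_def T_def
    using ricci_algebra[where B = B and \<alpha> = \<alpha> and j = j and k = k] symB by simp
  have inv: "matrix_inv (G x) = (u x)\<^sup>2 *\<^sub>R mat 1"
    unfolding G[OF x] using u by (subst matrix_inv_scaled_mat_1) auto
  have scal: "scalar_curv G x = (u x)\<^sup>2 * (\<Sum>i\<in>UNIV. ricci G x $ i $ i)"
    unfolding scalar_curv_def inv by (simp add: mat_def mult_delta sum_distrib_left)
  have "(\<Sum>i\<in>UNIV. ricci G x $ i $ i) = (N - 2) * (T + S) + N * (T - (N - 2) * S)"
    unfolding ric by (simp add: sum.distrib S_def[unfolded power2_eq_square, symmetric] T_def[symmetric]
        N_def[symmetric] flip: sum_distrib_left)
  also have "\<dots> = (2 * (N - 1)) * (T + S - N / 2 * S)" by (simp add: field_simps power2_eq_square)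
  finally have scal: "scalar_curv G x / (2 * (N - 1)) = (u x)\<^sup>2 * (T + S - N / 2 * S)"
    unfolding scal using N by simp
  \<comment> \<open>Subtracting the scalar part cancels the trace T and leaves only -S/2 on the
    diagonal.\<close>
  have sch: "schouten G x $ i $ j = B i j + \<alpha> i * \<alpha> j - (if i = j then S / 2 else 0)" for i j
  proof -
    have "schouten G x $ i $ j = 1 / (N - 2) * (ricci G x $ i $ j - scalar_curv G x / (2 * (N - 1)) * G x $ i $ j)"
      by (simp add: schouten_def N_def)
    also have "\<dots> = 1 / (N - 2) * ((N - 2) * (B i j + \<alpha> i * \<alpha> j - (if i = j then S / 2 else 0)))"
    proof -
      have "scalar_curv G x / (2 * (N - 1)) * G x $ i $ j = (if i = j then T + S - N / 2 * S else 0)"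
        unfolding scal G[OF x] using u by (simp add: mat_def)
      hence "ricci G x $ i $ j - scalar_curv G x / (2 * (N - 1)) * G x $ i $ j
          = (N - 2) * (B i j + \<alpha> i * \<alpha> j - (if i = j then S / 2 else 0))"
        unfolding ric by (simp only:) (simp add: algebra_simps)
      thus ?thesis by (simp only:)
    qed
    finally show ?thesis using N by simp
  qed
  have SS: "(u x)\<^sup>2 * S = (\<Sum>m\<in>UNIV. (pd m u x)\<^sup>2)"
    unfolding S_def \<alpha>_def sum_distrib_left using u by (simp add: power_divide)
  have "matrix_inv (G x) ** schouten G x = (u x)\<^sup>2 *\<^sub>R schouten G x"
    unfolding inv by (simp flip: scalar_matrix_assoc)
  moreover have "(u x)\<^sup>2 * (B i j + \<alpha> i * \<alpha> j - (if i = j then S / 2 else 0))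
     = u x * pd i (pd j u) x - (if i = j then (\<Sum>m\<in>UNIV. (pd m u x)\<^sup>2) / 2 else 0)" for i j
    unfolding SS[symmetric] B_def using u by (auto simp: field_simps power2_eq_square)
  ultimately show ?thesis by (simp add: vec_eq_iff sch)
qed

section \<open>Touching the distance to a plane from below\<close>

text \<open>On the line y + t a a negative second derivative would make the first derivative
  negative just to the right of 0, and the mean value theorem would push F below its
  minimum.\<close>

lemma interior_minimum_second_order:
  fixes F :: "'a::real_normed_vector \<Rightarrow> real"
  assumes V: "open V" "y \<in> V" and F': "\<And>z. z \<in> V \<Longrightarrow> (F has_derivative F' z) (at z)"
    and F'': "((\<lambda>z. F' z a) has_derivative F'') (at y)"
    and min: "\<And>z. z \<in> V \<Longrightarrow> F y \<le> F z"
  shows "F' y a = 0" "F'' a \<ge> 0"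
proof -
  obtain r where r: "r > 0" "ball y r \<subseteq> V" using V openE by blast
  define c where "c = r / (norm a + 1)"
  have c: "c > 0" using r(1) by (simp add: c_def add_nonneg_pos)
  have inV: "y + t *\<^sub>R a \<in> V" if "\<bar>t\<bar> < c" for t
  proof -
    have "\<bar>t\<bar> * (norm a + 1) < c * (norm a + 1)"
      using that by (intro mult_strict_right_mono) (auto simp: add_nonneg_pos)
    also have "\<dots> = r"
      using add_nonneg_pos[OF norm_ge_zero[of a] zero_less_one] by (simp add: c_def)
    finally have "\<bar>t\<bar> * norm a < r" by (simp add: algebra_simps)
    hence "y + t *\<^sub>R a \<in> ball y r" by (simp add: dist_norm)
    thus ?thesis using r(2) by blast
  qed
  define g where "g = (\<lambda>t. F (y + t *\<^sub>R a))"
  define g' where "g' = (\<lambda>t. F' (y + t *\<^sub>R a) a)"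
  have g: "(g has_real_derivative g' t) (at t)" if "\<bar>t\<bar> < c" for t
    unfolding g_def g'_def by (rule line_derivative F' inV that)+
  have g'': "(g' has_real_derivative F'' a) (at 0)"
    unfolding g'_def using F'' by (intro line_derivative) simp
  have gmin: "g 0 \<le> g t" if "\<bar>t\<bar> < c" for t
    using min[OF inV[OF that]] by (simp add: g_def)
  have g0: "g' 0 = 0"
    using DERIV_local_min[OF g[of 0] c] gmin c by simp
  thus "F' y a = 0" by (simp add: g'_def)
  show "F'' a \<ge> 0"
  proof (rule ccontr)
    assume "\<not> F'' a \<ge> 0"
    then obtain e where e: "e > 0" "\<And>h. h > 0 \<Longrightarrow> h < e \<Longrightarrow> g' (0 + h) < g' 0"
      using DERIV_neg_dec_right[OF g''] by force
    define h where "h = min e c / 2"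
    have h: "h > 0" "h < e" "h < c" using e(1) c by (auto simp: h_def)
    have "\<exists>z>0. z < h \<and> g h - g 0 = (h - 0) * g' z"
      using h by (intro MVT2 g) auto
    then obtain z where z: "z > 0" "z < h" "g h - g 0 = h * g' z" by auto
    have "g' z < 0" using e(2)[of z] z h g0 by simp
    hence "g h < g 0" using z(3) h(1) mult_pos_neg[of h "g' z"] by simp
    with gmin[of h] h show False by simp
  qed
qed

text \<open>The projection goes onto the normal space of a plane: \<open>norm (pr (x - m))\<close>
  is the distance from x to m + ker pr.\<close>

locale orthogonal_projection =
  fixes pr :: "'a::euclidean_space \<Rightarrow> 'a"
  assumes lin: "linear pr" and selfadjoint: "pr x \<bullet> y = x \<bullet> pr y" and idem: "pr (pr x) = pr x"
begin

lemma norm_sq: "(norm (pr x))\<^sup>2 = x \<bullet> pr x"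
  by (metis idem power2_norm_eq_inner selfadjoint)

lemma norm_le: "norm (pr x) \<le> norm x"
proof -
  have "norm (pr x) * norm (pr x) \<le> norm x * norm (pr x)"
    using norm_sq[of x] norm_cauchy_schwarz[of x "pr x"] by (simp add: power2_eq_square)
  thus ?thesis by (cases "pr x = 0") auto
qed

lemma diff: "pr (x - y) = pr x - pr y" using lin by (rule linear_diff)

lemma has_derivative_proj: "((\<lambda>z. pr (z - m)) has_derivative pr) (at z)"
proof -
  have "bounded_linear pr" using lin linear_conv_bounded_linear by blast
  moreover have "((\<lambda>z. z - m) has_derivative (\<lambda>h. h)) (at z)" by (auto intro!: derivative_eq_intros)
  ultimately show ?thesis by (rule bounded_linear.has_derivative)
qed

lemma has_derivative_dist_sq:
  "((\<lambda>z. (norm (pr (z - m)))\<^sup>2) has_derivative (\<lambda>h. 2 * (pr (z - m) \<bullet> h))) (at z)"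
proof -
  from has_derivative_inner[OF has_derivative_proj[of m z] has_derivative_proj[of m z]]
  have 1: "((\<lambda>z. (norm (pr (z - m)))\<^sup>2) has_derivative (\<lambda>h. pr (z - m) \<bullet> pr h + pr h \<bullet> pr (z - m))) (at z)"
    by (simp only: power2_norm_eq_inner)
  have 2: "pr (z - m) \<bullet> pr h + pr h \<bullet> pr (z - m) = 2 * (pr (z - m) \<bullet> h)" for h
    using selfadjoint[of "pr (z - m)" h] unfolding idem inner_commute[of "pr h"] by linarith
  from 1 show ?thesis unfolding 2 .
qed

text \<open>Comparing \<open>u\<^sup>2\<close> with \<open>K\<^sup>2 |pr(\<cdot> - m)|\<^sup>2\<close> instead of \<open>u\<close> with \<open>K |pr(\<cdot> - m)|\<close> keeps the comparison
  function quadratic.\<close>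

lemma touching_point:
  fixes u :: "'a \<Rightarrow> real"
  assumes U: "open U" "Ck_on 2 U u" "cball x0 (d/2) \<subseteq> U" and upos: "\<And>x. x \<in> U \<Longrightarrow> u x > 0"
    and d: "d > 0" and \<eta>: "\<eta> > 0" and K: "K > 0" and l: "l > 0" "l \<le> K"
    and x0: "norm (pr (x0 - m)) \<le> d" "u x0 \<ge> l * d"
    and upper: "\<And>x. x \<in> cball x0 (d/2) \<Longrightarrow> u x \<le> K * (norm (pr (x - m)) + \<eta> * d)"
    and \<delta>: "\<delta> = 2 * (K\<^sup>2 - l\<^sup>2) + 2 * K\<^sup>2 * (3 * \<eta> + \<eta>\<^sup>2) + \<eta>"
  obtains y where "y \<in> ball x0 (d/2)"
    "\<And>h. u y * frechet_derivative u (at y) h = (K\<^sup>2 *\<^sub>R pr (y - m) + (2 * \<delta>) *\<^sub>R (y - x0)) \<bullet> h"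
    "\<And>a. u y * frechet_derivative (\<lambda>z. frechet_derivative u (at z) a) (at y) a
        + (frechet_derivative u (at y) a)\<^sup>2 \<le> K\<^sup>2 * (a \<bullet> pr a) + 2 * \<delta> * (a \<bullet> a)"
    "(u y)\<^sup>2 \<ge> K\<^sup>2 * (norm (pr (y - m)))\<^sup>2 - (K\<^sup>2 - l\<^sup>2) * d\<^sup>2"
proof -
  define F where "F = (\<lambda>z. K\<^sup>2 / 2 * (norm (pr (z - m)))\<^sup>2 + \<delta> * (norm (z - x0))\<^sup>2 - 1 / 2 * (u z)\<^sup>2)"
  define u' where "u' = (\<lambda>z. frechet_derivative u (at z))"
  have du: "(u has_derivative u' z) (at z)" if "z \<in> U" for z
    unfolding u'_def using U(2) that by (intro Ck_on_has_derivative[of 1 U]) (auto simp: numeral_2_eq_2)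
  have d2u: "((\<lambda>z. u' z a) has_derivative frechet_derivative (\<lambda>z. u' z a) (at z)) (at z)" if "z \<in> U" for z a
    unfolding u'_def using U(2) that by (intro Ck_on_has_derivative[of 0 U]) (auto simp: numeral_2_eq_2)
  define F' where "F' = (\<lambda>z h. K\<^sup>2 * (pr (z - m) \<bullet> h) + 2 * \<delta> * ((z - x0) \<bullet> h) - u z * u' z h)"
  have dF: "(F has_derivative F' z) (at z)" if "z \<in> U" for z
  proof -
    have 1: "((\<lambda>z. (norm (z - x0))\<^sup>2) has_derivative (\<lambda>h. 2 * ((z - x0) \<bullet> h))) (at z)"
      unfolding power2_norm_eq_inner by (auto intro!: derivative_eq_intros simp: inner_commute)
    have 2: "((\<lambda>z. (u z)\<^sup>2) has_derivative (\<lambda>h. 2 * (u z * u' z h))) (at z)"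
      by (rule derivative_eq_intros du[OF that] refl)+ (simp add: fun_eq_iff)
    show ?thesis unfolding F_def F'_def
      by (rule has_derivative_eq_rhs[OF has_derivative_diff[OF has_derivative_add[OF
          has_derivative_mult_right[OF has_derivative_dist_sq] has_derivative_mult_right[OF 1]]
          has_derivative_mult_right[OF 2]]]) (simp add: fun_eq_iff)
  qed
  have d2F: "((\<lambda>z. F' z a) has_derivative (\<lambda>h. K\<^sup>2 * (pr h \<bullet> a) + 2 * \<delta> * (h \<bullet> a)
      - (u y * frechet_derivative (\<lambda>z. u' z a) (at y) h + u' y h * u' y a))) (at y)" if "y \<in> U" for y a
    unfolding F'_def by (rule derivative_eq_intros d2u[OF that] du[OF that] has_derivative_proj refl | simp)+
  have contF: "continuous_on (cball x0 (d/2)) F"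
    using dF U(3) has_derivative_continuous by (intro continuous_at_imp_continuous_on) blast
  obtain y where y: "y \<in> cball x0 (d/2)" "\<And>z. z \<in> cball x0 (d/2) \<Longrightarrow> F y \<le> F z"
    using continuous_attains_inf[OF compact_cball _ contF] d by auto
  have x0in: "x0 \<in> cball x0 (d/2)" using d by simp
  have "(l * d)\<^sup>2 \<le> (u x0)\<^sup>2" using x0(2) l d by (intro power_mono) auto
  moreover have "K\<^sup>2 * (norm (pr (x0 - m)))\<^sup>2 \<le> K\<^sup>2 * d\<^sup>2" using x0(1) by (intro mult_left_mono power_mono) auto
  ultimately have F0: "F x0 \<le> (K\<^sup>2 - l\<^sup>2) * d\<^sup>2 / 2" by (simp add: F_def power_mult_distrib algebra_simps)
  \<comment> \<open>The constant \<delta> is the one for which \<delta> (d/2)^2 pays for the bound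
    on \<open>F x0\<close>, for the excess of u^2 over K^2 h^2 on the boundary sphere, and for a
    margin \<eta> (d/2)^2; its 3 is twice 3/2, from h \<le> 3d/2. Hence the minimum of F is
    interior.\<close>
  have Fbd: "F z > F x0" if z: "dist x0 z = d/2" for z
  proof -
    define h where "h = norm (pr (z - m))"
    have zin: "z \<in> cball x0 (d/2)" using z by simp
    have "pr (z - m) = pr (x0 - m) + pr (z - x0)" by (simp add: diff)
    hence "h \<le> norm (pr (x0 - m)) + norm (pr (z - x0))" unfolding h_def using norm_triangle_ineq by metis
    also have "\<dots> \<le> d + d/2" using x0(1) norm_le[of "z - x0"] z by (simp add: dist_norm norm_minus_commute)
    finally have h: "h \<le> 3 / 2 * d" by simp
    have "0 < u z" using upos U(3) zin by blast
    hence "(u z)\<^sup>2 \<le> (K * (h + \<eta> * d))\<^sup>2" using upper[OF zin] unfolding h_def by (intro power_mono) auto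
    also have "\<dots> = K\<^sup>2 * h\<^sup>2 + K\<^sup>2 * (2 * \<eta> * d * h) + K\<^sup>2 * (\<eta>\<^sup>2 * d\<^sup>2)"
      by (simp add: power2_eq_square algebra_simps)
    also have "\<dots> \<le> K\<^sup>2 * h\<^sup>2 + K\<^sup>2 * (2 * \<eta> * d * (3 / 2 * d)) + K\<^sup>2 * (\<eta>\<^sup>2 * d\<^sup>2)"
      using h \<eta> d by (intro add_mono mult_left_mono) auto
    finally have uz: "(u z)\<^sup>2 \<le> K\<^sup>2 * h\<^sup>2 + K\<^sup>2 * (3 * \<eta> + \<eta>\<^sup>2) * d\<^sup>2"
      by (simp add: power2_eq_square algebra_simps)
    have nz: "norm (z - x0) = d/2" using z by (simp add: dist_norm norm_minus_commute)
    have "F z = K\<^sup>2 / 2 * h\<^sup>2 + \<delta> * (d/2)\<^sup>2 - (u z)\<^sup>2 / 2" by (simp add: F_def nz h_def)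
    also have "\<dots> \<ge> \<delta> * (d/2)\<^sup>2 - K\<^sup>2 * (3 * \<eta> + \<eta>\<^sup>2) * d\<^sup>2 / 2"
      using uz by simp
    also have "\<delta> * (d/2)\<^sup>2 - K\<^sup>2 * (3 * \<eta> + \<eta>\<^sup>2) * d\<^sup>2 / 2 = (K\<^sup>2 - l\<^sup>2) * d\<^sup>2 / 2 + \<eta> * (d/2)\<^sup>2"
      unfolding \<delta> by (simp add: power2_eq_square field_simps)
    finally have "F z \<ge> (K\<^sup>2 - l\<^sup>2) * d\<^sup>2 / 2 + \<eta> * (d/2)\<^sup>2" .
    moreover have "\<eta> * (d/2)\<^sup>2 > 0" using \<eta> d by simp
    ultimately show ?thesis using F0 by linarith
  qed
  have yb: "y \<in> ball x0 (d/2)"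
    using y(1) y(2)[OF x0in] Fbd[of y] by force
  have yU: "y \<in> U" using y(1) U(3) by blast
  have bU: "ball x0 (d/2) \<subseteq> U" using U(3) ball_subset_cball by blast
  note so = interior_minimum_second_order[OF open_ball yb dF d2F[OF yU]]
  have 1: "F' y a = 0" for a using y(2) bU by (intro so) auto
  have 2: "K\<^sup>2 * (pr a \<bullet> a) + 2 * \<delta> * (a \<bullet> a) - (u y * frechet_derivative (\<lambda>z. u' z a) (at y) a + u' y a * u' y a) \<ge> 0" for a
    using y(2) bU by (intro so(2)) auto
  have \<delta>0: "\<delta> \<ge> 0" unfolding \<delta> using l \<eta> K by (simp add: power_mono)
  \<comment> \<open>Discarding the nonnegative perturbation term leaves a lower bound for u at the
    contact point.\<close>
  have "F y \<le> (K\<^sup>2 - l\<^sup>2) * d\<^sup>2 / 2" using y(2)[OF x0in] F0 by simp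
  hence 3: "K\<^sup>2 * (norm (pr (y - m)))\<^sup>2 - (u y)\<^sup>2 \<le> (K\<^sup>2 - l\<^sup>2) * d\<^sup>2"
    unfolding F_def using mult_nonneg_nonneg[OF \<delta>0 zero_le_power2[of "norm (y - x0)"]] by linarith
  show ?thesis
  proof (rule that[OF yb])
    show "u y * frechet_derivative u (at y) h = (K\<^sup>2 *\<^sub>R pr (y - m) + (2 * \<delta>) *\<^sub>R (y - x0)) \<bullet> h" for h
      using 1[of h] by (simp add: F'_def u'_def inner_simps)
    show "u y * frechet_derivative (\<lambda>z. frechet_derivative u (at z) a) (at y) a
        + (frechet_derivative u (at y) a)\<^sup>2 \<le> K\<^sup>2 * (a \<bullet> pr a) + 2 * \<delta> * (a \<bullet> a)" for a
      using 2[of a] by (simp add: u'_def power2_eq_square inner_commute)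
    show "(u y)\<^sup>2 \<ge> K\<^sup>2 * (norm (pr (y - m)))\<^sup>2 - (K\<^sup>2 - l\<^sup>2) * d\<^sup>2" using 3 by simp
  qed
qed

text \<open>At the contact point u g = K^2 z + e with u close to K |z|, so g is close to K times the
  unit vector along z. \<open>E * d\<close> bounds the difference of u and K |z|: the summand K
  \<eta> comes from the upper bound for u, the other one from the lower bound for u^2.\<close>

lemma gradient_estimate:
  fixes z g e :: 'a
  assumes d: "d > 0" and K: "K > 0" and l: "0 < l" "l \<le> K" and \<eta>: "\<eta> > 0" and \<delta>: "\<delta> \<ge> 0"
    and z: "norm z \<ge> d / 4" and up: "u \<le> K * (norm z + \<eta> * d)"
    and lo: "u\<^sup>2 \<ge> K\<^sup>2 * (norm z)\<^sup>2 - (K\<^sup>2 - l\<^sup>2) * d\<^sup>2" and u: "u > 0"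
    and e: "norm e \<le> \<delta> * d" and g: "u *\<^sub>R g = K\<^sup>2 *\<^sub>R z + e"
    and E: "E = K * \<eta> + 4 * (K\<^sup>2 - l\<^sup>2) / K" "E < K / 4"
  shows "norm (g - K *\<^sub>R (z /\<^sub>R norm z)) \<le> (K * E + \<delta>) / (K / 4 - E)"
proof -
  define h where "h = norm z"
  have h: "h > 0" "h \<ge> d / 4" using z d unfolding h_def by linarith+
  have Kl: "K\<^sup>2 - l\<^sup>2 \<ge> 0" using l by (simp add: power_mono)
  have 1: "u - K * h \<le> K * \<eta> * d" using up by (simp add: h_def algebra_simps)
  \<comment> \<open>The difference of squares is divided by K h + u \<ge> K d / 4; this is the
    origin of the factor 4 in E.\<close>
  have 2: "K * h - u \<le> 4 * (K\<^sup>2 - l\<^sup>2) / K * d"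
  proof (cases "K * h \<le> u")
    case True
    moreover have "4 * (K\<^sup>2 - l\<^sup>2) / K * d \<ge> 0" using Kl K d by simp
    ultimately show ?thesis by linarith
  next
    case False
    have Kd: "K * d / 4 \<le> K * h" using mult_left_mono[OF h(2), of K] K by simp
    have "(K * h - u) * (K * d / 4) \<le> (K * h - u) * (K * h + u)"
      using False u Kd by (intro mult_left_mono) linarith+
    also have "\<dots> \<le> (K\<^sup>2 - l\<^sup>2) * d\<^sup>2" using lo by (simp add: h_def power2_eq_square algebra_simps)
    finally have "(K * h - u) * (K / 4) * d \<le> (K\<^sup>2 - l\<^sup>2) * d * d" by (simp add: power2_eq_square algebra_simps)
    hence "(K * h - u) * (K / 4) \<le> (K\<^sup>2 - l\<^sup>2) * d" using d by simp
    thus ?thesis using K by (simp add: field_simps)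
  qed
  have Ed: "\<bar>K * h - u\<bar> \<le> E * d"
  proof -
    have "4 * (K\<^sup>2 - l\<^sup>2) / K * d \<ge> 0" "K * \<eta> * d \<ge> 0" using Kl K d \<eta> by simp_all
    thus ?thesis using 1 2 unfolding E(1) by (simp add: distrib_right abs_le_iff)
  qed
  have ulo: "u \<ge> (K / 4 - E) * d"
  proof -
    have "K * (d / 4) \<le> K * h" using h(2) K by (intro mult_left_mono) auto
    moreover have "K * h - u \<le> E * d" using Ed by linarith
    ultimately show ?thesis by (simp add: algebra_simps)
  qed
  have E0: "E \<ge> 0" using E(1) K \<eta> Kl by simp
  have zh: "K\<^sup>2 *\<^sub>R z = (K\<^sup>2 * h) *\<^sub>R (z /\<^sub>R h)" using h by simp
  have "u *\<^sub>R (g - K *\<^sub>R (z /\<^sub>R h)) = (K * (K * h - u)) *\<^sub>R (z /\<^sub>R h) + e"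
    unfolding scaleR_diff_right g zh by (simp add: scaleR_diff_left power2_eq_square right_diff_distrib mult.commute mult.left_commute)
  hence "norm (u *\<^sub>R (g - K *\<^sub>R (z /\<^sub>R h))) \<le> norm ((K * (K * h - u)) *\<^sub>R (z /\<^sub>R h)) + norm e"
    by (metis norm_triangle_ineq)
  also have "norm ((K * (K * h - u)) *\<^sub>R (z /\<^sub>R h)) = K * \<bar>K * h - u\<bar>"
    using K h by (simp add: h_def abs_mult)
  also have "K * \<bar>K * h - u\<bar> + norm e \<le> K * (E * d) + \<delta> * d"
    using Ed e K by (intro add_mono mult_left_mono) auto
  also have "\<dots> = (K * E + \<delta>) * d" by (simp add: algebra_simps)
  finally have "u * norm (g - K *\<^sub>R (z /\<^sub>R h)) \<le> (K * E + \<delta>) * d"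
    using u by (simp only: norm_scaleR abs_of_pos)
  moreover have "(K / 4 - E) * d * norm (g - K *\<^sub>R (z /\<^sub>R h)) \<le> u * norm (g - K *\<^sub>R (z /\<^sub>R h))"
    using ulo by (intro mult_right_mono) auto
  ultimately have "(K / 4 - E) * norm (g - K *\<^sub>R (z /\<^sub>R h)) * d \<le> (K * E + \<delta>) * d" by (simp add: algebra_simps)
  hence "(K / 4 - E) * norm (g - K *\<^sub>R (z /\<^sub>R h)) \<le> K * E + \<delta>" using d by simp
  thus ?thesis using E(2) by (simp add: h_def field_simps)
qed

text \<open>The threshold for \<eta> is uniform in u, the base point and the scale d: the
  submanifold is close to a plane with tolerance \<eta> only at scales d that are chosen after
  \<eta>. The vector \<nu> is the direction of the gradient of the distance to the plane.\<close>

lemma touching_quadratic_form: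
  fixes u :: "'a \<Rightarrow> real"
  assumes L: "L > 0" and \<tau>: "\<tau> > 0"
  shows "\<forall>\<^sub>F \<eta> in at_right 0. \<forall>U u x0 m d. open U \<longrightarrow> Ck_on 2 U u \<longrightarrow> cball x0 (d/2) \<subseteq> U \<longrightarrow>
    (\<forall>x\<in>U. u x > 0) \<longrightarrow> d > 0 \<longrightarrow> norm (pr (x0 - m)) \<le> d \<longrightarrow> u x0 \<ge> (L - \<eta>) * d \<longrightarrow>
    (\<forall>x\<in>cball x0 (d/2). u x \<le> (L + \<eta>) * (norm (pr (x - m)) + \<eta> * d)) \<longrightarrow>
    (\<exists>y\<in>U. \<exists>\<nu> g. norm \<nu> = 1 \<and> pr \<nu> = \<nu> \<and> (\<forall>h. frechet_derivative u (at y) h = g \<bullet> h) \<and>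
      (\<forall>a. u y * frechet_derivative (\<lambda>z. frechet_derivative u (at z) a) (at y) a - (norm g)\<^sup>2 / 2 * (a \<bullet> a)
        \<le> (L\<^sup>2 / 2 + \<tau>) * (a \<bullet> a)) \<and>
      (\<forall>t s. pr t = 0 \<longrightarrow> (let a = t + s *\<^sub>R \<nu> in
         u y * frechet_derivative (\<lambda>z. frechet_derivative u (at z) a) (at y) a - (norm g)\<^sup>2 / 2 * (a \<bullet> a)
        \<le> (- L\<^sup>2 / 2 + \<tau>) * (a \<bullet> a))))"
proof -
  define K where "K = (\<lambda>\<eta>. L + \<eta>)"
  define l where "l = (\<lambda>\<eta>. L - \<eta>)"
  define \<delta> where "\<delta> = (\<lambda>\<eta>. 2 * ((K \<eta>)\<^sup>2 - (l \<eta>)\<^sup>2) + 2 * (K \<eta>)\<^sup>2 * (3 * \<eta> + \<eta>\<^sup>2) + \<eta>)"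
  define E where "E = (\<lambda>\<eta>. K \<eta> * \<eta> + 4 * ((K \<eta>)\<^sup>2 - (l \<eta>)\<^sup>2) / K \<eta>)"
  \<comment> \<open>\<open>\<rho> \<eta>\<close> is the bound that \<open>gradient_estimate\<close>
    gives for the distance of the gradient to K \<nu>.\<close>
  define \<rho> where "\<rho> = (\<lambda>\<eta>. (K \<eta> * E \<eta> + \<delta> \<eta>) / (K \<eta> / 4 - E \<eta>))"
  have K: "(K \<longlongrightarrow> L) (at_right 0)" unfolding K_def by (rule tendsto_eq_intros | simp)+
  have l: "(l \<longlongrightarrow> L) (at_right 0)" unfolding l_def by (rule tendsto_eq_intros | simp)+
  have \<delta>: "(\<delta> \<longlongrightarrow> 0) (at_right 0)" unfolding \<delta>_def by (rule tendsto_eq_intros K l | simp)+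
  have E: "(E \<longlongrightarrow> 0) (at_right 0)" unfolding E_def using L by (auto intro!: tendsto_eq_intros K l)
  have \<rho>: "(\<rho> \<longlongrightarrow> 0) (at_right 0)" unfolding \<rho>_def using L by (auto intro!: tendsto_eq_intros K \<delta> E)
  have 1: "\<forall>\<^sub>F \<eta> in at_right 0. l \<eta> > 0" using order_tendstoD(1)[OF l L] .
  have "((\<lambda>\<eta>. l \<eta> / K \<eta> - \<eta>) \<longlongrightarrow> 1) (at_right 0)" using L by (auto intro!: tendsto_eq_intros K l)
  hence 2: "\<forall>\<^sub>F \<eta> in at_right 0. l \<eta> / K \<eta> - \<eta> > 3 / 4" by (rule order_tendstoD(1)) simp
  have "((\<lambda>\<eta>. K \<eta> / 4 - E \<eta>) \<longlongrightarrow> L / 4) (at_right 0)" by (auto intro!: tendsto_eq_intros K E)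
  hence 3: "\<forall>\<^sub>F \<eta> in at_right 0. K \<eta> / 4 - E \<eta> > 0" by (rule order_tendstoD(1)) (use L in simp)
  have "((\<lambda>\<eta>. K \<eta> - \<rho> \<eta>) \<longlongrightarrow> L) (at_right 0)" by (auto intro!: tendsto_eq_intros K \<rho>)
  hence 4: "\<forall>\<^sub>F \<eta> in at_right 0. K \<eta> - \<rho> \<eta> > 0" by (rule order_tendstoD(1)) (use L in simp)
  have "((\<lambda>\<eta>. (K \<eta>)\<^sup>2 + 2 * \<delta> \<eta> - (K \<eta> - \<rho> \<eta>)\<^sup>2 / 2) \<longlongrightarrow> L\<^sup>2 / 2) (at_right 0)"
    by (auto intro!: tendsto_eq_intros K \<rho> \<delta>)
  hence 5: "\<forall>\<^sub>F \<eta> in at_right 0. (K \<eta>)\<^sup>2 + 2 * \<delta> \<eta> - (K \<eta> - \<rho> \<eta>)\<^sup>2 / 2 < L\<^sup>2 / 2 + \<tau>"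
    by (rule order_tendstoD(2)) (use \<tau> in simp)
  have "((\<lambda>\<eta>. 2 * \<delta> \<eta> + 2 * K \<eta> * \<rho> \<eta> - (K \<eta> - \<rho> \<eta>)\<^sup>2 / 2) \<longlongrightarrow> - L\<^sup>2 / 2) (at_right 0)"
    by (auto intro!: tendsto_eq_intros K \<rho> \<delta>)
  hence 6: "\<forall>\<^sub>F \<eta> in at_right 0. 2 * \<delta> \<eta> + 2 * K \<eta> * \<rho> \<eta> - (K \<eta> - \<rho> \<eta>)\<^sup>2 / 2 < - L\<^sup>2 / 2 + \<tau>"
    by (rule order_tendstoD(2)) (use \<tau> in simp)
  have "\<forall>\<^sub>F \<eta> in at_right (0::real). \<eta> > 0" by (rule eventually_at_right_less)
  with 1 2 3 4 5 6 show ?thesis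
  proof (eventually_elim, intro allI impI)
    fix \<eta> :: real and U and u :: "'a \<Rightarrow> real" and x0 m and d :: real
    assume c: "l \<eta> > 0" "l \<eta> / K \<eta> - \<eta> > 3 / 4" "K \<eta> / 4 - E \<eta> > 0" "K \<eta> - \<rho> \<eta> > 0"
      "(K \<eta>)\<^sup>2 + 2 * \<delta> \<eta> - (K \<eta> - \<rho> \<eta>)\<^sup>2 / 2 < L\<^sup>2 / 2 + \<tau>"
      "2 * \<delta> \<eta> + 2 * K \<eta> * \<rho> \<eta> - (K \<eta> - \<rho> \<eta>)\<^sup>2 / 2 < - L\<^sup>2 / 2 + \<tau>" "\<eta> > 0"
    assume U: "open U" "Ck_on 2 U u" "cball x0 (d/2) \<subseteq> U" "\<forall>x\<in>U. u x > 0" and d: "d > 0"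
      and x0: "norm (pr (x0 - m)) \<le> d" "u x0 \<ge> (L - \<eta>) * d"
      and up: "\<forall>x\<in>cball x0 (d/2). u x \<le> (L + \<eta>) * (norm (pr (x - m)) + \<eta> * d)"
    have K0: "K \<eta> > 0" using L c by (simp add: K_def)
    have lK: "l \<eta> \<le> K \<eta>" using c by (simp add: l_def K_def)
    have \<delta>0: "\<delta> \<eta> \<ge> 0" unfolding \<delta>_def using c lK K0 by (simp add: power_mono)
    obtain y where y: "y \<in> ball x0 (d/2)"
      "\<And>h. u y * frechet_derivative u (at y) h = ((K \<eta>)\<^sup>2 *\<^sub>R pr (y - m) + (2 * \<delta> \<eta>) *\<^sub>R (y - x0)) \<bullet> h"
      "\<And>a. u y * frechet_derivative (\<lambda>z. frechet_derivative u (at z) a) (at y) a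
        + (frechet_derivative u (at y) a)\<^sup>2 \<le> (K \<eta>)\<^sup>2 * (a \<bullet> pr a) + 2 * \<delta> \<eta> * (a \<bullet> a)"
      "(u y)\<^sup>2 \<ge> (K \<eta>)\<^sup>2 * (norm (pr (y - m)))\<^sup>2 - ((K \<eta>)\<^sup>2 - (l \<eta>)\<^sup>2) * d\<^sup>2"
      using touching_point[OF U(1-3) _ d c(7) K0 c(1) lK x0(1), of "\<delta> \<eta>"] U(4) x0(2) up
      unfolding \<delta>_def K_def l_def by blast
    have yc: "y \<in> cball x0 (d/2)" using y(1) by auto
    hence yU: "y \<in> U" using U(3) by blast
    have uy: "u y > 0" using U(4) yU by blast
    define z where "z = pr (y - m)"
    define e where "e = (2 * \<delta> \<eta>) *\<^sub>R (y - x0)"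
    define g where "g = ((K \<eta>)\<^sup>2 *\<^sub>R z + e) /\<^sub>R u y"
    have g: "frechet_derivative u (at y) h = g \<bullet> h" for h
      using y(2)[of h] uy by (simp add: g_def z_def e_def divide_simps mult.commute)
    have ug: "u y *\<^sub>R g = (K \<eta>)\<^sup>2 *\<^sub>R z + e" using uy by (simp add: g_def)
    have ne: "norm e \<le> \<delta> \<eta> * d"
    proof -
      have "norm (y - x0) \<le> d/2" using yc by (simp add: dist_norm norm_minus_commute)
      from mult_left_mono[OF this, of "2 * \<delta> \<eta>"] \<delta>0 show ?thesis by (simp add: e_def)
    qed
    \<comment> \<open>The upper bound at x0 itself against u x0 \<ge> l d puts x0 at distance at
      least 3d/4 from the plane, and y is within d/2 of x0.\<close>
    have zd: "norm z \<ge> d / 4"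
    proof -
      have "l \<eta> * d \<le> K \<eta> * (norm (pr (x0 - m)) + \<eta> * d)"
        using x0(2) up d unfolding l_def K_def by (force intro: order_trans)
      hence "(l \<eta> / K \<eta> - \<eta>) * d \<le> norm (pr (x0 - m))" using K0 by (simp add: field_simps)
      moreover have "(l \<eta> / K \<eta> - \<eta>) * d \<ge> 3 / 4 * d" using c(2) d by (intro mult_right_mono) auto
      ultimately have "norm (pr (x0 - m)) \<ge> 3 / 4 * d" by linarith
      moreover have "norm (pr (x0 - m)) \<le> norm z + norm (pr (x0 - y))"
        using norm_triangle_ineq[of z "pr (x0 - y)"] by (simp add: z_def diff)
      moreover have "norm (pr (x0 - y)) \<le> d/2"
        using norm_le[of "x0 - y"] yc by (simp add: dist_norm)
      ultimately show ?thesis by linarith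
    qed
    define \<nu> where "\<nu> = z /\<^sub>R norm z"
    have z0: "norm z > 0" using zd d by linarith
    have \<nu>: "norm \<nu> = 1" "pr \<nu> = \<nu>" using z0 lin by (simp_all add: \<nu>_def linear_cmul z_def idem)
    have gr: "norm (g - K \<eta> *\<^sub>R \<nu>) \<le> \<rho> \<eta>"
      unfolding \<nu>_def \<rho>_def
      by (rule gradient_estimate[OF d K0 c(1) lK c(7) \<delta>0 zd _ _ uy ne ug])
        (use y(4) up yc c(3) in \<open>auto simp: z_def E_def K_def\<close>)
    have gK: "norm g \<ge> K \<eta> - \<rho> \<eta>"
      using gr norm_triangle_ineq2[of "K \<eta> *\<^sub>R \<nu>" g] \<nu>(1) K0 by (simp add: norm_minus_commute)
    hence g2: "(norm g)\<^sup>2 \<ge> (K \<eta> - \<rho> \<eta>)\<^sup>2" using c(4) by (intro power_mono) auto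
    define D where "D = (\<lambda>a. u y * frechet_derivative (\<lambda>z. frechet_derivative u (at z) a) (at y) a - (norm g)\<^sup>2 / 2 * (a \<bullet> a))"
    have D: "D a \<le> (K \<eta>)\<^sup>2 * (a \<bullet> pr a) - (g \<bullet> a)\<^sup>2 + (2 * \<delta> \<eta> - (K \<eta> - \<rho> \<eta>)\<^sup>2 / 2) * (a \<bullet> a)" for a
    proof -
      have "(K \<eta> - \<rho> \<eta>)\<^sup>2 / 2 * (a \<bullet> a) \<le> (norm g)\<^sup>2 / 2 * (a \<bullet> a)" using g2 by (intro mult_right_mono) auto
      thus ?thesis using y(3)[of a] unfolding D_def g by (simp add: algebra_simps)
    qed
    have "D a \<le> (L\<^sup>2 / 2 + \<tau>) * (a \<bullet> a)" for a
    proof -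
      have "a \<bullet> pr a \<le> a \<bullet> a"
        using norm_le[of a] unfolding norm_sq[symmetric] power2_norm_eq_inner[symmetric] by (intro power_mono) auto
      hence "(K \<eta>)\<^sup>2 * (a \<bullet> pr a) \<le> (K \<eta>)\<^sup>2 * (a \<bullet> a)" by (intro mult_left_mono) auto
      hence "D a \<le> ((K \<eta>)\<^sup>2 + 2 * \<delta> \<eta> - (K \<eta> - \<rho> \<eta>)\<^sup>2 / 2) * (a \<bullet> a)"
        using D[of a] by (simp add: algebra_simps) (smt (verit) zero_le_power2)
      also have "\<dots> \<le> (L\<^sup>2 / 2 + \<tau>) * (a \<bullet> a)" using c(5) by (intro mult_right_mono) auto
      finally show ?thesis .
    qed
    moreover have "D (t + s *\<^sub>R \<nu>) \<le> (- L\<^sup>2 / 2 + \<tau>) * ((t + s *\<^sub>R \<nu>) \<bullet> (t + s *\<^sub>R \<nu>))" if t: "pr t = 0" for t s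
    proof -
      define a where "a = t + s *\<^sub>R \<nu>"
      have pra: "pr a = s *\<^sub>R \<nu>" using t lin \<nu>(2) by (simp add: a_def linear_add linear_cmul)
      have aa: "a \<bullet> pr a = s\<^sup>2" using norm_sq[of a] unfolding pra using \<nu>(1) by simp
      have "t \<bullet> \<nu> = 0" by (metis \<nu>(2) inner_zero_left selfadjoint t)
      hence a\<nu>: "\<nu> \<bullet> a = s" using \<nu>(1) by (simp add: a_def inner_simps norm_eq_1 inner_commute)
      define r where "r = (g - K \<eta> *\<^sub>R \<nu>) \<bullet> a"
      \<comment> \<open>As the gradient is almost K \<nu>, its squared product with a cancels K^2
        s^2 up to a cross term of size \<rho>, and r^2 has the favourable sign. So on the tangential
        directions and on \<nu> only -|g|^2/2 survives, up to small errors.\<close>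
      have ga: "g \<bullet> a = K \<eta> * s + r" by (simp add: r_def inner_simps a\<nu>)
      have r: "\<bar>r\<bar> \<le> \<rho> \<eta> * norm a"
        unfolding r_def using Cauchy_Schwarz_ineq2 gr by (meson mult_right_mono norm_ge_zero order_trans)
      have s: "\<bar>s\<bar> \<le> norm a" using Cauchy_Schwarz_ineq2[of \<nu> a] \<nu>(1) a\<nu> by simp
      have "\<bar>s * r\<bar> \<le> norm a * (\<rho> \<eta> * norm a)"
        unfolding abs_mult using r s by (intro mult_mono) auto
      hence "- (s * r) \<le> \<rho> \<eta> * (a \<bullet> a)"
        by (simp add: power2_norm_eq_inner[symmetric] power2_eq_square algebra_simps abs_le_iff)
      hence "- (2 * K \<eta>) * (s * r) \<le> 2 * K \<eta> * (\<rho> \<eta> * (a \<bullet> a))" using K0 mult_left_mono[of "- (s * r)" "\<rho> \<eta> * (a \<bullet> a)" "2 * K \<eta>"] by simp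
      moreover have "(g \<bullet> a)\<^sup>2 = (K \<eta>)\<^sup>2 * s\<^sup>2 + 2 * K \<eta> * (s * r) + r\<^sup>2" unfolding ga by (simp add: power2_eq_square algebra_simps)
      moreover have "r\<^sup>2 \<ge> 0" by simp
      ultimately have "(K \<eta>)\<^sup>2 * s\<^sup>2 - (g \<bullet> a)\<^sup>2 \<le> 2 * K \<eta> * (\<rho> \<eta> * (a \<bullet> a))" by linarith
      hence "D a \<le> (2 * \<delta> \<eta> + 2 * K \<eta> * \<rho> \<eta> - (K \<eta> - \<rho> \<eta>)\<^sup>2 / 2) * (a \<bullet> a)"
        using D[of a] unfolding aa by (simp add: algebra_simps)
      also have "\<dots> \<le> (- L\<^sup>2 / 2 + \<tau>) * (a \<bullet> a)" using c(6) by (intro mult_right_mono) auto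
      finally show ?thesis by (simp only: a_def)
    qed
    ultimately show "\<exists>y\<in>U. \<exists>\<nu> g. norm \<nu> = 1 \<and> pr \<nu> = \<nu> \<and> (\<forall>h. frechet_derivative u (at y) h = g \<bullet> h) \<and>
      (\<forall>a. u y * frechet_derivative (\<lambda>z. frechet_derivative u (at z) a) (at y) a - (norm g)\<^sup>2 / 2 * (a \<bullet> a)
        \<le> (L\<^sup>2 / 2 + \<tau>) * (a \<bullet> a)) \<and>
      (\<forall>t s. pr t = 0 \<longrightarrow> (let a = t + s *\<^sub>R \<nu> in
         u y * frechet_derivative (\<lambda>z. frechet_derivative u (at z) a) (at y) a - (norm g)\<^sup>2 / 2 * (a \<bullet> a)
        \<le> (- L\<^sup>2 / 2 + \<tau>) * (a \<bullet> a)))"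
      using yU \<nu> g unfolding D_def Let_def by blast
  qed
qed

end

section \<open>Stereographic coordinates\<close>

text \<open>The speed of a \<open>valid_path\<close> may be unbounded near its break points. If the
  length is finite, the speed is Lebesgue integrable and dominates the derivative in the gauge
  integral, where the fundamental theorem permits finitely many exceptional points.\<close>

lemma dist_le_conf_length:
  assumes "valid_path \<gamma>"
  shows "ennreal (dist (pathstart \<gamma>) (pathfinish \<gamma>)) \<le> conf_length (\<lambda>_. 1) \<gamma>"
proof (cases "conf_length (\<lambda>_. 1) \<gamma> = \<infinity>")
  case True
  thus ?thesis by simp
next
  case False
  obtain S where S: "finite S" "continuous_on {0..1} \<gamma>" "\<gamma> C1_differentiable_on ({0..1} - S)"
    using assms unfolding valid_path_def piecewise_C1_differentiable_on_def by auto
  obtain D where "\<forall>t\<in>{0..1} - S. (\<gamma> has_vector_derivative D t) (at t)" "continuous_on ({0..1} - S) D"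
    using S(3) unfolding C1_differentiable_on_def by blast
  hence D: "\<And>t. t \<in> {0..1} - S \<Longrightarrow> (\<gamma> has_vector_derivative D t) (at t)" "continuous_on ({0..1} - S) D"
    by blast+
  define f where "f = (\<lambda>t. indicator ({0..1} - S) t *\<^sub>R norm (D t))"
  have "{0..1} - S \<in> sets borel" using S(1) by (auto intro: borel_closed finite_imp_closed)
  hence "f \<in> borel_measurable borel"
    unfolding f_def using D(2) by (intro borel_measurable_continuous_on_indicator continuous_on_norm)
  hence meas: "f \<in> borel_measurable lborel" by simp
  have nn: "f t \<ge> 0" for t by (simp add: f_def)
  have "AE t in lborel. t \<notin> S" using S(1) by (intro AE_not_in finite_imp_null_set_lborel)
  hence "(\<integral>\<^sup>+ t. ennreal (f t) \<partial>lborel) = conf_length (\<lambda>_. 1) \<gamma>"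
    unfolding conf_length_def
    by (intro nn_integral_cong_AE, eventually_elim)
      (auto simp: f_def indicator_def vector_derivative_at[OF D(1)])
  with False have fin: "(\<integral>\<^sup>+ t. ennreal (f t) \<partial>lborel) = conf_length (\<lambda>_. 1) \<gamma>" "conf_length (\<lambda>_. 1) \<gamma> < \<infinity>"
    by (auto simp: top.not_eq_extremum)
  have int: "integrable lborel f"
    using meas nn fin by (intro integrableI_nonneg) auto
  hence eq: "conf_length (\<lambda>_. 1) \<gamma> = ennreal (integral\<^sup>L lborel f)"
    using nn fin(1) by (subst nn_integral_eq_integral[symmetric]) auto
  have "(f has_integral (integral\<^sup>L lborel f)) UNIV" by (rule has_integral_integral_lborel[OF int])
  moreover have "f = (\<lambda>t. if t \<in> {0..1} then f t else 0)" by (auto simp: f_def indicator_def)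
  ultimately have hf: "(f has_integral (integral\<^sup>L lborel f)) {0..1}"
    by (metis has_integral_restrict_UNIV)
  define D0 where "D0 = (\<lambda>t. if t \<in> S then 0 else D t)"
  have hD: "(D0 has_integral (\<gamma> 1 - \<gamma> 0)) {0..1}"
    by (rule fundamental_theorem_of_calculus_strong[OF S(1)]) (use S(2) D(1) in \<open>auto simp: D0_def\<close>)
  have "norm (integral {0..1} D0) \<le> integral {0..1} f"
    using hf hD by (intro integral_norm_bound_integral) (auto simp: D0_def f_def indicator_def)
  hence "norm (\<gamma> 1 - \<gamma> 0) \<le> integral\<^sup>L lborel f"
    using hf hD by (simp add: integral_unique)
  thus ?thesis unfolding eq
    by (intro ennreal_leI) (simp add: dist_norm pathstart_def pathfinish_def norm_minus_commute)
qed

lemma dist_le_conf_dist: "ennreal (dist x y) \<le> conf_dist \<Omega> (\<lambda>_. 1) x y"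
  unfolding conf_dist_def using dist_le_conf_length by (intro INF_greatest) auto

section \<open>The stereographic chart\<close>

text \<open>J identifies \<open>real^'n\<close> with the hyperplane orthogonal to the pole N. The
  pole is a parameter since it has to avoid the submanifold.\<close>

locale stereographic =
  fixes N :: "(real^'n) \<times> real" and J :: "real^'n \<Rightarrow> (real^'n) \<times> real"
  assumes norm_N: "norm N = 1" and lin_J: "linear J" and inner_J: "J x \<bullet> J y = x \<bullet> y"
    and J_N: "J x \<bullet> N = 0" and surj_J: "q \<bullet> N = 0 \<Longrightarrow> \<exists>x. J x = q"
begin

text \<open>The conformal factor: \<phi> pulls the round metric back to w^2 \<delta> (see
  \<open>phi'_inner\<close>), so v^-2 times the round metric becomes u^-2 \<delta> with u = v /
  w.\<close>

definition w :: "real^'n \<Rightarrow> real" where "w x = 2 / (1 + x \<bullet> x)"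

text \<open>The second intersection of the sphere with the line from N through J x; w x is its
  parameter on that line.\<close>

definition \<phi> :: "real^'n \<Rightarrow> (real^'n) \<times> real" where "\<phi> x = N + w x *\<^sub>R (J x - N)"

definition \<psi> :: "(real^'n) \<times> real \<Rightarrow> real^'n" where "\<psi> q = (1 / (1 - q \<bullet> N)) *\<^sub>R adjoint J q"

lemma N_N: "N \<bullet> N = 1" using norm_N by (simp add: norm_eq_1)

lemma N_J: "N \<bullet> J x = 0" using J_N by (simp add: inner_commute)

lemma w_pos: "w x > 0" by (simp add: w_def add_pos_nonneg)

lemma w_le: "w x \<le> 2" by (simp add: w_def divide_le_eq add_pos_nonneg)

lemma w_mult: "w x * (1 + x \<bullet> x) = 2"
proof -
  have "1 + x \<bullet> x \<noteq> 0" by (metis add_nonneg_eq_0_iff inner_ge_zero zero_le_one zero_neq_one)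
  thus ?thesis unfolding w_def by (rule nonzero_eq_divide_eq[THEN iffD1, OF _ refl])
qed

lemma phi_inner: "\<phi> x \<bullet> \<phi> y = 1 - w x - w y + w x * w y * (x \<bullet> y + 1)"
  by (simp add: \<phi>_def inner_simps N_N N_J J_N inner_J algebra_simps)

lemma phi_inner_self: "\<phi> x \<bullet> \<phi> x = 1"
proof -
  have "\<phi> x \<bullet> \<phi> x = 1 - 2 * w x + w x * (w x * (1 + x \<bullet> x))"
    unfolding phi_inner by (simp add: algebra_simps)
  thus ?thesis unfolding w_mult by simp
qed

lemma phi_in_Sph: "\<phi> x \<in> Sph" using phi_inner_self[of x] by (simp add: norm_eq_1)

lemma phi_N: "1 - \<phi> x \<bullet> N = w x" by (simp add: \<phi>_def inner_simps N_N J_N algebra_simps)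

lemma adjoint_J: "adjoint J (J x) = x" "adjoint J N = 0"
proof -
  have "adjoint J (J x) \<bullet> y = x \<bullet> y" for y using adjoint_clauses(2)[OF lin_J, of "J x" y] by (simp add: inner_J)
  thus "adjoint J (J x) = x" by (metis vector_eq_rdot)
  have "adjoint J N \<bullet> y = 0 \<bullet> y" for y using adjoint_clauses(2)[OF lin_J, of N y] by (simp add: N_J)
  thus "adjoint J N = 0" by (metis vector_eq_rdot)
qed

lemma lin_adjoint: "linear (adjoint J)" by (rule adjoint_linear[OF lin_J])

lemma psi_phi: "\<psi> (\<phi> x) = x"
proof -
  have "adjoint J (\<phi> x) = w x *\<^sub>R x"
    unfolding \<phi>_def by (simp add: linear_add[OF lin_adjoint] linear_cmul[OF lin_adjoint] linear_diff[OF lin_adjoint] adjoint_J)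
  thus ?thesis using w_pos[of x] by (simp add: \<psi>_def phi_N)
qed

lemma J_adjoint: "J (adjoint J q) = q - (q \<bullet> N) *\<^sub>R N"
proof -
  have "(q - (q \<bullet> N) *\<^sub>R N) \<bullet> N = 0" by (simp add: inner_simps N_N)
  then obtain x where x: "J x = q - (q \<bullet> N) *\<^sub>R N" using surj_J by blast
  have "adjoint J q = adjoint J (J x + (q \<bullet> N) *\<^sub>R N)" by (simp add: x)
  also have "\<dots> = x" by (simp add: linear_add[OF lin_adjoint] linear_cmul[OF lin_adjoint] adjoint_J)
  finally show ?thesis using x by simp
qed

lemma Sph_inner_N: 
  assumes "q \<in> Sph" "q \<noteq> N"
  shows "q \<bullet> N < 1"
proof -
  have "q \<bullet> N \<le> norm q * norm N" by (rule norm_cauchy_schwarz)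
  moreover have "q \<bullet> N \<noteq> 1"
  proof
    assume "q \<bullet> N = 1"
    hence "(q - N) \<bullet> (q - N) = 0" using assms(1) N_N by (simp add: inner_simps inner_commute norm_eq_1)
    thus False using assms(2) by simp
  qed
  ultimately show ?thesis using assms(1) norm_N by simp
qed

lemma phi_psi:
  assumes "q \<in> Sph" "q \<noteq> N"
  shows "\<phi> (\<psi> q) = q"
proof -
  define s where "s = q \<bullet> N"
  have s: "s < 1" using Sph_inner_N[OF assms] by (simp add: s_def)
  define c where "c = 1 - s"
  have c: "c > 0" using s by (simp add: c_def)
  have qq: "q \<bullet> q = 1" using assms(1) by (simp add: norm_eq_1)
  have "adjoint J q \<bullet> adjoint J q = (q - s *\<^sub>R N) \<bullet> (q - s *\<^sub>R N)"
    unfolding s_def J_adjoint[symmetric] inner_J ..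
  also have "\<dots> = 1 - s\<^sup>2" by (simp add: inner_simps qq N_N inner_commute power2_eq_square s_def)
  also have "\<dots> = c * (1 + s)" by (simp add: c_def power2_eq_square algebra_simps)
  finally have "\<psi> q \<bullet> \<psi> q = (1 + s) / c"
    using c by (simp add: \<psi>_def s_def[symmetric] c_def[symmetric])
  hence "1 + \<psi> q \<bullet> \<psi> q = 2 / c" using c by (simp add: c_def field_simps)
  hence w: "w (\<psi> q) = c" using c by (simp add: w_def)
  have "J (\<psi> q) = (1 / c) *\<^sub>R (q - s *\<^sub>R N)"
    unfolding \<psi>_def linear_cmul[OF lin_J] J_adjoint by (simp add: s_def c_def)
  hence "\<phi> (\<psi> q) = N + (q - s *\<^sub>R N) - c *\<^sub>R N"
    using c by (simp add: \<phi>_def w scaleR_diff_right)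
  thus ?thesis by (simp add: c_def algebra_simps)
qed

lemma dist_phi_sq: "(dist (\<phi> x) (\<phi> y))\<^sup>2 = w x * w y * (dist x y)\<^sup>2"
proof -
  have "(dist (\<phi> x) (\<phi> y))\<^sup>2 = 2 - 2 * (\<phi> x \<bullet> \<phi> y)"
    unfolding dist_norm power2_norm_eq_inner
    by (simp add: inner_diff_left inner_diff_right phi_inner_self inner_commute)
  also have "\<dots> = (w x * 2) + w y * 2 - 2 * w x * w y * (x \<bullet> y + 1)"
    unfolding phi_inner by (simp add: algebra_simps)
  also have "\<dots> = w x * (w y * (1 + y \<bullet> y)) + w y * (w x * (1 + x \<bullet> x)) - 2 * w x * w y * (x \<bullet> y + 1)"
    unfolding w_mult ..
  also have "\<dots> = w x * w y * ((x - y) \<bullet> (x - y))"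
    by (simp add: inner_diff_left inner_diff_right inner_commute algebra_simps)
  finally show ?thesis by (simp add: dist_norm power2_norm_eq_inner)
qed

text \<open>The factor depends on r alone and tends to 1 with r, so the comparison of distances
  below is uniform in x.\<close>

lemma w_comparison:
  assumes "dist x z \<le> r"
  shows "w z \<le> (1 + r)\<^sup>2 * w x"
proof -
  have r: "r \<ge> 0" using assms zero_le_dist[of x z] by linarith
  have "norm x \<le> norm z + r"
    using assms norm_triangle_ineq2[of x z] by (simp add: dist_norm)
  hence "1 + (norm x)\<^sup>2 \<le> 1 + (norm z + r)\<^sup>2" by (intro add_left_mono power_mono) auto
  also have "\<dots> \<le> (1 + r)\<^sup>2 * (1 + (norm z)\<^sup>2)"
  proof -
    have "(1 + r)\<^sup>2 * (1 + (norm z)\<^sup>2) - (1 + (norm z + r)\<^sup>2)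
      = r * (norm z - 1)\<^sup>2 + r * (1 + (norm z)\<^sup>2) + r\<^sup>2 * (norm z)\<^sup>2"
      by (simp add: power2_eq_square algebra_simps)
    moreover have "\<dots> \<ge> 0" using r by simp
    ultimately show ?thesis by linarith
  qed
  finally have *: "1 + x \<bullet> x \<le> (1 + r)\<^sup>2 * (1 + z \<bullet> z)" by (simp add: power2_norm_eq_inner)
  have "1 + x \<bullet> x > 0" "1 + z \<bullet> z > 0" by (simp_all add: add_pos_nonneg)
  thus ?thesis using * unfolding w_def by (simp add: field_simps)
qed

definition \<phi>' :: "real^'n \<Rightarrow> real^'n \<Rightarrow> (real^'n) \<times> real" where
  "\<phi>' x h = (- (w x)\<^sup>2 * (x \<bullet> h)) *\<^sub>R (J x - N) + w x *\<^sub>R J h"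

lemma w_has_derivative: "(w has_derivative (\<lambda>h. - (w x)\<^sup>2 * (x \<bullet> h))) (at x)"
proof -
  have "1 + x \<bullet> x \<noteq> 0" using inner_ge_zero[of x] by linarith
  thus ?thesis unfolding w_def[abs_def]
    by (auto intro!: derivative_eq_intros simp: inner_commute power2_eq_square)
qed

lemma bounded_linear_J: "bounded_linear J" using lin_J linear_conv_bounded_linear by blast

lemma phi_has_derivative: "(\<phi> has_derivative \<phi>' x) (at x)"
proof -
  have J: "((\<lambda>x. J x - N) has_derivative J) (at x)"
    using bounded_linear_imp_has_derivative[OF bounded_linear_J] by (auto intro!: derivative_eq_intros)
  have "((\<lambda>x. w x *\<^sub>R (J x - N)) has_derivative (\<lambda>h. w x *\<^sub>R J h + (- (w x)\<^sup>2 * (x \<bullet> h)) *\<^sub>R (J x - N))) (at x)"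
    by (rule has_derivative_scaleR[OF w_has_derivative J])
  from has_derivative_add[OF has_derivative_const[of N] this] show ?thesis
    unfolding \<phi>_def[abs_def] \<phi>'_def[abs_def] by (simp add: add.commute)
qed

lemma phi'_inner: "\<phi>' x h \<bullet> \<phi>' x k = (w x)\<^sup>2 * (h \<bullet> k)"
proof -
  have "\<phi>' x h \<bullet> \<phi>' x k = (w x)^3 * (x \<bullet> h) * (x \<bullet> k) * (w x * (1 + x \<bullet> x)) 
      - 2 * (w x)^3 * (x \<bullet> h) * (x \<bullet> k) + (w x)\<^sup>2 * (h \<bullet> k)"
    by (simp add: \<phi>'_def inner_simps N_N N_J J_N inner_J inner_commute power2_eq_square power3_eq_cube algebra_simps)
  thus ?thesis unfolding w_mult by simp
qed

lemma norm_phi': "norm (\<phi>' x h) = w x * norm h"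
  unfolding norm_eq_sqrt_inner phi'_inner using w_pos[of x] by (simp add: real_sqrt_mult)

lemma linear_phi': "linear (\<phi>' x)"
  using has_derivative_linear[OF phi_has_derivative] .

lemma continuous_phi: "continuous_on S \<phi>"
  using phi_has_derivative has_derivative_continuous by (intro continuous_at_imp_continuous_on) blast

lemma Ck_on_w:
  assumes "open U" shows "Ck_on m U w"
proof -
  have "Ck_on m U (\<lambda>x. 2 * inverse (1 + x \<bullet> x))"
    by (intro Ck_on_mult[OF assms] Ck_on_inverse[OF assms] Ck_on_add[OF assms] Ck_on_const
        Ck_on_bilinear[OF assms bounded_bilinear_inner] Ck_on_bounded_linear[OF assms bounded_linear_ident])
      (metis add_nonneg_eq_0_iff inner_ge_zero zero_le_one zero_neq_one)
  thus ?thesis unfolding w_def[abs_def] by (simp add: divide_inverse)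
qed

lemma Ck_on_phi:
  assumes "open U" shows "Ck_on m U \<phi>"
proof -
  have "Ck_on m U (\<lambda>x. N + w x *\<^sub>R (J x + (- N)))"
    by (intro Ck_on_add[OF assms] Ck_on_const Ck_on_scaleR[OF assms] Ck_on_w[OF assms]
        Ck_on_bounded_linear[OF assms bounded_linear_J])
  thus ?thesis by (simp add: \<phi>_def[abs_def])
qed

lemma continuous_psi: "continuous_on {q. q \<bullet> N \<noteq> 1} \<psi>"
  unfolding \<psi>_def using lin_adjoint linear_conv_bounded_linear
  by (intro continuous_intros) (auto intro: linear_continuous_on)

lemma open_psi_vimage:
  assumes "open U"
  shows "open ({q. q \<bullet> N \<noteq> 1} \<inter> \<psi> -` U)"
proof -
  have "open {q. q \<bullet> N \<noteq> 1}"
    by (intro open_Collect_neq continuous_intros)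
  thus ?thesis using continuous_open_preimage[OF continuous_psi _ assms] by blast
qed

lemma phi_image: "\<phi> ` U = Sph \<inter> ({q. q \<bullet> N \<noteq> 1} \<inter> \<psi> -` U)"
proof
  show "\<phi> ` U \<subseteq> Sph \<inter> ({q. q \<bullet> N \<noteq> 1} \<inter> \<psi> -` U)"
  proof
    fix q assume "q \<in> \<phi> ` U"
    then obtain x where "x \<in> U" "q = \<phi> x" by blast
    moreover have "\<phi> x \<bullet> N \<noteq> 1" using phi_N[of x] w_pos[of x] by linarith
    ultimately show "q \<in> Sph \<inter> ({q. q \<bullet> N \<noteq> 1} \<inter> \<psi> -` U)" using phi_in_Sph psi_phi by auto
  qed
  show "Sph \<inter> ({q. q \<bullet> N \<noteq> 1} \<inter> \<psi> -` U) \<subseteq> \<phi> ` U"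
  proof
    fix q assume q: "q \<in> Sph \<inter> ({q. q \<bullet> N \<noteq> 1} \<inter> \<psi> -` U)"
    hence "q \<noteq> N" using N_N by auto
    hence "\<phi> (\<psi> q) = q" using q phi_psi by blast
    thus "q \<in> \<phi> ` U" using q by (metis IntE image_eqI vimageE)
  qed
qed

lemma sph_param_phi:
  assumes "open U" shows "sph_param U \<phi>"
  unfolding sph_param_def
proof (intro conjI ballI)
  show "smooth_on U \<phi>" using Ck_on_phi[OF assms] by (simp add: smooth_on_def)
  show "openin (top_of_set Sph) (\<phi> ` U)"
    unfolding phi_image using open_psi_vimage[OF assms] by (rule openin_open_Int)
  have "homeomorphism U (\<phi> ` U) \<phi> \<psi>"
    unfolding homeomorphism_def
  proof (intro conjI)
    show "continuous_on (\<phi> ` U) \<psi>"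
      by (rule continuous_on_subset[OF continuous_psi]) (auto simp: phi_image)
  qed (auto simp: psi_phi continuous_phi image_image)
  thus "\<exists>\<psi>. homeomorphism U (\<phi> ` U) \<phi> \<psi>" by blast
  fix x
  show "inj (frechet_derivative \<phi> (at x))"
    unfolding frechet_derivative_at[OF phi_has_derivative, symmetric] linear_injective_0[OF linear_phi']
    by (metis less_irrefl mult_eq_0_iff norm_eq_zero norm_phi' w_pos)
qed (use assms in auto)

lemma conf_metric_phi: "conf_metric v \<phi> x = (1 / (v (\<phi> x) / w x)\<^sup>2) *\<^sub>R mat 1"
proof -
  have "pd i \<phi> x = \<phi>' x (axis i 1)" for i
    by (rule pd_eqI[OF phi_has_derivative])
  thus ?thesis
    by (simp add: vec_eq_iff conf_metric_def phi'_inner inner_axis_axis mat_def power_divide)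
qed

text \<open>The image of the straight segment is an admissible path, with speed w |y - x|.\<close>

lemma conf_dist_phi_le:
  assumes "\<And>z. z \<in> closed_segment x y \<Longrightarrow> w z \<le> c"
  shows "conf_dist Sph (\<lambda>_. 1) (\<phi> x) (\<phi> y) \<le> ennreal (c * dist x y)"
proof -
  define \<gamma> where "\<gamma> = \<phi> \<circ> linepath x y"
  have d: "(\<gamma> has_vector_derivative \<phi>' (linepath x y t) (y - x)) (at t)" for t
    unfolding \<gamma>_def
    by (rule vector_derivative_diff_chain_within[OF has_vector_derivative_linepath_within])
      (rule has_derivative_at_withinI[OF phi_has_derivative])
  have "continuous_on {0..1} (\<lambda>t. \<phi>' (linepath x y t) (y - x))"
  proof -
    have "continuous_on S w" for S
      using w_has_derivative has_derivative_continuous by (intro continuous_at_imp_continuous_on) blast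
    note c = continuous_on_compose2[OF this _ subset_UNIV, of _ "linepath x y"]
    have "continuous_on S J" for S using bounded_linear_J by (rule linear_continuous_on)
    note c' = continuous_on_compose2[OF this _ subset_UNIV, of _ "linepath x y"]
    show ?thesis unfolding \<phi>'_def
      by (intro continuous_intros c c')
  qed
  hence "\<gamma> C1_differentiable_on {0..1}" using d unfolding C1_differentiable_on_def
    by (intro exI[of _ "\<lambda>t. \<phi>' (linepath x y t) (y - x)"]) auto
  hence "valid_path \<gamma>" unfolding valid_path_def by (rule C1_differentiable_imp_piecewise)
  moreover have "path_image \<gamma> \<subseteq> Sph" unfolding path_image_def \<gamma>_def using phi_in_Sph by auto
  moreover have "pathstart \<gamma> = \<phi> x" "pathfinish \<gamma> = \<phi> y"
    by (simp_all add: \<gamma>_def pathstart_def pathfinish_def linepath_def)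
  ultimately have "conf_dist Sph (\<lambda>_. 1) (\<phi> x) (\<phi> y) \<le> conf_length (\<lambda>_. 1) \<gamma>"
    unfolding conf_dist_def by (intro INF_lower) auto
  also have "\<dots> \<le> (\<integral>\<^sup>+ t\<in>{0..1}. ennreal (c * dist x y) \<partial>(lborel::real measure))"
    unfolding conf_length_def
  proof (intro nn_integral_mono)
    fix t :: real
    show "ennreal (norm (vector_derivative \<gamma> (at t)) / 1) * indicator {0..1} t \<le> ennreal (c * dist x y) * indicator {0..1} t"
    proof (cases "t \<in> {0..1}")
      case True
      hence "linepath x y t \<in> closed_segment x y" by (metis linepath_in_path atLeastAtMost_iff)
      from assms[OF this] have "w (linepath x y t) * norm (y - x) \<le> c * norm (y - x)"
        by (intro mult_right_mono) auto
      thus ?thesis by (simp add: vector_derivative_at[OF d] norm_phi' dist_norm norm_minus_commute ennreal_leI mult_right_mono)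
    qed simp
  qed
  also have "\<dots> = ennreal (c * dist x y)" by (simp add: nn_integral_cmult_indicator)
  finally show ?thesis .
qed

lemma sph_dist_phi_upper: "sph_dist (\<phi> x) (\<phi> y) \<le> w x * dist x y * (1 + dist x y)\<^sup>2"
proof -
  have "w z \<le> (1 + dist x y)\<^sup>2 * w x" if "z \<in> closed_segment x y" for z
    by (rule w_comparison) (use that in \<open>metis dist_in_closed_segment dist_commute\<close>)
  from conf_dist_phi_le[OF this] have "conf_dist Sph (\<lambda>_. 1) (\<phi> x) (\<phi> y) \<le> ennreal ((1 + dist x y)\<^sup>2 * w x * dist x y)" .
  moreover have "(1 + dist x y)\<^sup>2 * w x * dist x y \<ge> 0" using w_pos[of x] by simp
  ultimately show ?thesis unfolding sph_dist_def
    by (metis (no_types, lifting) enn2real_leI mult.commute mult.left_commute)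
qed

text \<open>\<open>sph_dist\<close> turns an infinite value into 0, so finiteness has to be known
  before the chord can bound it from below.\<close>

lemma conf_dist_phi_finite: "conf_dist Sph (\<lambda>_. 1) (\<phi> x) (\<phi> y) < \<infinity>"
proof -
  have "conf_dist Sph (\<lambda>_. 1) (\<phi> x) (\<phi> y) \<le> ennreal (2 * dist x y)"
    by (rule conf_dist_phi_le) (rule w_le)
  thus ?thesis using order_le_less_trans by fastforce
qed

lemma dist_phi_le_sph_dist: "dist (\<phi> x) (\<phi> y) \<le> sph_dist (\<phi> x) (\<phi> y)"
  unfolding sph_dist_def
  using dist_le_conf_dist[of "\<phi> x" "\<phi> y" Sph] conf_dist_phi_finite[of x y]
  by (metis enn2real_ennreal enn2real_mono infinity_ennreal_def zero_le_dist)

text \<open>The chord formula \<open>dist_phi_sq\<close> combined with w y \<ge> w x / (1 + r)^2 for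
  r = |x - y|.\<close>

lemma sph_dist_phi_lower: "w x * dist x y / (1 + dist x y) \<le> sph_dist (\<phi> x) (\<phi> y)"
proof -
  have "w x \<le> (1 + dist x y)\<^sup>2 * w y" using w_comparison[of y x "dist x y"] by (simp add: dist_commute)
  hence "(w x * dist x y)\<^sup>2 \<le> w x * ((1 + dist x y)\<^sup>2 * w y) * (dist x y)\<^sup>2"
  proof -
    have "(w x * dist x y)\<^sup>2 = w x * w x * (dist x y)\<^sup>2" by (simp add: power2_eq_square)
    thus ?thesis using \<open>w x \<le> _\<close> w_pos[of x] by (simp add: mult_left_mono mult_right_mono)
  qed
  also have "\<dots> = ((1 + dist x y) * dist (\<phi> x) (\<phi> y))\<^sup>2"
    by (simp add: power_mult_distrib dist_phi_sq)
  finally have "w x * dist x y \<le> (1 + dist x y) * dist (\<phi> x) (\<phi> y)"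
    by (rule power2_le_imp_le) simp
  hence "w x * dist x y / (1 + dist x y) \<le> dist (\<phi> x) (\<phi> y)"
    by (simp add: divide_le_eq add_pos_nonneg mult.commute)
  thus ?thesis using dist_phi_le_sph_dist order_trans by blast
qed

end

lemma stereographic_exists:
  fixes N :: "(real^'n) \<times> real"
  assumes "norm N = 1"
  obtains J where "stereographic N J"
proof -
  have "dim (UNIV :: (real^'n) set) = dim {q. N \<bullet> q = 0}"
    using assms by (subst dim_hyperplane) auto
  then obtain f g where f: "linear f" "f ` UNIV = {q. N \<bullet> q = 0}" "\<And>x::real^'n. norm (f x) = norm x"
    using isometries_subspaces[OF subspace_UNIV subspace_hyperplane] by (metis UNIV_I)
  have "f x \<bullet> f y = x \<bullet> y" for x y
    unfolding dot_norm linear_add[OF f(1), symmetric] f(3) ..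
  hence "stereographic N f"
    unfolding stereographic_def
  proof (intro conjI allI impI)
    fix x show "f x \<bullet> N = 0" using f(2) by (metis (mono_tags) inner_commute mem_Collect_eq rangeI)
  next
    fix q assume "q \<bullet> N = 0"
    hence "q \<in> range f" using f(2) by (simp add: inner_commute)
    thus "\<exists>x. f x = q" by (metis imageE)
  qed (use assms f(1) in auto)
  thus ?thesis by (rule that)
qed

section \<open>Behaviour near the submanifold\<close>

lemma Ck_on_bounded_linear_compose:
  assumes "open U" "bounded_linear g" "Ck_on m U f"
  shows "Ck_on m U (\<lambda>x. g (f x))"
  using assms(3)
proof (induction m arbitrary: f)
  case 0
  thus ?case using bounded_linear.continuous_on[OF assms(2)] by simp
next
  case (Suc m)
  show ?case
    by (rule Ck_on_SucI[OF assms(1) bounded_linear.has_derivative[OF assms(2) Ck_on_has_derivative[OF Suc.prems]]])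
      (use Suc in auto)
qed

text \<open>Strict differentiability: a and b both move while the derivative stays frozen at x0.
  This lets one tangent space serve all nearby base points.\<close>

lemma Ck_on_1_strictly_differentiable:
  fixes F :: "'a::euclidean_space \<Rightarrow> 'b::real_normed_vector"
  assumes U: "open U" "Ck_on 1 U F" "x0 \<in> U" and e: "e > 0"
  obtains s where "s > 0" "ball x0 s \<subseteq> U"
    "\<And>a b. a \<in> ball x0 s \<Longrightarrow> b \<in> ball x0 s \<Longrightarrow>
      norm (F b - F a - frechet_derivative F (at x0) (b - a)) \<le> norm (b - a) * e"
proof -
  define F' where "F' = (\<lambda>x. frechet_derivative F (at x))"
  have dF: "(F has_derivative F' x) (at x)" if "x \<in> U" for x
    unfolding F'_def using U(2) that by (intro Ck_on_has_derivative[of 0 U]) auto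
  \<comment> \<open>\<open>Ck_on\<close> controls derivatives in fixed directions only; the sum over
    the basis turns this into a bound on the operator norm.\<close>
  define g where "g = (\<lambda>x. \<Sum>b\<in>Basis. norm (F' x b - F' x0 b))"
  have "continuous_on U g" unfolding g_def F'_def using U(2) by (intro continuous_intros) auto
  hence "isCont g x0" using U by (simp add: continuous_on_eq_continuous_at)
  hence "(g \<longlongrightarrow> g x0) (nhds x0)" unfolding isCont_def tendsto_at_iff_tendsto_nhds .
  hence "\<forall>\<^sub>F x in nhds x0. g x < e" by (rule order_tendstoD(2)) (simp add: e g_def)
  moreover have "\<forall>\<^sub>F x in nhds x0. x \<in> U" using U by (intro eventually_nhds_in_open)
  ultimately have "\<forall>\<^sub>F x in nhds x0. x \<in> U \<and> g x < e" by eventually_elim auto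
  then obtain s where s: "s > 0" "\<And>x. dist x x0 < s \<Longrightarrow> x \<in> U \<and> g x < e"
    by (auto simp: eventually_nhds_metric)
  have sub: "ball x0 s \<subseteq> U" using s(2) by (auto simp: dist_commute)
  have on: "onorm (F' x - F' x0) \<le> e" if "x \<in> ball x0 s" for x
  proof (rule onorm_le)
    fix h
    have lin: "linear (F' x)" "linear (F' x0)"
      using dF has_derivative_linear that sub U(3) by blast+
    have "(F' x - F' x0) h = (\<Sum>b\<in>Basis. (h \<bullet> b) *\<^sub>R (F' x b - F' x0 b))"
      unfolding fun_diff_def
      by (subst (1 2) euclidean_representation[of h, symmetric])
        (simp add: linear_sum[OF lin(1)] linear_sum[OF lin(2)] linear_cmul[OF lin(1)] linear_cmul[OF lin(2)]
          scaleR_diff_right sum_subtractf)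
    hence "norm ((F' x - F' x0) h) \<le> (\<Sum>b\<in>Basis. norm ((h \<bullet> b) *\<^sub>R (F' x b - F' x0 b)))"
      by (simp only: norm_sum)
    also have "\<dots> \<le> (\<Sum>b\<in>Basis. norm h * norm (F' x b - F' x0 b))"
      by (intro sum_mono) (auto intro!: mult_right_mono Basis_le_norm)
    also have "\<dots> = norm h * g x" by (simp add: g_def sum_distrib_left)
    also have "\<dots> \<le> norm h * e" using s(2)[of x] that by (intro mult_left_mono) (auto simp: dist_commute)
    finally show "norm ((F' x - F' x0) h) \<le> e * norm h" by (simp add: mult.commute)
  qed
  have "norm (F b - F a - F' x0 (b - a)) \<le> norm (b - a) * e" if "a \<in> ball x0 s" "b \<in> ball x0 s" for a b
  proof (rule differentiable_bound_linearization[where S = "ball x0 s" and f' = F'])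
    show "a + t *\<^sub>R (b - a) \<in> ball x0 s" if "t \<in> {0..1}" for t
    proof -
      have "(1 - t) *\<^sub>R a + t *\<^sub>R b \<in> ball x0 s"
        using \<open>a \<in> _\<close> \<open>b \<in> _\<close> that by (intro convexD[OF convex_ball]) auto
      thus ?thesis by (simp add: algebra_simps)
    qed
    show "(F has_derivative F' x) (at x within ball x0 s)" if "x \<in> ball x0 s" for x
      using dF sub that by (blast intro: has_derivative_at_withinI)
  qed (use on s(1) in auto)
  with s(1) sub show ?thesis using that unfolding F'_def by blast
qed

section \<open>The distance to the submanifold, read in the chart\<close>

lemma eventually_approaching:
  "eventually P (approaching M) \<longleftrightarrow> (\<exists>e>0. \<forall>q\<in>Sph - M. sph_setdist q M < e \<longrightarrow> P q)"
proof -
  have "eventually P (approaching M) \<longleftrightarrow> (\<exists>e\<in>{0<..}. eventually P (principal {x \<in> Sph - M. sph_setdist x M < e}))"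
    unfolding approaching_def
  proof (rule eventually_INF_base)
    fix a b :: real assume "a \<in> {0<..}" "b \<in> {0<..}"
    thus "\<exists>x\<in>{0<..}. principal {y \<in> Sph - M. sph_setdist y M < x}
        \<le> inf (principal {y \<in> Sph - M. sph_setdist y M < a}) (principal {y \<in> Sph - M. sph_setdist y M < b})"
      by (intro bexI[of _ "min a b"]) auto
  qed auto
  thus ?thesis unfolding eventually_principal Bex_def Ball_def mem_Collect_eq greaterThan_iff by blast
qed

context stereographic
begin

lemma isCont_phi: "isCont \<phi> x"
  using has_derivative_continuous[OF phi_has_derivative] .

lemma closed_phi_vimage: "closed M \<Longrightarrow> closed (\<phi> -` M)"
  using isCont_phi by (intro continuous_closed_vimage) auto

lemma phi_vimage_eq: "M \<subseteq> Sph \<Longrightarrow> N \<notin> M \<Longrightarrow> \<phi> -` M = \<psi> ` M"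
  by (safe; metis phi_psi psi_phi imageI subsetD vimageI vimageE)

lemma compact_phi_vimage:
  assumes "compact M" "M \<subseteq> Sph" "N \<notin> M"
  shows "compact (\<phi> -` M)"
  unfolding phi_vimage_eq[OF assms(2,3)]
  using assms Sph_inner_N by (intro compact_continuous_image continuous_on_subset[OF continuous_psi]) force+

text \<open>Nearest points for the two distances may differ. The upper bound tests the Euclidean
  nearest point; the lower bound treats every point of M, using that t / (1 + t) increases.\<close>

lemma sph_setdist_phi:
  assumes M: "compact M" "M \<subseteq> Sph" "N \<notin> M" "M \<noteq> {}"
  defines "d \<equiv> \<lambda>x. infdist x (\<phi> -` M)"
  shows "sph_setdist (\<phi> x) M \<le> w x * d x * (1 + d x)\<^sup>2" "w x * d x / (1 + d x) \<le> sph_setdist (\<phi> x) M"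
proof -
  have cl: "closed (\<phi> -` M)" using compact_imp_closed[OF M(1)] by (rule closed_phi_vimage)
  have ne: "\<phi> -` M \<noteq> {}" using M(4) phi_vimage_eq[OF M(2,3)] by simp
  have bdd: "bdd_below (sph_dist (\<phi> x) ` M)" by (intro bdd_belowI[of _ 0]) (auto simp: sph_dist_def)
  obtain m where m: "m \<in> \<phi> -` M" "d x = dist x m" unfolding d_def using infdist_attains_inf[OF cl ne] by metis
  have "sph_setdist (\<phi> x) M \<le> sph_dist (\<phi> x) (\<phi> m)"
    unfolding sph_setdist_def using m(1) by (intro cINF_lower[OF bdd]) auto
  also have "\<dots> \<le> w x * d x * (1 + d x)\<^sup>2" unfolding m(2) by (rule sph_dist_phi_upper)
  finally show "sph_setdist (\<phi> x) M \<le> w x * d x * (1 + d x)\<^sup>2" .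
  show "w x * d x / (1 + d x) \<le> sph_setdist (\<phi> x) M"
    unfolding sph_setdist_def
  proof (rule cINF_greatest[OF M(4)])
    fix q assume "q \<in> M"
    then obtain y where y: "q = \<phi> y" "y \<in> \<phi> -` M" using M phi_psi by (metis subsetD vimageI)
    have "d x \<le> dist x y" unfolding d_def using y(2) by (rule infdist_le)
    moreover have "d x \<ge> 0" by (simp add: d_def infdist_nonneg)
    ultimately have "d x / (1 + d x) \<le> dist x y / (1 + dist x y)" by (simp add: field_simps)
    hence "w x * (d x / (1 + d x)) \<le> w x * (dist x y / (1 + dist x y))"
      using w_pos[of x] by (intro mult_left_mono) auto
    also have "\<dots> \<le> sph_dist (\<phi> x) q" unfolding y(1) using sph_dist_phi_lower[of x y] by simp
    finally show "w x * d x / (1 + d x) \<le> sph_dist (\<phi> x) q" by simp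
  qed
qed

text \<open>The factor w cancels between \<open>v (\<phi> x) / w x\<close> and the spherical
  distance, and the distortion (1 + r)^2 is paid for by the second half of \<epsilon>.\<close>

lemma eventually_upper_ratio:
  assumes M: "compact M" "M \<subseteq> Sph" "N \<notin> M" "M \<noteq> {}"
    and L: "Limsup (approaching M) (\<lambda>x. ereal (v x / sph_setdist x M)) = ereal L" "L > 0" and \<epsilon>: "\<epsilon> > 0"
  shows "\<forall>\<^sub>F r in at_right 0. \<forall>x. \<phi> x \<notin> M \<longrightarrow> infdist x (\<phi> -` M) = r \<longrightarrow> v (\<phi> x) / w x \<le> (L + \<epsilon>) * r"
proof -
  have "\<forall>\<^sub>F q in approaching M. ereal (v q / sph_setdist q M) < ereal (L + \<epsilon> / 2)"
    using \<epsilon> by (intro Limsup_lessD) (simp add: L)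
  then obtain e where e: "e > 0" "\<And>q. q \<in> Sph - M \<Longrightarrow> sph_setdist q M < e \<Longrightarrow> v q / sph_setdist q M < L + \<epsilon> / 2"
    unfolding eventually_approaching by auto
  have "((\<lambda>r. (L + \<epsilon> / 2) * (1 + r)\<^sup>2) \<longlongrightarrow> L + \<epsilon> / 2) (at_right (0::real))" by (auto intro!: tendsto_eq_intros)
  hence 1: "\<forall>\<^sub>F r in at_right (0::real). (L + \<epsilon> / 2) * (1 + r)\<^sup>2 < L + \<epsilon>" by (rule order_tendstoD(2)) (use \<epsilon> in simp)
  have "((\<lambda>r. 2 * r * (1 + r)\<^sup>2) \<longlongrightarrow> 0) (at_right (0::real))" by (auto intro!: tendsto_eq_intros)
  hence 2: "\<forall>\<^sub>F r in at_right (0::real). 2 * r * (1 + r)\<^sup>2 < e" by (rule order_tendstoD(2)) (use e in simp)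
  have "\<forall>\<^sub>F r in at_right (0::real). r > 0" by (rule eventually_at_right_less)
  with 1 2 show ?thesis
  proof (eventually_elim, intro allI impI)
    fix r :: real and x
    assume r: "(L + \<epsilon> / 2) * (1 + r)\<^sup>2 < L + \<epsilon>" "2 * r * (1 + r)\<^sup>2 < e" "r > 0"
      and x: "\<phi> x \<notin> M" "infdist x (\<phi> -` M) = r"
    define s where "s = sph_setdist (\<phi> x) M"
    have s: "s \<le> w x * r * (1 + r)\<^sup>2" "w x * r / (1 + r) \<le> s"
      using sph_setdist_phi[OF M, of x] unfolding s_def x(2) by auto
    have "w x * r / (1 + r) > 0" using r w_pos[of x] by simp
    hence s0: "s > 0" using s(2) by linarith
    have "w x * (r * (1 + r)\<^sup>2) \<le> 2 * (r * (1 + r)\<^sup>2)" using r w_le[of x] by (intro mult_right_mono) auto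
    hence "s < e" using s(1) r(2) by (simp add: mult.assoc)
    hence "v (\<phi> x) / s < L + \<epsilon> / 2" using e(2)[of "\<phi> x"] x(1) phi_in_Sph unfolding s_def by blast
    hence "v (\<phi> x) < (L + \<epsilon> / 2) * s" using s0 by (simp add: divide_less_eq)
    also have "\<dots> \<le> (L + \<epsilon> / 2) * (w x * r * (1 + r)\<^sup>2)" using s(1) L \<epsilon> by (intro mult_left_mono) auto
    also have "\<dots> = ((L + \<epsilon> / 2) * (1 + r)\<^sup>2) * (w x * r)" by simp
    also have "\<dots> \<le> (L + \<epsilon>) * (w x * r)" using r w_pos[of x] by (intro mult_right_mono) auto
    finally show "v (\<phi> x) / w x \<le> (L + \<epsilon>) * r" using w_pos[of x] by (simp add: divide_le_eq mult_ac)
  qed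
qed

text \<open>If the ratio stayed below L - \<epsilon> at all small Euclidean distances, the limsup
  would be below L. The obstacle is the pole: w tends to 0 there, so spherical closeness to M
  controls the Euclidean distance only away from N.\<close>

lemma frequently_lower_ratio:
  assumes M: "compact M" "M \<subseteq> Sph" "N \<notin> M" "M \<noteq> {}" and v: "\<And>q. q \<in> Sph - M \<Longrightarrow> v q > 0"
    and L: "Limsup (approaching M) (\<lambda>x. ereal (v x / sph_setdist x M)) = ereal L" and \<epsilon>: "\<epsilon> > 0" "\<epsilon> < L"
  shows "\<exists>\<^sub>F r in at_right 0. \<exists>x. \<phi> x \<notin> M \<and> infdist x (\<phi> -` M) = r \<and> v (\<phi> x) / w x \<ge> (L - \<epsilon>) * r"
proof (rule ccontr)
  assume "\<not> ?thesis"
  hence "\<forall>\<^sub>F r in at_right 0. \<forall>x. \<phi> x \<notin> M \<longrightarrow> infdist x (\<phi> -` M) = r \<longrightarrow> v (\<phi> x) / w x < (L - \<epsilon>) * r"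
    unfolding not_frequently by (rule eventually_mono) (auto simp: not_le)
  moreover have "((\<lambda>r. (L - \<epsilon>) * (1 + r)) \<longlongrightarrow> L - \<epsilon>) (at_right (0::real))" by (auto intro!: tendsto_eq_intros)
  hence "\<forall>\<^sub>F r in at_right (0::real). (L - \<epsilon>) * (1 + r) < L - \<epsilon> / 2" by (rule order_tendstoD(2)) (use \<epsilon> in simp)
  ultimately have "\<forall>\<^sub>F r in at_right 0. (\<forall>x. \<phi> x \<notin> M \<longrightarrow> infdist x (\<phi> -` M) = r \<longrightarrow> v (\<phi> x) / w x < (L - \<epsilon>) * r)
      \<and> (L - \<epsilon>) * (1 + r) < L - \<epsilon> / 2" by (rule eventually_conj)
  then obtain b where b: "b > 0"
    "\<And>r x. 0 < r \<Longrightarrow> r < b \<Longrightarrow> \<phi> x \<notin> M \<Longrightarrow> infdist x (\<phi> -` M) = r \<Longrightarrow> v (\<phi> x) / w x < (L - \<epsilon>) * r"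
    "\<And>r. 0 < r \<Longrightarrow> r < b \<Longrightarrow> (L - \<epsilon>) * (1 + r) < L - \<epsilon> / 2"
    unfolding eventually_at_right_field by auto
  have ne: "\<phi> -` M \<noteq> {}" using M(4) phi_vimage_eq[OF M(2,3)] by simp
  have cl: "closed (\<phi> -` M)" using compact_imp_closed[OF M(1)] by (rule closed_phi_vimage)
  \<comment> \<open>Points with chord less than c/2 to M have chord at least c/2 to N. The square of
    the latter is 2 w, hence w \<ge> c^2/8, and the second entry of e then forces the Euclidean
    distance below b.\<close>
  define c where "c = infdist N M"
  have c: "c > 0" unfolding c_def using infdist_pos_not_in_closed[OF compact_imp_closed[OF M(1)] M(4,3)] .
  define sN where "sN = sph_setdist N M"
  \<comment> \<open>\<open>sN\<close> could be the junk value \<open>0\<close>, as nothing above says that \<open>N\<close> has finite distance to \<open>M\<close>.\<close>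
  define e where "e = min (c / 2) (min (c\<^sup>2 / 8 * (b / (1 + b))) (if sN > 0 then sN else 1))"
  have e: "e > 0" unfolding e_def using c b(1) by auto
  have e': "e \<le> c / 2" "e \<le> c\<^sup>2 / 8 * (b / (1 + b))" "sN > 0 \<Longrightarrow> e \<le> sN"
    unfolding e_def by (simp_all only: min.cobounded1 min.coboundedI2 if_True min.cobounded2)
  have bound: "v q / sph_setdist q M \<le> L - \<epsilon> / 2" if q: "q \<in> Sph - M" "sph_setdist q M < e" for q
  proof (cases "q = N")
    case True
    have "sN \<le> 0" using q(2) e'(3) unfolding True sN_def[symmetric] by linarith
    hence "v q / sph_setdist q M \<le> 0" using v[OF q(1)] unfolding True sN_def[symmetric]
      by (simp add: divide_nonneg_nonpos)
    thus ?thesis using \<epsilon> by simp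
  next
    case False
    define x where "x = \<psi> q"
    have x: "q = \<phi> x" using phi_psi q(1) False by (simp add: x_def)
    define d where "d = infdist x (\<phi> -` M)"
    have d: "d > 0" unfolding d_def
      by (rule infdist_pos_not_in_closed[OF cl ne]) (use q(1) x in auto)
    have low: "w x * d / (1 + d) \<le> sph_setdist q M" unfolding x d_def by (rule sph_setdist_phi(2)[OF M])
    have "\<exists>m\<in>M. sph_dist q m < e"
      using q(2) unfolding sph_setdist_def by (subst (asm) cINF_less_iff[OF M(4)])
        (auto intro!: bdd_belowI[of _ 0] simp: sph_dist_def)
    then obtain m where m: "m \<in> M" "sph_dist q m < e" by blast
    obtain y where y: "m = \<phi> y" using m(1) M phi_psi by (metis subsetD)
    have "dist q m < e" using dist_phi_le_sph_dist[of x y] m(2) unfolding x y by linarith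
    moreover have "c \<le> dist N m" unfolding c_def using m(1) by (rule infdist_le)
    moreover have "dist N m \<le> dist N q + dist q m" by (rule dist_triangle)
    ultimately have "dist N q \<ge> c / 2" using e'(1) by linarith
    hence "(dist N q)\<^sup>2 \<ge> (c / 2)\<^sup>2" using c by (intro power_mono) auto
    moreover have "(dist N q)\<^sup>2 = 2 * w x"
      unfolding x phi_N[symmetric] dist_norm power2_norm_eq_inner
      by (simp add: inner_diff_left inner_diff_right phi_inner_self N_N inner_commute)
    ultimately have wx: "w x \<ge> c\<^sup>2 / 8" by (simp add: power_divide)
    have "c\<^sup>2 / 8 * (d / (1 + d)) \<le> w x * (d / (1 + d))" using wx d by (intro mult_right_mono) auto
    also have "\<dots> < e" using low q(2) by simp
    also have "\<dots> \<le> c\<^sup>2 / 8 * (b / (1 + b))" by (rule e'(2))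
    finally have "d / (1 + d) < b / (1 + b)" using c by (subst (asm) mult_less_cancel_left_pos) auto
    hence db: "d < b" using d b(1) by (simp add: field_simps)
    have u: "v q / w x < (L - \<epsilon>) * d" using b(2)[OF d db _ d_def[symmetric]] q(1) unfolding x by blast
    have "v q / sph_setdist q M \<le> v q / (w x * d / (1 + d))"
    proof (rule divide_left_mono[OF low])
      have "w x * d / (1 + d) > 0" using d w_pos[of x] by simp
      thus "0 < sph_setdist q M * (w x * d / (1 + d))" using low by (intro mult_pos_pos) linarith+
    qed (use v[OF q(1)] in simp)
    also have "\<dots> = (v q / w x) * (1 + d) / d" using d w_pos[of x] by (simp add: field_simps)
    also have "\<dots> \<le> ((L - \<epsilon>) * d) * (1 + d) / d" using u d by (intro divide_right_mono mult_right_mono) auto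
    also have "\<dots> = (L - \<epsilon>) * (1 + d)" using d by simp
    also have "\<dots> \<le> L - \<epsilon> / 2" using b(3)[OF d db] by simp
    finally show ?thesis .
  qed
  have "Limsup (approaching M) (\<lambda>x. ereal (v x / sph_setdist x M)) \<le> ereal (L - \<epsilon> / 2)"
    by (rule Limsup_bounded) (use e bound in \<open>auto simp: eventually_approaching\<close>)
  thus False unfolding L using \<epsilon> by simp
qed

section \<open>Approximation by tangent planes\<close>

text \<open>T is the image of the slice under the derivative of the slice chart read in
  stereographic coordinates. The statement is the one-sided closeness that bounds distances to M
  from above: M passes near every m + t, with the same T for all base points m near q.\<close>

lemma tangent_space_approximation:
  assumes M: "closed_submanifold p M" "N \<notin> M" and q: "\<phi> q \<in> M"
  obtains T where "subspace T" "dim T = p"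
    "\<And>\<eta>. \<eta> > 0 \<Longrightarrow> \<exists>r>0. \<forall>m. \<phi> m \<in> M \<longrightarrow> dist m q < r \<longrightarrow>
      (\<forall>t\<in>T. norm t < r \<longrightarrow> (\<exists>m'. \<phi> m' \<in> M \<and> norm (m' - m - t) \<le> \<eta> * norm t))"
proof -
  have MS: "M \<subseteq> Sph" using M(1) by (simp add: closed_submanifold_def)
  obtain U f S where f: "sph_param U f" "\<phi> q \<in> f ` U" and S: "subspace S" "dim S = p" "M \<inter> f ` U = f ` (U \<inter> S)"
    using M(1) q unfolding closed_submanifold_def by blast
  have U: "open U" and Cf: "\<And>m. Ck_on m U f" and openf: "openin (top_of_set Sph) (f ` U)"
    and injf: "\<And>x. x \<in> U \<Longrightarrow> inj (frechet_derivative f (at x))"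
    using f(1) by (auto simp: sph_param_def smooth_on_def)
  obtain k where k: "homeomorphism U (f ` U) f k" using f(1) by (auto simp: sph_param_def)
  have fS: "f ` U \<subseteq> Sph" using openin_imp_subset[OF openf] by simp
  obtain a0 where a0: "a0 \<in> U" "f a0 = \<phi> q" using f(2) by auto
  define V where "V = U \<inter> f -` {z. z \<bullet> N \<noteq> 1}"
  have V: "open V" unfolding V_def
    by (intro continuous_open_preimage Ck_on_continuous[OF Cf] U open_Collect_neq continuous_intros)
  have VU: "V \<subseteq> U" by (auto simp: V_def)
  have "\<phi> q \<bullet> N \<noteq> 1" using phi_N[of q] w_pos[of q] by linarith
  hence a0V: "a0 \<in> V" using a0 by (simp add: V_def)
  define F where "F = (\<lambda>a. \<psi> (f a))"
  have phiF: "\<phi> (F a) = f a" if "a \<in> V" for a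
    unfolding F_def by (rule phi_psi) (use that fS N_N in \<open>auto simp: V_def\<close>)
  have CV: "Ck_on 1 V f" using Ck_on_subset[OF Cf VU] .
  have "bounded_linear (adjoint J)" using lin_adjoint linear_conv_bounded_linear by blast
  hence "Ck_on 1 V (\<lambda>a. inverse (1 + - (f a \<bullet> N)) *\<^sub>R adjoint J (f a))"
    by (intro Ck_on_scaleR[OF V] Ck_on_inverse[OF V] Ck_on_add[OF V] Ck_on_const
        Ck_on_bounded_linear_compose[OF V _ CV] bounded_linear_minus bounded_linear_inner_left) (auto simp: V_def)
  hence CF: "Ck_on 1 V F" by (simp add: F_def \<psi>_def[abs_def] divide_inverse)
  define F' where "F' = frechet_derivative F (at a0)"
  have dF: "(F has_derivative F') (at a0)"
    unfolding F'_def using CF a0V by (intro Ck_on_has_derivative[of 0 V]) auto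
  have linF: "linear F'" using dF has_derivative_linear by blast
  have "((\<lambda>a. \<phi> (F a)) has_derivative (\<lambda>h. \<phi>' (F a0) (F' h))) (at a0)"
    by (rule has_derivative_compose[OF dF phi_has_derivative])
  hence "(f has_derivative (\<lambda>h. \<phi>' (F a0) (F' h))) (at a0)"
    by (rule has_derivative_transform_within_open[OF _ V a0V phiF])
  hence "frechet_derivative f (at a0) = (\<lambda>h. \<phi>' (F a0) (F' h))" using frechet_derivative_at by metis
  hence injF: "inj F'" using injf[OF a0(1)] unfolding inj_def by metis
  obtain B where B: "B > 0" "\<And>x. B * norm x \<le> norm (F' x)"
    using linear_inj_bounded_below_pos[OF linF injF] by metis
  define T where "T = F' ` S"
  have T: "subspace T" "dim T = p"
    unfolding T_def using linear_subspace_image[OF linF S(1)] dim_image_eq[OF linF, of S] injF S(2)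
    by (auto simp: inj_on_subset)
  have approx: "\<exists>r>0. \<forall>m. \<phi> m \<in> M \<longrightarrow> dist m q < r \<longrightarrow>
      (\<forall>t\<in>T. norm t < r \<longrightarrow> (\<exists>m'. \<phi> m' \<in> M \<and> norm (m' - m - t) \<le> \<eta> * norm t))" if \<eta>: "\<eta> > 0" for \<eta>
  proof -
    \<comment> \<open>The tolerance \<eta> B turns an error relative to |l| into one relative to
      |t|, where t = F' l has |t| \<ge> B |l|.\<close>
    obtain s where s: "s > 0" "ball a0 s \<subseteq> V"
      "\<And>a b. a \<in> ball a0 s \<Longrightarrow> b \<in> ball a0 s \<Longrightarrow> norm (F b - F a - F' (b - a)) \<le> norm (b - a) * (\<eta> * B)"
      using Ck_on_1_strictly_differentiable[OF V CF a0V mult_pos_pos[OF \<eta> B(1)]] unfolding F'_def by blast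
    obtain O' where O': "open O'" "f ` U = Sph \<inter> O'" using openf by (auto simp: openin_open)
    define W where "W = \<phi> -` O'"
    have W: "open W" unfolding W_def by (rule continuous_open_vimage[OF O'(1) isCont_phi])
    have WU: "\<phi> m \<in> f ` U \<longleftrightarrow> m \<in> W" for m using O'(2) phi_in_Sph unfolding W_def by blast
    have "continuous_on W (\<lambda>m. k (\<phi> m))"
    proof (rule continuous_on_compose2[OF _ continuous_phi])
      show "continuous_on (f ` U) k" using k by (rule homeomorphism_cont2)
      show "\<phi> ` W \<subseteq> f ` U" using WU by blast
    qed
    moreover have qW: "q \<in> W" using WU f(2) by blast
    ultimately have "isCont (\<lambda>m. k (\<phi> m)) q" using W by (simp add: continuous_on_eq_continuous_at)
    moreover have kq: "k (\<phi> q) = a0" using k a0 unfolding homeomorphism_def by metis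
    ultimately have "((\<lambda>m. k (\<phi> m)) \<longlongrightarrow> a0) (nhds q)"
      unfolding isCont_def tendsto_at_iff_tendsto_nhds[of "\<lambda>m. k (\<phi> m)" q] by (simp only:)
    hence "\<forall>\<^sub>F m in nhds q. dist (k (\<phi> m)) a0 < s / 2" using s(1) by (intro tendstoD) auto
    moreover have "\<forall>\<^sub>F m in nhds q. m \<in> W" using W qW by (intro eventually_nhds_in_open)
    ultimately have "\<forall>\<^sub>F m in nhds q. m \<in> W \<and> dist (k (\<phi> m)) a0 < s / 2" by eventually_elim auto
    then obtain r where r: "r > 0" "\<And>m. dist m q < r \<Longrightarrow> m \<in> W \<and> dist (k (\<phi> m)) a0 < s / 2"
      by (auto simp: eventually_nhds_metric)
    \<comment> \<open>The first entry puts the parameter of m within s/2 of a0, the second makes the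
      step l shorter than s/2.\<close>
    define r' where "r' = min r (B * s / 2)"
    have r': "r' > 0" using r s B by (simp add: r'_def)
    have "\<exists>m'. \<phi> m' \<in> M \<and> norm (m' - m - t) \<le> \<eta> * norm t"
      if m: "\<phi> m \<in> M" "dist m q < r'" and t: "t \<in> T" "norm t < r'" for m t
    proof -
      define a where "a = k (\<phi> m)"
      have mW: "m \<in> W" "dist a a0 < s / 2" using r(2)[of m] m(2) by (auto simp: r'_def a_def)
      have "\<phi> m \<in> M \<inter> f ` U" using m(1) mW(1) WU by blast
      then obtain a' where a': "a' \<in> U" "a' \<in> S" "\<phi> m = f a'" unfolding S(3) by blast
      have "a = a'" unfolding a_def a'(3) using k a'(1) unfolding homeomorphism_def by blast
      hence a: "a \<in> S" "f a = \<phi> m" using a' by auto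
      obtain l where l: "l \<in> S" "t = F' l" using t(1) by (auto simp: T_def)
      have nl: "B * norm l \<le> norm t" using B(2)[of l] l by simp
      hence "B * norm l < B * (s / 2)" using t(2) by (simp add: r'_def)
      hence ls: "norm l < s / 2" using B(1) by simp
      define b where "b = a + l"
      have bS: "b \<in> S" unfolding b_def using a(1) l(1) S(1) by (rule subspace_add[rotated])
      have ain: "a \<in> ball a0 s" using mW(2) s(1) by (simp add: dist_commute)
      have "dist a0 b \<le> dist a0 a + dist a b" by (rule dist_triangle)
      also have "\<dots> = dist a a0 + norm l" by (simp add: b_def dist_commute) (simp add: dist_norm)
      also have "\<dots> < s" using mW(2) ls by simp
      finally have bin: "b \<in> ball a0 s" by simp
      have bV: "b \<in> V" using bin s(2) by blast
      have "f b \<in> M" using S(3) bS bV VU by blast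
      hence 1: "\<phi> (F b) \<in> M" using phiF[OF bV] by simp
      have Fa: "F a = m" by (simp add: F_def a(2) psi_phi)
      have "norm (F b - m - t) \<le> norm l * (\<eta> * B)"
        using s(3)[OF ain bin] by (simp add: Fa b_def l(2))
      also have "\<dots> = \<eta> * (B * norm l)" by simp
      also have "\<dots> \<le> \<eta> * norm t" using nl \<eta> by (intro mult_left_mono) auto
      finally show ?thesis using 1 by blast
    qed
    thus ?thesis using r' by blast
  qed
  show ?thesis by (rule that[OF T approx])
qed

end

section \<open>The asymptotic eigenvalue bounds\<close>

lemma orthogonal_projection_exists:
  fixes T :: "'a::euclidean_space set"
  assumes T: "subspace T"
  obtains pr where "orthogonal_projection pr" "\<And>x. x - pr x \<in> T" "\<And>t. t \<in> T \<Longrightarrow> pr t = 0"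
proof -
  obtain B where B: "B \<subseteq> T" "pairwise orthogonal B" "\<And>x. x \<in> B \<Longrightarrow> norm x = 1" "independent B" "span B = T"
    using orthonormal_basis_subspace[OF T] by metis
  have fin: "finite B" using B(4) independent_imp_finite by blast
  define pr where "pr = (\<lambda>x. x - (\<Sum>b\<in>B. (x \<bullet> b) *\<^sub>R b))"
  have lin: "linear pr" unfolding pr_def
    by (intro linearI) (simp_all add: inner_add_left scaleR_add_left sum.distrib scaleR_sum_right scaleR_diff_right)
  have sa: "pr x \<bullet> y = x \<bullet> pr y" for x y
    by (simp add: pr_def inner_diff_left inner_diff_right inner_sum_left inner_sum_right inner_commute mult.commute)
  have T0: "pr t = 0" if "t \<in> T" for t
    using orthonormal_basis_expand[OF B(2,3) _ fin, of t] that B(5) by (simp add: pr_def)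
  have mem: "x - pr x \<in> T" for x
    using B(1) T by (auto simp: pr_def intro!: subspace_sum subspace_scale)
  have idem: "pr (pr x) = pr x" for x
    using T0[OF mem[of x]] lin by (simp add: linear_diff)
  show ?thesis by (rule that[of pr]) (use lin sa idem T0 mem in \<open>auto simp: orthogonal_projection_def\<close>)
qed

lemma frechet_derivative_eq_sum_pd:
  fixes u :: "real^'n \<Rightarrow> 'b::real_normed_vector"
  assumes "u differentiable (at z)"
  shows "frechet_derivative u (at z) a = (\<Sum>j\<in>UNIV. (a $ j) *\<^sub>R pd j u z)"
proof -
  have lin: "linear (frechet_derivative u (at z))" using linear_frechet_derivative[OF assms] .
  have "frechet_derivative u (at z) a = frechet_derivative u (at z) (\<Sum>j\<in>UNIV. (a $ j) *\<^sub>R axis j 1)"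
    using basis_expansion[of a] by (simp add: scalar_mult_eq_scaleR)
  thus ?thesis by (simp add: linear_sum[OF lin] linear_cmul[OF lin] pd_def)
qed

lemma second_derivative_eq_sum_pd:
  fixes u :: "real^'n \<Rightarrow> real"
  assumes U: "open U" "Ck_on 2 U u" "y \<in> U"
  shows "frechet_derivative (\<lambda>z. frechet_derivative u (at z) a) (at y) b
    = (\<Sum>i\<in>UNIV. \<Sum>j\<in>UNIV. b $ i * a $ j * pd i (pd j u) y)"
proof -
  have C1: "Ck_on 1 U u" using U(2) Ck_on_le[of 1 2] by simp
  have dpu: "(pd j u has_derivative frechet_derivative (pd j u) (at y)) (at y)" for j
    using U(2,3) unfolding pd_def by (intro Ck_on_has_derivative[of 0 U]) (auto simp: numeral_2_eq_2)
  have "frechet_derivative (\<lambda>z. frechet_derivative u (at z) a) (at y)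
      = frechet_derivative (\<lambda>z. \<Sum>j\<in>UNIV. (a $ j) *\<^sub>R pd j u z) (at y)"
    by (rule frechet_derivative_cong_open[OF U(1,3)], rule frechet_derivative_eq_sum_pd) (use C1 in auto)
  also have "\<dots> = (\<lambda>h. \<Sum>j\<in>UNIV. (a $ j) *\<^sub>R frechet_derivative (pd j u) (at y) h)"
    by (rule frechet_derivative_at[symmetric]) (intro has_derivative_sum has_derivative_scaleR_right dpu)
  finally have "frechet_derivative (\<lambda>z. frechet_derivative u (at z) a) (at y) b
      = (\<Sum>j\<in>UNIV. a $ j * frechet_derivative (pd j u) (at y) b)" by simp
  also have "\<dots> = (\<Sum>j\<in>UNIV. a $ j * (\<Sum>i\<in>UNIV. b $ i * pd i (pd j u) y))"
    using dpu by (subst frechet_derivative_eq_sum_pd) (auto simp: differentiable_def)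
  also have "\<dots> = (\<Sum>j\<in>UNIV. \<Sum>i\<in>UNIV. b $ i * a $ j * pd i (pd j u) y)"
    by (simp add: sum_distrib_left mult_ac)
  also have "\<dots> = (\<Sum>i\<in>UNIV. \<Sum>j\<in>UNIV. b $ i * a $ j * pd i (pd j u) y)" by (rule sum.swap)
  finally show ?thesis .
qed

text \<open>The order of \<open>lam\<close> is unknown; d relists the eigenvalues along an
  eigenbasis, where the quadratic form can be tested, and has the same \<sigma>_j.\<close>

lemma eigenvalue_bounds_of_quadratic_form:
  fixes A :: "real^'n^'n"
  assumes sym: "transpose A = A" and lam: "eigenvalue_vector A lam"
    and up: "\<And>\<xi>. \<xi> \<bullet> (A *v \<xi>) \<le> \<alpha> * (\<xi> \<bullet> \<xi>)"
    and E: "subspace E" "dim E = q" and le: "\<And>\<xi>. \<xi> \<in> E \<Longrightarrow> \<xi> \<bullet> (A *v \<xi>) \<le> \<beta> * (\<xi> \<bullet> \<xi>)"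
  obtains d :: "'n \<Rightarrow> real" and J where "\<And>j. esym_on d UNIV j = esym j lam" "card J = q" 
    "\<And>i. d i \<le> \<alpha>" "\<And>i. i \<in> J \<Longrightarrow> d i \<le> \<beta>"
proof -
  obtain b :: "'n \<Rightarrow> real^'n" and d :: "'n \<Rightarrow> real"
    where b: "\<And>i j. b i \<bullet> b j = (if i = j then 1 else 0)" "\<And>i. A *v b i = d i *\<^sub>R b i"
    by (rule symmetric_matrix_eigenbasis[OF sym]) (rule that; assumption)
  have "eigenvalue_vector A (\<chi> i. d i)" by (rule eigenvalue_vector_of_eigenbasis[OF b])
  from eigenvalue_vector_prod_unique[OF this lam]
  have e: "esym_on d UNIV j = esym j lam" for j
    unfolding esym_eq_esym_on esym_on_def by simp
  obtain J where J: "card J = q" "\<And>i. i \<in> J \<Longrightarrow> d i \<le> \<beta>"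
    using eigenvalues_le_of_quadratic_form_le[OF b E le] by metis
  have "d i \<le> \<alpha>" for i using up[of "b i"] by (simp add: b)
  with e J show ?thesis using that by blast
qed

context stereographic
begin

section \<open>Contact points near the submanifold\<close>

text \<open>The preimage of M is compact, so nearest points converge along a subsequence and the
  tangent space at the single limit q can be used.\<close>

lemma almost_maximal_sequence:
  assumes M: "compact M" "M \<subseteq> Sph" "N \<notin> M" "M \<noteq> {}" and v: "\<And>q. q \<in> Sph - M \<Longrightarrow> v q > 0"
    and L: "Limsup (approaching M) (\<lambda>x. ereal (v x / sph_setdist x M)) = ereal L" "L > 0"
  obtains x m :: "nat \<Rightarrow> real^'n" and q where
    "\<And>n. \<phi> (x n) \<notin> M" "\<And>n. \<phi> (m n) \<in> M" "\<phi> q \<in> M" "m \<longlonglongrightarrow> q"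
    "\<And>n. infdist (x n) (\<phi> -` M) = dist (x n) (m n)" "(\<lambda>n. dist (x n) (m n)) \<longlonglongrightarrow> 0"
    "\<And>\<epsilon>. \<epsilon> > 0 \<Longrightarrow> \<forall>\<^sub>F n in sequentially. v (\<phi> (x n)) / w (x n) \<ge> (L - \<epsilon>) * dist (x n) (m n)"
proof -
  have cl: "closed (\<phi> -` M)" using compact_imp_closed[OF M(1)] by (rule closed_phi_vimage)
  have ne: "\<phi> -` M \<noteq> {}" using M(4) phi_vimage_eq[OF M(2,3)] by simp
  \<comment> \<open>A null sequence inside (0, L), the range that
    \<open>frequently_lower_ratio\<close> accepts.\<close>
  define \<epsilon> where "\<epsilon> = (\<lambda>n. L / real (n + 2))"
  have \<epsilon>: "0 < \<epsilon> n" "\<epsilon> n < L" for n using L(2) by (auto simp: \<epsilon>_def divide_less_eq add_pos_nonneg)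
  have "\<exists>x. \<phi> x \<notin> M \<and> infdist x (\<phi> -` M) < 1 / real (Suc n) \<and> v (\<phi> x) / w x \<ge> (L - \<epsilon> n) * infdist x (\<phi> -` M)" for n
  proof -
    have "\<exists>\<^sub>F r in at_right 0. \<exists>x. \<phi> x \<notin> M \<and> infdist x (\<phi> -` M) = r \<and> v (\<phi> x) / w x \<ge> (L - \<epsilon> n) * r"
      by (rule frequently_lower_ratio[OF M _ L(1) \<epsilon>]) (rule v)
    moreover have "\<forall>\<^sub>F r in at_right (0::real). P r \<longrightarrow> r < 1 / real (Suc n) \<and> P r" for P
      by (rule eventually_at_rightI[of 0 "1 / real (Suc n)"]) auto
    ultimately have "\<exists>\<^sub>F r in at_right (0::real). r < 1 / real (Suc n) \<and>
      (\<exists>x. \<phi> x \<notin> M \<and> infdist x (\<phi> -` M) = r \<and> v (\<phi> x) / w x \<ge> (L - \<epsilon> n) * r)"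
      by (rule frequently_rev_mp)
    from frequently_ex[OF this] show ?thesis by blast
  qed
  then obtain x where x: "\<And>n. \<phi> (x n) \<notin> M" "\<And>n. infdist (x n) (\<phi> -` M) < 1 / real (Suc n)"
    "\<And>n. v (\<phi> (x n)) / w (x n) \<ge> (L - \<epsilon> n) * infdist (x n) (\<phi> -` M)" by metis
  have "\<exists>m. m \<in> \<phi> -` M \<and> infdist (x n) (\<phi> -` M) = dist (x n) m" for n
    using infdist_attains_inf[OF cl ne] by metis
  then obtain m where m: "\<And>n. m n \<in> \<phi> -` M" "\<And>n. infdist (x n) (\<phi> -` M) = dist (x n) (m n)" by metis
  obtain q r where q: "q \<in> \<phi> -` M" "strict_mono r" "(m \<circ> r) \<longlonglongrightarrow> q"
    using compact_phi_vimage[OF M(1-3)] m(1) unfolding compact_def by metis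
  have d0: "(\<lambda>n. dist (x n) (m n)) \<longlonglongrightarrow> 0"
    by (rule tendsto_sandwich[OF _ _ tendsto_const LIMSEQ_inverse_real_of_nat])
      (use x(2) m(2) in \<open>auto intro!: always_eventually less_imp_le simp: inverse_eq_divide\<close>)
  have low: "\<forall>\<^sub>F n in sequentially. v (\<phi> (x n)) / w (x n) \<ge> (L - e) * dist (x n) (m n)" if "e > 0" for e
  proof -
    have "(\<lambda>n. L / real (n + 2)) \<longlonglongrightarrow> 0"
      by (intro tendsto_divide_0[OF tendsto_const] filterlim_at_top_imp_at_infinity filterlim_compose[OF filterlim_real_sequentially] filterlim_add_const_nat_at_top)
    hence "\<forall>\<^sub>F n in sequentially. \<epsilon> n < e" unfolding \<epsilon>_def by (rule order_tendstoD(2)[OF _ that])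
    thus ?thesis
    proof eventually_elim
      case (elim n)
      have "(L - e) * dist (x n) (m n) \<le> (L - \<epsilon> n) * dist (x n) (m n)" using elim by (intro mult_right_mono) auto
      thus ?case using x(3)[of n] unfolding m(2) by linarith
    qed
  qed
  show ?thesis
  proof (rule that[of "x \<circ> r" "m \<circ> r" q])
    show "(\<lambda>n. dist ((x \<circ> r) n) ((m \<circ> r) n)) \<longlonglongrightarrow> 0"
      using LIMSEQ_subseq_LIMSEQ[OF d0 q(2)] by (simp add: o_def)
    show "\<forall>\<^sub>F n in sequentially. v (\<phi> ((x \<circ> r) n)) / w ((x \<circ> r) n) \<ge> (L - e) * dist ((x \<circ> r) n) ((m \<circ> r) n)" if "e > 0" for e
      using eventually_subseq[OF q(2) low[OF that]] by simp
  qed (use x m q in auto)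
qed

lemma asymptotic_quadratic_form:
  assumes M: "closed_submanifold p M" "N \<notin> M" "M \<noteq> {}" and v: "\<And>q. q \<in> Sph - M \<Longrightarrow> v q > 0"
    and L: "Limsup (approaching M) (\<lambda>x. ereal (v x / sph_setdist x M)) = ereal L" "L > 0"
    and Cu: "Ck_on 2 {x. \<phi> x \<notin> M} (\<lambda>x. v (\<phi> x) / w x)" and \<tau>: "\<tau> > 0"
  defines "Q \<equiv> \<lambda>g y a. v (\<phi> y) / w y * frechet_derivative (\<lambda>z. frechet_derivative (\<lambda>x. v (\<phi> x) / w x) (at z) a) (at y) a
      - (norm g)\<^sup>2 / 2 * (a \<bullet> a)"
  obtains y g E where "\<phi> y \<notin> M" "subspace E" "dim E = p + 1"
    "\<And>h. frechet_derivative (\<lambda>x. v (\<phi> x) / w x) (at y) h = g \<bullet> h"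
    "\<And>a. Q g y a \<le> (L\<^sup>2 / 2 + \<tau>) * (a \<bullet> a)" "\<And>a. a \<in> E \<Longrightarrow> Q g y a \<le> (- L\<^sup>2 / 2 + \<tau>) * (a \<bullet> a)"
proof -
  have MS: "compact M" "M \<subseteq> Sph" using M(1) by (auto simp: closed_submanifold_def)
  define M' where "M' = \<phi> -` M"
  define u where "u = (\<lambda>x. v (\<phi> x) / w x)"
  define U where "U = {x. \<phi> x \<notin> M}"
  have UM: "U = - M'" by (auto simp: U_def M'_def)
  have cl: "closed M'" unfolding M'_def using compact_imp_closed[OF MS(1)] by (rule closed_phi_vimage)
  have U: "open U" unfolding UM using cl by (rule open_Compl)
  have ne: "M' \<noteq> {}" unfolding M'_def using M(3) phi_vimage_eq[OF MS(2) M(2)] by simp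
  have upos: "\<forall>x\<in>U. u x > 0" using v phi_in_Sph w_pos by (auto simp: u_def U_def intro!: divide_pos_pos)
  obtain x m q where xm: "\<And>n. \<phi> (x n) \<notin> M" "\<And>n. \<phi> (m n) \<in> M" "\<phi> q \<in> M" "m \<longlonglongrightarrow> q"
    "\<And>n. infdist (x n) (\<phi> -` M) = dist (x n) (m n)" "(\<lambda>n. dist (x n) (m n)) \<longlonglongrightarrow> 0"
    "\<And>\<epsilon>. \<epsilon> > 0 \<Longrightarrow> \<forall>\<^sub>F n in sequentially. v (\<phi> (x n)) / w (x n) \<ge> (L - \<epsilon>) * dist (x n) (m n)"
    using almost_maximal_sequence[OF MS M(2,3) v L] by blast
  obtain T where T: "subspace T" "dim T = p"
    "\<And>\<eta>. \<eta> > 0 \<Longrightarrow> \<exists>r>0. \<forall>m. \<phi> m \<in> M \<longrightarrow> dist m q < r \<longrightarrow>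
      (\<forall>t\<in>T. norm t < r \<longrightarrow> (\<exists>m'. \<phi> m' \<in> M \<and> norm (m' - m - t) \<le> \<eta> * norm t))"
    using tangent_space_approximation[OF M(1,2) xm(3)] by blast
  obtain pr where pr: "orthogonal_projection pr" "\<And>x. x - pr x \<in> T" "\<And>t. t \<in> T \<Longrightarrow> pr t = 0"
    using orthogonal_projection_exists[OF T(1)] by blast
  interpret pr: orthogonal_projection pr by fact
  have "\<forall>\<^sub>F \<eta> in at_right (0::real). \<eta> > 0" by (rule eventually_at_right_less)
  \<comment> \<open>The tolerance \<eta> is fixed here; b, r and finally n are chosen in terms of
    it.\<close>
  from eventually_happens[OF eventually_conj[OF this pr.touching_quadratic_form[OF L(2) \<tau>]]]
  obtain \<eta> where \<eta>: "\<eta> > 0" and touch: "\<And>U u x0 m d. open U \<Longrightarrow> Ck_on 2 U u \<Longrightarrow> cball x0 (d/2) \<subseteq> U \<Longrightarrow>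
    (\<forall>x\<in>U. u x > 0) \<Longrightarrow> d > 0 \<Longrightarrow> norm (pr (x0 - m)) \<le> d \<Longrightarrow> u x0 \<ge> (L - \<eta>) * d \<Longrightarrow>
    (\<forall>x\<in>cball x0 (d/2). u x \<le> (L + \<eta>) * (norm (pr (x - m)) + \<eta> * d)) \<Longrightarrow>
    (\<exists>y\<in>U. \<exists>\<nu> g. norm \<nu> = 1 \<and> pr \<nu> = \<nu> \<and> (\<forall>h. frechet_derivative u (at y) h = g \<bullet> h) \<and>
      (\<forall>a. u y * frechet_derivative (\<lambda>z. frechet_derivative u (at z) a) (at y) a - (norm g)\<^sup>2 / 2 * (a \<bullet> a)
        \<le> (L\<^sup>2 / 2 + \<tau>) * (a \<bullet> a)) \<and>
      (\<forall>t s. pr t = 0 \<longrightarrow> (let a = t + s *\<^sub>R \<nu> in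
         u y * frechet_derivative (\<lambda>z. frechet_derivative u (at z) a) (at y) a - (norm g)\<^sup>2 / 2 * (a \<bullet> a)
        \<le> (- L\<^sup>2 / 2 + \<tau>) * (a \<bullet> a))))"
    by auto
  obtain b where b: "b > 0" "\<And>x. x \<in> U \<Longrightarrow> infdist x M' < b \<Longrightarrow> u x \<le> (L + \<eta>) * infdist x M'"
  proof -
    obtain b where b: "b > 0" "\<forall>r>0. r < b \<longrightarrow> (\<forall>x. \<phi> x \<notin> M \<longrightarrow> infdist x (\<phi> -` M) = r \<longrightarrow> v (\<phi> x) / w x \<le> (L + \<eta>) * r)"
      using eventually_upper_ratio[OF MS M(2,3) L \<eta>] unfolding eventually_at_right_field by auto
    show ?thesis
    proof (rule that[OF b(1)])
      fix x assume x: "x \<in> U" "infdist x M' < b"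
      hence "infdist x M' > 0" using infdist_pos_not_in_closed[OF cl ne] unfolding UM by blast
      thus "u x \<le> (L + \<eta>) * infdist x M'" using b(2) x unfolding U_def M'_def u_def by blast
    qed
  qed
  obtain r where r: "r > 0" "\<And>m t. \<phi> m \<in> M \<Longrightarrow> dist m q < r \<Longrightarrow> t \<in> T \<Longrightarrow> norm t < r \<Longrightarrow>
      \<exists>m'. \<phi> m' \<in> M \<and> norm (m' - m - t) \<le> \<eta> / 2 * norm t"
    using T(3)[of "\<eta> / 2"] \<eta> by (metis half_gt_zero)
  \<comment> \<open>Points z of the ball around x n satisfy |z - m n| \<le> 3d/2; with d below half
    of min b r this stays below both b and r.\<close>
  have "\<forall>\<^sub>F n in sequentially. dist (x n) (m n) < min b r / 2"
    using xm(6) by (rule order_tendstoD(2)) (use b(1) r(1) in simp)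
  moreover have "\<forall>\<^sub>F n in sequentially. dist (m n) q < r" using xm(4) r(1) by (rule tendstoD)
  moreover note xm(7)[OF \<eta>]
  ultimately have "\<forall>\<^sub>F n in sequentially. dist (x n) (m n) < min b r / 2 \<and> dist (m n) q < r \<and>
      v (\<phi> (x n)) / w (x n) \<ge> (L - \<eta>) * dist (x n) (m n)" by eventually_elim auto
  from eventually_happens[OF this] obtain n where n: "dist (x n) (m n) < min b r / 2" "dist (m n) q < r"
      "u (x n) \<ge> (L - \<eta>) * dist (x n) (m n)" unfolding u_def by auto
  define d where "d = dist (x n) (m n)"
  have infd: "infdist (x n) M' = d" unfolding M'_def d_def by (rule xm(5))
  have d: "d > 0" unfolding infd[symmetric]
    by (rule infdist_pos_not_in_closed[OF cl ne]) (use xm(1) in \<open>auto simp: M'_def\<close>)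
  have inU: "cball (x n) (d/2) \<subseteq> U"
  proof
    fix z assume "z \<in> cball (x n) (d/2)"
    hence "d \<le> infdist z M' + d / 2" using infdist_triangle[of "x n" M' z] infd by simp
    hence "infdist z M' > 0" using d by simp
    thus "z \<in> U" unfolding UM by auto
  qed
  have up: "\<forall>z\<in>cball (x n) (d/2). u z \<le> (L + \<eta>) * (norm (pr (z - m n)) + \<eta> * d)"
  proof
    fix z assume z: "z \<in> cball (x n) (d/2)"
    have "dist z (m n) \<le> dist z (x n) + dist (x n) (m n)" by (rule dist_triangle)
    hence zm: "norm (z - m n) \<le> 3 / 2 * d" using z by (simp add: dist_norm d_def norm_minus_commute)
    define t where "t = (z - m n) - pr (z - m n)"
    have tT: "t \<in> T" unfolding t_def by (rule pr(2))
    have "pr t = 0" by (rule pr(3)[OF tT])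
    hence "t \<bullet> pr (z - m n) = 0" by (metis inner_zero_left pr.selfadjoint)
    hence "t \<bullet> t = t \<bullet> (z - m n)" by (simp add: t_def inner_diff_right)
    also have "\<dots> \<le> norm t * norm (z - m n)" by (rule norm_cauchy_schwarz)
    finally have "norm t * norm t \<le> norm t * norm (z - m n)" by (simp add: power2_norm_eq_inner[symmetric] power2_eq_square)
    hence nt: "norm t \<le> norm (z - m n)" by (cases "t = 0") auto
    hence nt: "norm t \<le> 3 / 2 * d" using zm by linarith
    hence "norm t < r" using n(1) d unfolding d_def[symmetric] by linarith
    then obtain m' where m': "\<phi> m' \<in> M" "norm (m' - m n - t) \<le> \<eta> / 2 * norm t"
      using r(2)[OF xm(2) n(2) tT] by blast
    \<comment> \<open>Here m n + t is the foot of z on the plane, and m' is a point of the preimage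
      of M near that foot; \<eta>/2 times 3d/2 is below \<eta> d.\<close>
    have "infdist z M' \<le> dist z m'" using m'(1) by (intro infdist_le) (simp add: M'_def)
    also have "\<dots> = norm (pr (z - m n) - (m' - m n - t))" by (simp add: dist_norm t_def algebra_simps)
    also have "\<dots> \<le> norm (pr (z - m n)) + norm (m' - m n - t)" by (rule norm_triangle_ineq4)
    also have "norm (m' - m n - t) \<le> \<eta> / 2 * (3 / 2 * d)"
      using m'(2) mult_left_mono[OF nt, of "\<eta> / 2"] \<eta> by linarith
    also have "\<dots> \<le> \<eta> * d" using \<eta> d by simp
    finally have 1: "infdist z M' \<le> norm (pr (z - m n)) + \<eta> * d" by simp
    have "infdist z M' \<le> infdist (x n) M' + dist z (x n)" by (rule infdist_triangle)
    hence "infdist z M' < b" using z n(1) d unfolding infd d_def[symmetric] by (simp add: dist_commute)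
    hence "u z \<le> (L + \<eta>) * infdist z M'" using b(2) z inU by blast
    also have "\<dots> \<le> (L + \<eta>) * (norm (pr (z - m n)) + \<eta> * d)" using 1 L(2) \<eta> by (intro mult_left_mono) auto
    finally show "u z \<le> (L + \<eta>) * (norm (pr (z - m n)) + \<eta> * d)" .
  qed
  have "norm (pr (x n - m n)) \<le> d" using pr.norm_le[of "x n - m n"] by (simp add: d_def dist_norm)
  from touch[OF U _ inU upos d this n(3)[folded d_def] up] Cu
  obtain y \<nu> g where y: "y \<in> U" "norm \<nu> = 1" "pr \<nu> = \<nu>" "\<And>h. frechet_derivative u (at y) h = g \<bullet> h"
    "\<And>a. u y * frechet_derivative (\<lambda>z. frechet_derivative u (at z) a) (at y) a - (norm g)\<^sup>2 / 2 * (a \<bullet> a)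
        \<le> (L\<^sup>2 / 2 + \<tau>) * (a \<bullet> a)"
    "\<And>t s a. pr t = 0 \<Longrightarrow> a = t + s *\<^sub>R \<nu> \<Longrightarrow>
         u y * frechet_derivative (\<lambda>z. frechet_derivative u (at z) a) (at y) a - (norm g)\<^sup>2 / 2 * (a \<bullet> a)
        \<le> (- L\<^sup>2 / 2 + \<tau>) * (a \<bullet> a)"
    unfolding Let_def u_def U_def by blast
  \<comment> \<open>The directions in which the upper bound is negative: the tangential ones and
    \<nu>. The vector \<nu> adds a dimension because pr fixes it and kills T.\<close>
  define E where "E = span (insert \<nu> T)"
  have "\<nu> \<notin> T" using pr(3)[of \<nu>] y(2,3) by auto
  hence "\<nu> \<notin> span T" using T(1) by (metis span_eq_iff)
  hence dE: "dim E = p + 1" unfolding E_def using T(2) by (simp add: dim_insert)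
  have Ecase: "\<exists>t s. pr t = 0 \<and> a = t + s *\<^sub>R \<nu>" if aE: "a \<in> E" for a
  proof -
    obtain s where "a - s *\<^sub>R \<nu> \<in> span T" using aE unfolding E_def span_breakdown_eq by blast
    hence "a - s *\<^sub>R \<nu> \<in> T" using T(1) by (metis span_eq_iff)
    hence "pr (a - s *\<^sub>R \<nu>) = 0" by (rule pr(3))
    thus ?thesis by (intro exI[of _ "a - s *\<^sub>R \<nu>"] exI[of _ s]) simp
  qed
  show ?thesis
  proof (rule that[of y E g])
    show "Q g y a \<le> (- L\<^sup>2 / 2 + \<tau>) * (a \<bullet> a)" if "a \<in> E" for a
      using Ecase[OF that] y(6) unfolding Q_def u_def by blast
    show "Q g y a \<le> (L\<^sup>2 / 2 + \<tau>) * (a \<bullet> a)" for a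
      using y(5)[of a] unfolding Q_def u_def .
    show "frechet_derivative (\<lambda>x. v (\<phi> x) / w x) (at y) h = g \<bullet> h" for h
      using y(4)[of h] unfolding u_def .
  qed (use y(1) dE in \<open>auto simp: U_def E_def\<close>)
qed

lemma Ck_on_conformal_factor:
  assumes M: "compact M" and v: "sph_smooth_on (Sph - M) v"
  shows "Ck_on m {x. \<phi> x \<notin> M} (\<lambda>x. v (\<phi> x) / w x)"
proof -
  have "{x. \<phi> x \<notin> M} = - (\<phi> -` M)" by auto
  hence U: "open {x. \<phi> x \<notin> M}" using closed_phi_vimage[OF compact_imp_closed[OF M]] by (simp add: open_Compl)
  have "smooth_on {x. \<phi> x \<notin> M} (\<lambda>x. v (\<phi> x))"
    using v sph_param_phi[OF U] phi_in_Sph unfolding sph_smooth_on_def by blast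
  hence "Ck_on m {x. \<phi> x \<notin> M} (\<lambda>x. v (\<phi> x))" by (simp add: smooth_on_def)
  hence "Ck_on m {x. \<phi> x \<notin> M} (\<lambda>x. v (\<phi> x) * inverse (w x))"
    using w_pos by (intro Ck_on_mult[OF U] Ck_on_inverse[OF U] Ck_on_w[OF U]) (auto simp: less_imp_neq[symmetric])
  thus ?thesis by (simp add: divide_inverse)
qed

text \<open>The bound covers every \<open>lam\<close>, because the curvature equation provides some
  list of eigenvalues in no particular order.\<close>

lemma schouten_eigenvalue_bounds:
  assumes n: "CARD('n) > 2"
    and M: "closed_submanifold p M" "N \<notin> M" "M \<noteq> {}" and v: "\<And>q. q \<in> Sph - M \<Longrightarrow> v q > 0"
    and v_smooth: "sph_smooth_on (Sph - M) v"
    and L: "Limsup (approaching M) (\<lambda>x. ereal (v x / sph_setdist x M)) = ereal L" "L > 0" and \<tau>: "\<tau> > 0"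
  obtains y where "\<phi> y \<notin> M"
    "\<And>lam. eigenvalue_vector (matrix_inv (conf_metric v \<phi> y) ** schouten (conf_metric v \<phi>) y) lam \<Longrightarrow>
      \<exists>(d :: 'n \<Rightarrow> real) J. (\<forall>j. esym_on d UNIV j = esym j lam) \<and> card J = p + 1 \<and>
        (\<forall>i. d i \<le> L\<^sup>2 / 2 + \<tau>) \<and> (\<forall>i\<in>J. d i \<le> - (L\<^sup>2 / 2) + \<tau>)"
proof -
  have MS: "compact M" "M \<subseteq> Sph" using M(1) by (auto simp: closed_submanifold_def)
  define u where "u = (\<lambda>x. v (\<phi> x) / w x)"
  define U where "U = {x. \<phi> x \<notin> M}"
  have "U = - (\<phi> -` M)" by (auto simp: U_def)
  hence U: "open U" using closed_phi_vimage[OF compact_imp_closed[OF MS(1)]] by (simp add: open_Compl)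
  have Cu: "Ck_on 2 U u" unfolding U_def u_def by (rule Ck_on_conformal_factor[OF MS(1) v_smooth])
  have upos: "u x > 0" if "x \<in> U" for x
    using that v phi_in_Sph w_pos by (auto simp: u_def U_def intro!: divide_pos_pos)
  obtain y g E where y: "\<phi> y \<notin> M" "subspace E" "dim E = p + 1" "\<And>h. frechet_derivative u (at y) h = g \<bullet> h"
    "\<And>a. u y * frechet_derivative (\<lambda>z. frechet_derivative u (at z) a) (at y) a - (norm g)\<^sup>2 / 2 * (a \<bullet> a)
      \<le> (L\<^sup>2 / 2 + \<tau>) * (a \<bullet> a)"
    "\<And>a. a \<in> E \<Longrightarrow> u y * frechet_derivative (\<lambda>z. frechet_derivative u (at z) a) (at y) a - (norm g)\<^sup>2 / 2 * (a \<bullet> a)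
      \<le> (- L\<^sup>2 / 2 + \<tau>) * (a \<bullet> a)"
  proof (rule asymptotic_quadratic_form[OF M v L Cu[unfolded U_def u_def] \<tau>], goal_cases)
    case (1 q)
    show ?case by (rule 1(2))
  next
    case (2 y g E)
    have "v (\<phi> z) / w z = u z" for z by (simp add: u_def)
    from 2(2-)[unfolded this] show ?case by (rule that)
  qed
  have yU: "y \<in> U" using y(1) by (simp add: U_def)
  define G where "G = conf_metric v \<phi>"
  define A where "A = matrix_inv (G y) ** schouten G y"
  have "G z = (1 / (u z)\<^sup>2) *\<^sub>R mat 1" for z unfolding G_def u_def by (rule conf_metric_phi)
  with upos have cfs: "matrix_inv (G y) ** schouten G y =
      (\<chi> i j. u y * pd i (pd j u) y - (if i = j then (\<Sum>m\<in>UNIV. (pd m u y)\<^sup>2) / 2 else 0))"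
    by (intro conformally_flat_schouten[OF n U Cu _ _ yU])
  have g2: "(\<Sum>m\<in>UNIV. (pd m u y)\<^sup>2) = (norm g)\<^sup>2"
    unfolding pd_def y(4) by (simp add: inner_axis power2_norm_eq_inner) (simp add: inner_vec_def power2_eq_square)
  have A: "A $ i $ j = u y * pd i (pd j u) y - (if i = j then (norm g)\<^sup>2 / 2 else 0)" for i j
    unfolding A_def cfs g2 by simp
  have "pd i (pd j u) y = pd j (pd i u) y" for i j
    using second_derivative_symmetric[OF U Cu yU] unfolding pd_def[abs_def] by blast
  hence sym: "transpose A = A" by (auto simp: vec_eq_iff transpose_def A)
  have form: "\<xi> \<bullet> (A *v \<xi>) = u y * frechet_derivative (\<lambda>z. frechet_derivative u (at z) \<xi>) (at y) \<xi> - (norm g)\<^sup>2 / 2 * (\<xi> \<bullet> \<xi>)" for \<xi>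
  proof -
    have "\<xi> \<bullet> (A *v \<xi>) = (\<Sum>i\<in>UNIV. \<Sum>j\<in>UNIV. \<xi> $ i * (A $ i $ j * \<xi> $ j))"
      by (simp add: inner_vec_def matrix_vector_mult_def sum_distrib_left)
    also have "\<dots> = (\<Sum>i\<in>UNIV. \<Sum>j\<in>UNIV. u y * (\<xi> $ i * \<xi> $ j * pd i (pd j u) y)
        - (if i = j then (norm g)\<^sup>2 / 2 * (\<xi> $ i * \<xi> $ i) else 0))"
      unfolding A by (intro sum.cong refl) (auto simp: algebra_simps)
    also have "\<dots> = u y * (\<Sum>i\<in>UNIV. \<Sum>j\<in>UNIV. \<xi> $ i * \<xi> $ j * pd i (pd j u) y) - (norm g)\<^sup>2 / 2 * (\<xi> \<bullet> \<xi>)"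
      by (simp add: sum_subtractf sum_distrib_left inner_vec_def)
    finally show ?thesis unfolding second_derivative_eq_sum_pd[OF U Cu yU] .
  qed
  show ?thesis
  proof (rule that[OF y(1)])
    fix lam assume "eigenvalue_vector (matrix_inv (conf_metric v \<phi> y) ** schouten (conf_metric v \<phi>) y) lam"
    hence lam: "eigenvalue_vector A lam" by (simp add: A_def G_def)
    obtain d :: "'n \<Rightarrow> real" and J where dJ: "\<And>j. esym_on d UNIV j = esym j lam" "card J = p + 1"
      "\<And>i. d i \<le> L\<^sup>2 / 2 + \<tau>" "\<And>i. i \<in> J \<Longrightarrow> d i \<le> - L\<^sup>2 / 2 + \<tau>"
      by (rule eigenvalue_bounds_of_quadratic_form[OF sym lam _ y(2,3), of "L\<^sup>2 / 2 + \<tau>" "- L\<^sup>2 / 2 + \<tau>"])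
        (use y(5,6) in \<open>auto simp: form\<close>)
    thus "\<exists>(d :: 'n \<Rightarrow> real) J. (\<forall>j. esym_on d UNIV j = esym j lam) \<and> card J = p + 1 \<and>
        (\<forall>i. d i \<le> L\<^sup>2 / 2 + \<tau>) \<and> (\<forall>i\<in>J. d i \<le> - (L\<^sup>2 / 2) + \<tau>)"
      by (intro exI[of _ d] exI[of _ J]) auto
  qed
qed

end

theorem theorem3p1:
  fixes M :: "((real^'n) \<times> real) set"
    and v :: "(real^'n) \<times> real \<Rightarrow> real"
    and k p :: nat and \<kappa> :: real
  assumes k: "1 < k" "real k < real CARD('n) / 2"
    and M: "closed_submanifold p M" "M \<noteq> {}" "M \<noteq> Sph"
    and v_pos: "\<And>q. q \<in> Sph - M \<Longrightarrow> v q > 0"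
    and v_smooth: "sph_smooth_on (Sph - M) v"
    and complete: "conf_complete (Sph - M) v"
    and kappa: "\<kappa> > 0"
    and eqn: "\<And>U \<phi> x. sph_param U \<phi> \<Longrightarrow> \<phi> ` U \<subseteq> Sph - M \<Longrightarrow> x \<in> U \<Longrightarrow>
      \<exists>lam. eigenvalue_vector
              (matrix_inv (conf_metric v \<phi> x) ** schouten (conf_metric v \<phi>) x) lam \<and>
            lam \<in> garding_cone k \<and> esym k lam = \<kappa>"
    and L: "0 < Limsup (approaching M) (\<lambda>x. ereal (v x / sph_setdist x M))"
           "Limsup (approaching M) (\<lambda>x. ereal (v x / sph_setdist x M)) < \<infinity>"
  shows "real p < p_crit k CARD('n)"
proof -
  have MS: "compact M" "M \<subseteq> Sph" using M(1) by (auto simp: closed_submanifold_def)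
  \<comment> \<open>A point off M serves as the pole, so that the chart covers M.\<close>
  then obtain N where N: "N \<in> Sph" "N \<notin> M" using M(3) by blast
  have "norm N = 1" using N(1) by simp
  then obtain J where "stereographic N J" by (rule stereographic_exists)
  then interpret stereographic N J .
  obtain L' where L': "Limsup (approaching M) (\<lambda>x. ereal (v x / sph_setdist x M)) = ereal L'" "L' > 0"
    using L by (cases "Limsup (approaching M) (\<lambda>x. ereal (v x / sph_setdist x M))") auto
  have "{x. \<phi> x \<notin> M} = - (\<phi> -` M)" by auto
  hence U: "open {x. \<phi> x \<notin> M}" using closed_phi_vimage[OF compact_imp_closed[OF MS(1)]] by (simp add: open_Compl)
  have n: "CARD('n) > 2" using k by linarith
  have ex: "\<exists>(f :: 'n \<Rightarrow> real) J. (\<forall>j\<in>{1..k}. esym_on f UNIV j > 0) \<and> esym_on f UNIV k = \<kappa> \<and>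
      J \<subseteq> UNIV \<and> card J = p + 1 \<and> (\<forall>i\<in>UNIV. f i \<le> L'\<^sup>2 / 2 + \<tau>) \<and> (\<forall>i\<in>J. f i \<le> - (L'\<^sup>2 / 2) + \<tau>)"
    if \<tau>: "\<tau> > 0" for \<tau>
  proof -
    obtain y where y: "\<phi> y \<notin> M"
      "\<And>lam. eigenvalue_vector (matrix_inv (conf_metric v \<phi> y) ** schouten (conf_metric v \<phi>) y) lam \<Longrightarrow>
      \<exists>(d :: 'n \<Rightarrow> real) J. (\<forall>j. esym_on d UNIV j = esym j lam) \<and> card J = p + 1 \<and>
        (\<forall>i. d i \<le> L'\<^sup>2 / 2 + \<tau>) \<and> (\<forall>i\<in>J. d i \<le> - (L'\<^sup>2 / 2) + \<tau>)"
      using schouten_eigenvalue_bounds[OF n M(1) N(2) M(2) v_pos v_smooth L' \<tau>] by blast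
    have "\<phi> ` {x. \<phi> x \<notin> M} \<subseteq> Sph - M" using phi_in_Sph by blast
    from eqn[OF sph_param_phi[OF U] this, of y] y(1) obtain lam where
      lam: "eigenvalue_vector (matrix_inv (conf_metric v \<phi> y) ** schouten (conf_metric v \<phi>) y) lam"
        "lam \<in> garding_cone k" "esym k lam = \<kappa>" by auto
    obtain d :: "'n \<Rightarrow> real" and J where dJ: "\<forall>j. esym_on d UNIV j = esym j lam" "card J = p + 1"
      "\<forall>i. d i \<le> L'\<^sup>2 / 2 + \<tau>" "\<forall>i\<in>J. d i \<le> - (L'\<^sup>2 / 2) + \<tau>"
      using y(2)[OF lam(1)] by blast
    show ?thesis
      by (intro exI[of _ d] exI[of _ J]) (use dJ lam(2,3) in \<open>simp add: garding_cone_def\<close>)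
  qed
  \<comment> \<open>The index set J with p + 1 elements, for a single \<tau>, already shows p <
    n.\<close>
  have "p + 1 \<le> CARD('n)"
    using ex[of 1] card_mono[OF finite subset_UNIV] by (metis zero_less_one)
  hence pn: "p < CARD('n)" by simp
  have a: "L'\<^sup>2 / 2 > 0" using L'(2) by simp
  have "c_coeff CARD('n) (real p) j > 0" if "j \<in> {1..k}" for j
    by (rule c_coeff_pos[OF a kappa finite refl pn ex that])
  thus ?thesis using k(1) by (intro less_p_crit) auto
qed

end
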